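(* Let $X:=x^1\partial_1+x^2\partial_2$. Let $\mathcal{N}$ be a Type $\mathcal{B}$ model with torsion parameters $T=(T^1,T^2)$ such that $\dim\mathfrak{K}(\mathcal{N})>2$. Then $\mathcal{N}$ is linearly equivalent to one of the following models $\mathcal{N}_i^j(\star;T)$, with $T=(T^1,T^2)\in\mathbb{R}^2$ restricted to the values listed and with $\mathfrak{K}$ as listed; for the values of $T$ not listed, the given model has $\mathfrak{K}=\mathrm{span}\{X,\partial_2\}$. (1) $\mathcal{N}_0^6(T):=\mathcal{N}(0,0,T^1,T^2,-T^1,-T^2,0,0)$: (a) $\mathfrak{K}(\mathcal{N}_0^6(0))=\mathrm{span}\{\partial_1,\partial_2,x^1\partial_1,x^1\partial_2,x^2\partial_1,x^2\partial_2\}$; (b) $\mathfrak{K}(\mathcal{N}_0^6(0,T^2))=\mathrm{span}\{X,\partial_2,x^1\partial_2,x^2\partial_2\}$ if $T^2\ne0$. (2) $\mathcal{N}_1^6(\pm;T):=\mathcal{N}(1,0,T^1,T^2,-T^1,-T^2,\pm1,0)$. Then $T=0$ and $\mathfrak{K}(\mathcal{N}_1^6(\pm;0))=\mathrm{span}\{X,\partial_2,\frac1{x^1}\partial_1,\frac{x^2}{x^1}\partial_1,\frac{(x^1)^2\pm(x^2)^2}{x^1}\partial_1,\frac{-x^2((x^2)^2\pm(x^1)^2)}{x^1}\partial_1+((x^1)^2\pm(x^2)^2)\partial_2\}$. (3) $\mathcal{N}_2^6(c;T):=\mathcal{N}(-1+c,0,T^1,c+T^2,-T^1,c-T^2,0,0)$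 for $c\in\mathbb{R}$, $c\ne0$. Then $T^1T^2=0$ and (a) $\mathfrak{K}(\mathcal{N}_2^6(c;0))=\mathrm{span}\{x^1\partial_1,x^2\partial_2,\partial_2,(x^1)^{-c}\partial_2,(x^1)^{-c}(x^1\partial_1-cx^2\partial_2),x^2(x^1\partial_1-cx^2\partial_2)\}$; (b) $\mathfrak{K}(\mathcal{N}_2^6(c;(0,T^2)))=\mathrm{span}\{X,\partial_2,x^2\partial_2,(x^1)^{-c}\partial_2\}$ if $T^2\ne0$; (c) $\mathfrak{K}(\mathcal{N}_2^6(-\frac12;(T^1,0)))=\mathrm{span}\{X,\partial_2,x^2(x^1\partial_1+\frac12x^2\partial_2)\}$ if $T^1\ne0$. (4) $\mathcal{N}_3^6(T):=\mathcal{N}(-2,1,T^1,-1+T^2,-T^1,-1-T^2,0,0)$. Then $T^1=0$ and (a) $\mathfrak{K}(\mathcal{N}_3^6(0))=\mathrm{span}\{X,\partial_2,x^1\partial_2,(x^2+x^1\log x^1)\partial_2,-(x^1)^2\partial_1+x^1(x^1-x^2)\partial_2,(x^2+x^1\log x^1)(-x^1\partial_1+(x^1-x^2)\partial_2)\}$; (b) $\mathfrak{K}(\mathcal{N}_3^6(0,T^2))=\mathrm{span}\{X,\partial_2,x^1\partial_2,(x^2+x^1\log x^1)\partial_2\}$ if $T^2\ne0$. (5) $\mathcal{N}_4^6(T):=\mathcal{N}(0,1,T^1,T^2,-T^1,-T^2,0,0)$. Then $T^1=0$ and (a) $\mathfrak{K}(\mathcal{N}_4^6(0))=\mathrm{span}\{X,\partial_2,x^1\partial_2,(x^2+x^1\log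 x^1)\partial_2,\partial_1-(1+\log x^1)\partial_2,(x^2+x^1\log x^1)(\partial_1-(1+\log x^1)\partial_2)\}$; (b) $\mathfrak{K}(\mathcal{N}_4^6(0,T^2))=\mathrm{span}\{X,\partial_2,x^1\partial_2,(x^2+x^1\log x^1)\partial_2\}$ if $T^2\ne0$. (6) $\mathcal{N}_5^6(T):=\mathcal{N}(-1,0,T^1,T^2,-T^1,-T^2,0,0)$. Then $T^1=0$ and (a) $\mathfrak{K}(\mathcal{N}_5^6(0))=\mathrm{span}\{X,\partial_2,x^2\partial_2,x^1x^2\partial_1,\log x^1\,\partial_2,x^1\log x^1\,\partial_1\}$; (b) $\mathfrak{K}(\mathcal{N}_5^6(0,T^2))=\mathrm{span}\{X,\partial_2,x^2\partial_2,\log x^1\,\partial_2\}$ if $T^2\ne0$. (7) $\mathcal{N}_6^6(c;T):=\mathcal{N}(c,0,T^1,T^2,-T^1,-T^2,0,0)$ for $c\in\mathbb{R}$, $c\ne0,-1$. Then $T^1=0$ and (a) $\mathfrak{K}(\mathcal{N}_6^6(c;0))=\mathrm{span}\{X,\partial_2,x^2\partial_2,(x^1)^{-c}\partial_1,(x^1)^{-c}x^2\partial_1,(x^1)^{c+1}\partial_2\}$; (b) $\mathfrak{K}(\mathcal{N}_6^6(c;(0,T^2)))=\mathrm{span}\{X,\partial_2,x^2\partial_2,(x^1)^{c+1}\partial_2\}$ if $T^2\ne0$. (8) $\mathcal{N}_1^4(\kappa;T):=\mathcal{N}(2\kappa,1,T^1,T^2+\kappa,-T^1,-T^2+\kappa,0,0)$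 for $\kappa\in\mathbb{R}$, $\kappa\ne0,-1$. Then $T^1=0$ and $\mathfrak{K}(\mathcal{N}_1^4(\kappa;(0,T^2)))=\mathrm{span}\{X,\partial_2,x^1\partial_2,x^1(\partial_1-\log x^1\,\partial_2)\}$. (9) $\mathcal{N}_2^4(\kappa,\theta;T):=\mathcal{N}(-1+\theta+2\kappa,0,T^1,T^2+\kappa,-T^1,-T^2+\kappa,0,0)$ for $\kappa,\theta\in\mathbb{R}$ with $\theta\ne0$ and $\kappa(\kappa+\theta)\ne0$. Then $T^1=0$ and $\mathfrak{K}(\mathcal{N}_2^4(\kappa,\theta;(0,T^2)))=\mathrm{span}\{X,\partial_2,x^2\partial_2,(x^1)^\theta\partial_2\}$. (10) $\mathcal{N}_3^4(c;T):=\mathcal{N}(2c-1,0,T^1,T^2+c,-T^1,-T^2+c,0,0)$ for $c\in\mathbb{R}$, $c\ne0$. Then $T^1=0$ and $\mathfrak{K}(\mathcal{N}_3^4(c;(0,T^2)))=\mathrm{span}\{X,\partial_2,x^2\partial_2,\log x^1\,\partial_2\}$. (11) $\mathcal{N}_1^3(\pm;T):=\mathcal{N}(-\frac32,0,T^1,-\frac12+T^2,-T^1,-\frac12-T^2,\pm\frac12,0)$. Then $T^2=0$ and $\mathfrak{K}(\mathcal{N}_1^3(\pm;(T^1,0)))=\mathrm{span}\{X,\partial_2,x^2(2x^1\partial_1+x^2\partial_2)\}$. (12) $\mathcal{N}_2^3(c;T):=\mathcal{N}(-\frac32,0,1+T^1,-\frac12+T^2,1-T^1,-\frac12-T^2,c,2)$,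 $c\in\mathbb{R}$. Then $T^2=0$ and $\mathfrak{K}(\mathcal{N}_2^3(c;(T^1,0)))=\mathrm{span}\{X,\partial_2,x^2(2x^1\partial_1+x^2\partial_2)\}$. (13) $\mathcal{N}_3^3(T):=\mathcal{N}(-1,0,T^1,-1+T^2,-T^1,-1-T^2,-1,0)$. Then $T=0$ and $\mathfrak{K}(\mathcal{N}_3^3(0))=\mathrm{span}\{X,\partial_2,2x^1x^2\partial_1+((x^2)^2+(x^1)^2)\partial_2\}$. (14) $\mathcal{N}_4^3(T):=\mathcal{N}(-1,0,T^1,-1+T^2,-T^1,-1-T^2,1,0)$. Then $T=0$ and $\mathfrak{K}(\mathcal{N}_4^3(0))=\mathrm{span}\{X,\partial_2,2x^1x^2\partial_1+((x^2)^2-(x^1)^2)\partial_2\}$. (Here "Then $T^1=0$", etc., means that this condition on $T$ is necessary for the given model to satisfy $\dim\mathfrak{K}>2$.)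
   Context: For $\vec\xi=(\xi_1,\dots,\xi_8)\in\mathbb{R}^8$, $\mathcal{N}(\vec\xi)=(\mathbb{R}^+\times\mathbb{R},\nabla)$ denotes the affine surface with coordinates $(x^1,x^2)$, $x^1>0$, whose Christoffel symbols ($\nabla_{\partial_i}\partial_j=\Gamma_{ij}^k\partial_k$, $\partial_k=\partial/\partial x^k$, sums over repeated indices) are $$\begin{array}{llll}\Gamma_{11}^1=\frac{\xi_1}{x^1},&\Gamma_{11}^2=\frac{\xi_2}{x^1},&\Gamma_{12}^1=\frac{\xi_3}{x^1},&\Gamma_{12}^2=\frac{\xi_4}{x^1},\\ \Gamma_{21}^1=\frac{\xi_5}{x^1},&\Gamma_{21}^2=\frac{\xi_6}{x^1},&\Gamma_{22}^1=\frac{\xi_7}{x^1},&\Gamma_{22}^2=\frac{\xi_8}{x^1}.\end{array}$$ These are the Type $\mathcal{B}$ models (torsion is allowed and may vanish). The torsion parameters $T=(T^1,T^2)$ are the constants with $\frac12(\Gamma_{12}^i-\Gamma_{21}^i)=(x^1)^{-1}T^i$. Two Type $\mathcal{B}$ models are linearly equivalent if they are related by a change of coordinates $(x^1,x^2)\mapsto(x^1,bx^1+ax^2)$ with $a,b\in\mathbb{R}$, $a\ne0$ (this group acts linearly on the parameter space $\mathbb{R}^8$). A smooth vector field $Y=v^1\partial_1+v^2\partial_2$ is an affine Killing vector field if the Lie derivative of $\nabla$ with respect to $Y$ vanishes; equivalently, for all $1\le i,j,k\le2$, $$0=\frac{\partial^2 v^k}{\partial x^i\partial x^j}+v^l\frac{\partial\Gamma_{ij}^k}{\partial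 x^l}-\Gamma_{ij}^l\frac{\partial v^k}{\partial x^l}+\Gamma_{il}^k\frac{\partial v^l}{\partial x^j}+\Gamma_{lj}^k\frac{\partial v^l}{\partial x^i}.$$ $\mathfrak{K}(\mathcal{N})$ is the real Lie algebra of affine Killing vector fields on $\mathcal{N}$; spans are over $\mathbb{R}$. For a Type $\mathcal{B}$ model, $X,\partial_2\in\mathfrak{K}(\mathcal{N})$. In items with a sign $\pm$, the same choice of sign is made throughout the item.
   Formalization: The torsion parameters T of the listed model are not required to equal those of N (a linear equivalence changes them to (T¹/a, T²+(b/a)T¹)); with literally equal T the claim fails, e.g. for N(-3/2,0,1,-1/2,-1,-1/2,5,0). *)

theory Defs
  imports "HOL-Analysis.Analysis" "HOL-Library.Function_Algebras"
begin

text \<open>Pointwise real vector space structure on functions, so that the library's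
  \<^const>\<open>span\<close> and \<^const>\<open>dim\<close> apply to vector fields.\<close>

instantiation "fun" :: (type, real_vector) real_vector
begin

definition scaleR_fun :: "real \<Rightarrow> ('a \<Rightarrow> 'b) \<Rightarrow> 'a \<Rightarrow> 'b"
  where "scaleR_fun c f = (\<lambda>x. c *\<^sub>R f x)"

instance
  by standard (simp_all add: scaleR_fun_def fun_eq_iff scaleR_add_right scaleR_add_left)

end

definition half_plane :: "(real^2) set"
  where "half_plane = {p. 0 < p$1}"

definition pd :: "2 \<Rightarrow> (real^2 \<Rightarrow> real) \<Rightarrow> real^2 \<Rightarrow> real"
  where "pd i f p = frechet_derivative f (at p) (axis i 1)"

primrec Ck_on :: "nat \<Rightarrow> 'a::real_normed_vector set \<Rightarrow> ('a \<Rightarrow> 'b::real_normed_vector) \<Rightarrow> bool"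
  where
    "Ck_on 0 S f \<longleftrightarrow> continuous_on S f"
  | "Ck_on (Suc n) S f \<longleftrightarrow>
      (\<forall>x\<in>S. f differentiable (at x)) \<and> (\<forall>v. Ck_on n S (\<lambda>x. frechet_derivative f (at x) v))"

text \<open>Only meaningful for open sets \<open>S\<close>.\<close>

definition smooth_on :: "'a::real_normed_vector set \<Rightarrow> ('a \<Rightarrow> 'b::real_normed_vector) \<Rightarrow> bool"
  where "smooth_on S f \<longleftrightarrow> (\<forall>n. Ck_on n S f)"

text \<open>\<open>christoffel \<xi> p i j k\<close> is the coefficient of \<open>\<partial>\<^sub>k\<close> in the covariant derivative of
  \<open>\<partial>\<^sub>j\<close> in the direction \<open>\<partial>\<^sub>i\<close>, at the point \<open>p\<close> of the model with parameters \<open>\<xi>\<close>.\<close>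

definition christoffel :: "real^8 \<Rightarrow> real^2 \<Rightarrow> 2 \<Rightarrow> 2 \<Rightarrow> 2 \<Rightarrow> real"
  where "christoffel \<xi> p i j k =
    (if i = 1
     then (if j = 1 then (if k = 1 then \<xi>$1 else \<xi>$2) else (if k = 1 then \<xi>$3 else \<xi>$4))
     else (if j = 1 then (if k = 1 then \<xi>$5 else \<xi>$6) else (if k = 1 then \<xi>$7 else \<xi>$8)))
    / p$1"

definition torsion_params :: "real^8 \<Rightarrow> real \<Rightarrow> real \<Rightarrow> bool"
  where "torsion_params \<xi> T1 T2 \<longleftrightarrow>
    (\<forall>p\<in>half_plane.
      (christoffel \<xi> p 1 2 1 - christoffel \<xi> p 2 1 1) / 2 = T1 / p$1 \<and>
      (christoffel \<xi> p 1 2 2 - christoffel \<xi> p 2 1 2) / 2 = T2 / p$1)"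

text \<open>The change of coordinates \<open>\<Phi>\<close> carries the connection with parameters \<open>\<xi>\<close> to the one with
  parameters \<open>\<eta>\<close>: the general (inhomogeneous) transformation law of Christoffel symbols.\<close>

definition transforms_connection :: "(real^2 \<Rightarrow> real^2) \<Rightarrow> real^8 \<Rightarrow> real^8 \<Rightarrow> bool"
  where "transforms_connection \<Phi> \<xi> \<eta> \<longleftrightarrow>
    (\<forall>p\<in>half_plane. \<forall>i j l.
      pd i (pd j (\<lambda>q. \<Phi> q $ l)) p
      + (\<Sum>m\<in>UNIV. \<Sum>n\<in>UNIV.
          pd i (\<lambda>q. \<Phi> q $ m) p * pd j (\<lambda>q. \<Phi> q $ n) p * christoffel \<eta> (\<Phi> p) m n l)
      = (\<Sum>k\<in>UNIV. christoffel \<xi> p i j k * pd k (\<lambda>q. \<Phi> q $ l) p))"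

definition linearly_equivalent :: "real^8 \<Rightarrow> real^8 \<Rightarrow> bool"
  where "linearly_equivalent \<xi> \<eta> \<longleftrightarrow>
    (\<exists>a b. a \<noteq> 0 \<and> transforms_connection (\<lambda>p. vector [p$1, b * p$1 + a * p$2]) \<xi> \<eta>)"

text \<open>A vector field on the half plane is represented by its extension by zero to the whole plane;
  this makes equality of vector fields the equality of functions.\<close>

definition killing :: "real^8 \<Rightarrow> (real^2 \<Rightarrow> real^2) set"
  where "killing \<xi> = {Y. (\<forall>p. p \<notin> half_plane \<longrightarrow> Y p = 0) \<and> smooth_on half_plane Y \<and>
    (\<forall>p\<in>half_plane. \<forall>i j k.
      0 = pd i (pd j (\<lambda>q. Y q $ k)) p
        + (\<Sum>l\<in>UNIV.
              Y p $ l * pd l (\<lambda>q. christoffel \<xi> q i j k) p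
            - christoffel \<xi> p i j l * pd l (\<lambda>q. Y q $ k) p
            + christoffel \<xi> p i l k * pd j (\<lambda>q. Y q $ l) p
            + christoffel \<xi> p l j k * pd i (\<lambda>q. Y q $ l) p))}"

text \<open>\<open>vf (\<lambda>x y. (f x y, g x y))\<close> is the vector field \<open>f \<partial>\<^sub>1 + g \<partial>\<^sub>2\<close> on the half plane,
  with \<open>x\<close> and \<open>y\<close> the two coordinates.\<close>

definition vf :: "(real \<Rightarrow> real \<Rightarrow> real \<times> real) \<Rightarrow> real^2 \<Rightarrow> real^2"
  where "vf F = (\<lambda>p. if p \<in> half_plane
    then vector [fst (F (p$1) (p$2)), snd (F (p$1) (p$2))] else 0)"

definition XX :: "real^2 \<Rightarrow> real^2"
  where "XX = vf (\<lambda>x y. (x, y))"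

definition D1 :: "real^2 \<Rightarrow> real^2"
  where "D1 = vf (\<lambda>x y. (1, 0))"

definition D2 :: "real^2 \<Rightarrow> real^2"
  where "D2 = vf (\<lambda>x y. (0, 1))"

text \<open>\<open>Nd_i \<dots> T1 T2\<close> is the model \<open>N\<^sub>i\<^sup>d(\<dots>; T1, T2)\<close>; a sign is passed as \<open>s = 1\<close> or \<open>s = - 1\<close>.\<close>

definition N6_0 :: "real \<Rightarrow> real \<Rightarrow> real^8"
  where "N6_0 T1 T2 = vector [0, 0, T1, T2, - T1, - T2, 0, 0]"

definition N6_1 :: "real \<Rightarrow> real \<Rightarrow> real \<Rightarrow> real^8"
  where "N6_1 s T1 T2 = vector [1, 0, T1, T2, - T1, - T2, s, 0]"

definition N6_2 :: "real \<Rightarrow> real \<Rightarrow> real \<Rightarrow> real^8"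
  where "N6_2 c T1 T2 = vector [- 1 + c, 0, T1, c + T2, - T1, c - T2, 0, 0]"

definition N6_3 :: "real \<Rightarrow> real \<Rightarrow> real^8"
  where "N6_3 T1 T2 = vector [- 2, 1, T1, - 1 + T2, - T1, - 1 - T2, 0, 0]"

definition N6_4 :: "real \<Rightarrow> real \<Rightarrow> real^8"
  where "N6_4 T1 T2 = vector [0, 1, T1, T2, - T1, - T2, 0, 0]"

definition N6_5 :: "real \<Rightarrow> real \<Rightarrow> real^8"
  where "N6_5 T1 T2 = vector [- 1, 0, T1, T2, - T1, - T2, 0, 0]"

definition N6_6 :: "real \<Rightarrow> real \<Rightarrow> real \<Rightarrow> real^8"
  where "N6_6 c T1 T2 = vector [c, 0, T1, T2, - T1, - T2, 0, 0]"

definition N4_1 :: "real \<Rightarrow> real \<Rightarrow> real \<Rightarrow> real^8"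
  where "N4_1 \<kappa> T1 T2 = vector [2 * \<kappa>, 1, T1, T2 + \<kappa>, - T1, - T2 + \<kappa>, 0, 0]"

definition N4_2 :: "real \<Rightarrow> real \<Rightarrow> real \<Rightarrow> real \<Rightarrow> real^8"
  where "N4_2 \<kappa> \<theta> T1 T2 =
    vector [- 1 + \<theta> + 2 * \<kappa>, 0, T1, T2 + \<kappa>, - T1, - T2 + \<kappa>, 0, 0]"

definition N4_3 :: "real \<Rightarrow> real \<Rightarrow> real \<Rightarrow> real^8"
  where "N4_3 c T1 T2 = vector [2 * c - 1, 0, T1, T2 + c, - T1, - T2 + c, 0, 0]"

definition N3_1 :: "real \<Rightarrow> real \<Rightarrow> real \<Rightarrow> real^8"
  where "N3_1 s T1 T2 =
    vector [- 3/2, 0, T1, - 1/2 + T2, - T1, - 1/2 - T2, s * (1/2), 0]"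

definition N3_2 :: "real \<Rightarrow> real \<Rightarrow> real \<Rightarrow> real^8"
  where "N3_2 c T1 T2 =
    vector [- 3/2, 0, 1 + T1, - 1/2 + T2, 1 - T1, - 1/2 - T2, c, 2]"

definition N3_3 :: "real \<Rightarrow> real \<Rightarrow> real^8"
  where "N3_3 T1 T2 = vector [- 1, 0, T1, - 1 + T2, - T1, - 1 - T2, - 1, 0]"

definition N3_4 :: "real \<Rightarrow> real \<Rightarrow> real^8"
  where "N3_4 T1 T2 = vector [- 1, 0, T1, - 1 + T2, - T1, - 1 - T2, 1, 0]"

end

theory Submission
  imports Defs
begin

text \<open>Every Killing field is determined by its 1-jet at a point, so \<open>K(N)\<close> is finite-dimensional, and it is
  stable under \<open>ad \<partial>\<^sub>2\<close> and under homotheties.  Homotheties rescale \<open>ad \<partial>\<^sub>2\<close>, which is therefore nilpotent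
  modulo \<open>span {X, \<partial>\<^sub>2}\<close>.  Hence if \<open>dim K(N) > 2\<close> there is a Killing field \<open>Y\<close> outside \<open>span {X, \<partial>\<^sub>2}\<close> with
  \<open>[\<partial>\<^sub>2, Y]\<close> in it; up to that span, \<open>Y = (f(x\<^sup>1) + \<alpha> x\<^sup>1 x\<^sup>2) \<partial>\<^sub>1 + (g(x\<^sup>1) + \<alpha> (x\<^sup>2)\<^sup>2 / 2) \<partial>\<^sub>2\<close> with \<open>\<alpha>\<close> equal to 0 or 1, and the
  Killing system becomes a small system of ordinary differential equations which forces polynomial relations
  between the Christoffel parameters.  For the listed models, the invariance of the torsion and of the
  Ricci tensor of the symmetric part bounds the space of 1-jets from above by that of the listed fields.\<close>

section \<open>Smooth functions of two real variables\<close>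

text \<open>Stability under d/dy alone would leave room for fields with factors
  \<open>exp (\<lambda> * y)\<close> and for complex eigenvalues. The homothety argument excludes
  them while staying over the reals, and only functions of x remain unknown.

  The classification theorem is a list of necessary conditions on the parameters and is used in both
  directions. It leaves three families, each of which a shear and a scaling of y bring to a listed
  form; and it shows that a model outside these families has exactly the algebra spanned by X and
  d/dy, which settles the excluded torsion values without integrating anything. In the degenerate
  family \<open>C = E = F = S = 0\<close> the normal form is reached from the parameters alone.

  The symbols are split into symmetric part and torsion because second derivatives are symmetric:
  the torsion then contributes just two first-order equations, and these bound the 1-jets on the
  same footing as the Ricci equations. The six-dimensional cases are flat and torsion free, and
  there the bound is simply the six entries of a 1-jet.\<close>

lemma open_half_plane: "open half_plane"
proof -
  have "open {p :: real^2. 0 < p$1}"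
    by (intro open_Collect_less continuous_intros)
  then show ?thesis by (simp add: half_plane_def)
qed

text \<open>\<open>frechet_derivative\<close> is a choice among the possible derivatives. Functions
  that agree near \<open>x\<close> have the same derivatives, hence the same choice, even where no
  derivative exists.\<close>

lemma frechet_derivative_cong_open:
  assumes "open S" "x \<in> S" "\<And>y. y \<in> S \<Longrightarrow> f y = g y"
  shows "frechet_derivative f (at x) = frechet_derivative g (at x)"
proof -
  have "(f has_derivative D) (at x) \<longleftrightarrow> (g has_derivative D) (at x)" for D
    using has_derivative_transform_within_open[OF _ assms(1,2)] assms(3) by metis
  then show ?thesis unfolding frechet_derivative_def by simp
qed

lemma differentiable_cong_open:
  assumes "open S" "x \<in> S" "\<And>y. y \<in> S \<Longrightarrow> f y = g y" "f differentiable (at x)"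
  shows "g differentiable (at x)"
  using assms has_derivative_transform_within_open[OF _ assms(1,2)]
  unfolding differentiable_def by metis

text \<open>Smoothness as a greatest fixed point. Closure under directional derivatives is asked
  only up to equality on \<open>S\<close>, since outside \<open>S\<close> a derivative need not have
  the form of a member of the class.\<close>

lemma smooth_on_coinduct:
  assumes "open S" "G f"
    and diff: "\<And>f x. G f \<Longrightarrow> x \<in> S \<Longrightarrow> f differentiable (at x)"
    and closed: "\<And>f v. G f \<Longrightarrow> \<exists>g. G g \<and> (\<forall>x\<in>S. frechet_derivative f (at x) v = g x)"
  shows "smooth_on S f"
proof -
  \<comment> \<open>The induction runs over all \<open>h\<close> that agree on \<open>S\<close> with
    a member of \<open>G\<close>, because that is all that is known of a derivative.\<close>
  have "Ck_on n S h" if "G g" "\<forall>x\<in>S. h x = g x" for n g h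
    using that
  proof (induction n arbitrary: g h)
    case 0
    then have "continuous_on S g"
      by (meson continuous_at_imp_continuous_on diff differentiable_imp_continuous_within)
    with 0 show ?case by (simp cong: continuous_on_cong)
  next
    case (Suc n)
    have fr: "frechet_derivative h (at x) = frechet_derivative g (at x)" if "x \<in> S" for x
      using Suc.prems(2) that assms(1) by (intro frechet_derivative_cong_open) auto
    have "Ck_on n S (\<lambda>x. frechet_derivative h (at x) v)" for v
      using closed[OF Suc.prems(1), of v] Suc.IH fr by fastforce
    moreover have "\<forall>x\<in>S. h differentiable (at x)"
      using differentiable_cong_open[OF assms(1), of _ g h] diff Suc.prems by auto
    ultimately show ?case by simp
  qed
  then show ?thesis using assms(2) unfolding smooth_on_def by blast
qed

lemma smooth_on_differentiable: "smooth_on S f \<Longrightarrow> x \<in> S \<Longrightarrow> f differentiable (at x)"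
  unfolding smooth_on_def by (drule spec[of _ "Suc 0"]) simp

lemma smooth_on_frechet: "smooth_on S f \<Longrightarrow> smooth_on S (\<lambda>x. frechet_derivative f (at x) v)"
  unfolding smooth_on_def
proof
  fix n assume "\<forall>n. Ck_on n S f"
  then have "Ck_on (Suc n) S f" ..
  then show "Ck_on n S (\<lambda>x. frechet_derivative f (at x) v)" by simp
qed

lemma smooth_on_cong:
  assumes "open S" "smooth_on S f" "\<And>x. x \<in> S \<Longrightarrow> g x = f x"
  shows "smooth_on S g"
proof (rule smooth_on_coinduct[where G = "\<lambda>g. \<exists>f. smooth_on S f \<and> (\<forall>x\<in>S. g x = f x)"])
  show "\<exists>f. smooth_on S f \<and> (\<forall>x\<in>S. g x = f x)" using assms by blast
next
  fix f :: "'a \<Rightarrow> 'b" and x assume "\<exists>g. smooth_on S g \<and> (\<forall>x\<in>S. f x = g x)" "x \<in> S"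
  then show "f differentiable (at x)"
    using differentiable_cong_open[OF assms(1)] smooth_on_differentiable by metis
next
  fix f :: "'a \<Rightarrow> 'b" and v
  assume "\<exists>g. smooth_on S g \<and> (\<forall>x\<in>S. f x = g x)"
  then obtain g where g: "smooth_on S g" "\<forall>x\<in>S. f x = g x" by blast
  then have "\<forall>x\<in>S. frechet_derivative f (at x) v = frechet_derivative g (at x) v"
    using frechet_derivative_cong_open[OF assms(1)] by metis
  with smooth_on_frechet[OF g(1), of v]
  show "\<exists>g. (\<exists>h. smooth_on S h \<and> (\<forall>x\<in>S. g x = h x)) \<and> (\<forall>x\<in>S. frechet_derivative f (at x) v = g x)"
    by (intro exI[of _ "\<lambda>x. frechet_derivative g (at x) v"]) auto
qed (use assms in auto)

text \<open>The two bounded linear maps let one proof serve for real linear combinations, for the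
  components of a vector field and for assembling a field from its components.\<close>

lemma smooth_on_linear_combination:
  assumes "open S" "smooth_on S f" "smooth_on S g" "bounded_linear L" "bounded_linear M"
  shows "smooth_on S (\<lambda>x. L (f x) + M (g x))"
proof (rule smooth_on_coinduct[where G = "\<lambda>h. \<exists>f g. smooth_on S f \<and> smooth_on S g \<and> h = (\<lambda>x. L (f x) + M (g x))"])
  have D: "((\<lambda>x. L (f x) + M (g x)) has_derivative
      (\<lambda>v. L (frechet_derivative f (at x) v) + M (frechet_derivative g (at x) v))) (at x)"
    if "smooth_on S f" "smooth_on S g" "x \<in> S" for f g x
  proof -
    have "(f has_derivative frechet_derivative f (at x)) (at x)" "(g has_derivative frechet_derivative g (at x)) (at x)"
      using smooth_on_differentiable that frechet_derivative_works by blast+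
    from has_derivative_add[OF bounded_linear.has_derivative[OF assms(4) this(1)]
        bounded_linear.has_derivative[OF assms(5) this(2)]] show ?thesis .
  qed
  fix h v assume "\<exists>f g. smooth_on S f \<and> smooth_on S g \<and> h = (\<lambda>x. L (f x) + M (g x))"
  then obtain f g where h: "smooth_on S f" "smooth_on S g" "h = (\<lambda>x. L (f x) + M (g x))" by blast
  have "\<forall>x\<in>S. frechet_derivative h (at x) v
      = L (frechet_derivative f (at x) v) + M (frechet_derivative g (at x) v)"
  proof
    fix x assume "x \<in> S"
    from frechet_derivative_at[OF D[OF h(1,2) this]]
    show "frechet_derivative h (at x) v = L (frechet_derivative f (at x) v) + M (frechet_derivative g (at x) v)"
      unfolding h(3) by metis
  qed
  moreover note smooth_on_frechet[OF h(1), of v] smooth_on_frechet[OF h(2), of v]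
  ultimately show "\<exists>k. (\<exists>f g. smooth_on S f \<and> smooth_on S g \<and> k = (\<lambda>x. L (f x) + M (g x)))
       \<and> (\<forall>x\<in>S. frechet_derivative h (at x) v = k x)"
    by blast
  show "h differentiable (at x)" if "x \<in> S" for x
    unfolding h(3) by (rule differentiableI[OF D[OF h(1,2) that]])
next
  show "\<exists>f' g'. smooth_on S f' \<and> smooth_on S g' \<and> (\<lambda>x. L (f x) + M (g x)) = (\<lambda>x. L (f' x) + M (g' x))"
    using assms(2,3) by blast
qed (rule assms(1))

lemma smooth_on_bounded_linear:
  assumes "open S" "smooth_on S f" "bounded_linear L"
  shows "smooth_on S (\<lambda>x. L (f x))"
  using smooth_on_linear_combination[OF assms(1,2,2,3) bounded_linear_zero] by simp

lemma smooth_on_dilate: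
  assumes "open S" "smooth_on S f" "\<And>x. x \<in> S \<Longrightarrow> c *\<^sub>R x \<in> S"
  shows "smooth_on S (\<lambda>x. f (c *\<^sub>R x))"
\<comment> \<open>Each derivative produces another factor \<open>c\<close>; the scalar
  \<open>k\<close> in the class absorbs it.\<close>
proof (rule smooth_on_coinduct[where G = "\<lambda>h. \<exists>f k. smooth_on S f \<and> h = (\<lambda>x. k *\<^sub>R f (c *\<^sub>R x))"])
  show "\<exists>g k. smooth_on S g \<and> (\<lambda>x. f (c *\<^sub>R x)) = (\<lambda>x. k *\<^sub>R g (c *\<^sub>R x))"
    by (intro exI[of _ f] exI[of _ 1]) (use assms in auto)
  have D: "((\<lambda>x. k *\<^sub>R f (c *\<^sub>R x)) has_derivative
        (\<lambda>v. (k * c) *\<^sub>R frechet_derivative f (at (c *\<^sub>R x)) v)) (at x)"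
    if "smooth_on S f" "x \<in> S" for f :: "'a \<Rightarrow> 'b" and k x
  proof -
    have f: "(f has_derivative frechet_derivative f (at (c *\<^sub>R x))) (at (c *\<^sub>R x))"
      using smooth_on_differentiable[OF that(1)] assms(3)[OF that(2)] frechet_derivative_works by blast
    have l: "linear (frechet_derivative f (at (c *\<^sub>R x)))"
      using f by (rule has_derivative_linear)
    have "((\<lambda>x. k *\<^sub>R f (c *\<^sub>R x)) has_derivative
        (\<lambda>v. k *\<^sub>R frechet_derivative f (at (c *\<^sub>R x)) (c *\<^sub>R v))) (at x)"
      by (intro has_derivative_scaleR_right has_derivative_ident
          has_derivative_compose[where g = f and f = "\<lambda>x. c *\<^sub>R x", OF _ f])
    then show ?thesis by (simp add: linear_scale[OF l])
  qed
  fix h :: "'a \<Rightarrow> 'b" and v assume "\<exists>f k. smooth_on S f \<and> h = (\<lambda>x. k *\<^sub>R f (c *\<^sub>R x))"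
  then obtain f k where h: "smooth_on S f" "h = (\<lambda>x. k *\<^sub>R f (c *\<^sub>R x))" by blast
  show "\<exists>g. (\<exists>f k. smooth_on S f \<and> g = (\<lambda>x. k *\<^sub>R f (c *\<^sub>R x))) \<and>
           (\<forall>x\<in>S. frechet_derivative h (at x) v = g x)"
  proof (intro exI conjI ballI)
    show "smooth_on S (\<lambda>x. frechet_derivative f (at x) v)" using smooth_on_frechet h by blast
    show "frechet_derivative h (at x) v = (\<lambda>x. (k * c) *\<^sub>R frechet_derivative f (at (c *\<^sub>R x)) v) x"
      if "x \<in> S" for x using frechet_derivative_at[OF D[OF h(1) that, of k]] unfolding h(2) by metis
  qed simp
next
  fix h :: "'a \<Rightarrow> 'b" and x assume "\<exists>f k. smooth_on S f \<and> h = (\<lambda>x. k *\<^sub>R f (c *\<^sub>R x))" and x: "x \<in> S"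
  then obtain f k where h: "smooth_on S f" "h = (\<lambda>x. k *\<^sub>R f (c *\<^sub>R x))" by blast
  have "f differentiable (at (c *\<^sub>R x))"
    using smooth_on_differentiable[OF h(1)] assms(3)[OF x] by blast
  then have "(\<lambda>x. f (c *\<^sub>R x)) differentiable (at x)"
    by (intro differentiable_chain_at[of "\<lambda>x. c *\<^sub>R x" x f, unfolded o_def]) (auto intro!: derivative_intros)
  then show "h differentiable (at x)" unfolding h(2)
    by (intro differentiable_scaleR) auto
qed (use assms in auto)

section \<open>Partial derivatives of functions on the half plane\<close>

definition smooth2 :: "(real \<Rightarrow> real \<Rightarrow> real) \<Rightarrow> bool"
  where "smooth2 f \<longleftrightarrow> smooth_on half_plane (\<lambda>p. f (p$1) (p$2))"

definition Dx :: "(real \<Rightarrow> real \<Rightarrow> real) \<Rightarrow> real \<Rightarrow> real \<Rightarrow> real"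
  where "Dx f x y = pd 1 (\<lambda>p. f (p$1) (p$2)) (vector [x, y])"

definition Dy :: "(real \<Rightarrow> real \<Rightarrow> real) \<Rightarrow> real \<Rightarrow> real \<Rightarrow> real"
  where "Dy f x y = pd 2 (\<lambda>p. f (p$1) (p$2)) (vector [x, y])"

lemma vector2_eta: "vector [p$1, p$2] = (p :: real^2)"
  by (simp add: vec_eq_iff forall_2)

lemma vector2_in_half_plane [simp]: "(vector [x, y] :: real^2) \<in> half_plane \<longleftrightarrow> 0 < x"
  by (simp add: half_plane_def)

lemma smooth2_Dx: "smooth2 f \<Longrightarrow> smooth2 (Dx f)"
  unfolding smooth2_def Dx_def pd_def vector2_eta by (rule smooth_on_frechet)

lemma smooth2_Dy: "smooth2 f \<Longrightarrow> smooth2 (Dy f)"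
  unfolding smooth2_def Dy_def pd_def vector2_eta by (rule smooth_on_frechet)

lemma smooth2_has_derivative:
  assumes "smooth2 f" "0 < x"
  shows "((\<lambda>p::real^2. f (p$1) (p$2)) has_derivative (\<lambda>h. Dx f x y * h$1 + Dy f x y * h$2)) (at (vector [x, y]))"
proof -
  let ?F = "\<lambda>p::real^2. f (p$1) (p$2)" let ?p = "vector [x, y] :: real^2"
  have "?F differentiable (at ?p)"
    using assms by (intro smooth_on_differentiable[of half_plane]) (auto simp: smooth2_def)
  then have F: "(?F has_derivative frechet_derivative ?F (at ?p)) (at ?p)"
    using frechet_derivative_works by blast
  then have l: "linear (frechet_derivative ?F (at ?p))" by (rule has_derivative_linear)
  have "frechet_derivative ?F (at ?p) = (\<lambda>h. Dx f x y * h$1 + Dy f x y * h$2)"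
  proof
    fix h :: "real^2"
    have "h = h$1 *\<^sub>R axis 1 1 + h$2 *\<^sub>R axis 2 1"
      by (simp add: vec_eq_iff forall_2 axis_def)
    then have "frechet_derivative ?F (at ?p) h = frechet_derivative ?F (at ?p) (h$1 *\<^sub>R axis 1 1 + h$2 *\<^sub>R axis 2 1)"
      by simp
    also have "\<dots> = Dx f x y * h$1 + Dy f x y * h$2"
      by (simp add: linear_add[OF l] linear_scale[OF l] Dx_def Dy_def pd_def)
    finally show "frechet_derivative ?F (at ?p) h = Dx f x y * h$1 + Dy f x y * h$2" .
  qed
  from F[unfolded this] show ?thesis .
qed

lemma has_derivative_vec2:
  assumes "(g has_derivative g') F" "(h has_derivative h') F"
  shows "((\<lambda>t. vector [g t, h t] :: real^2) has_derivative (\<lambda>t. vector [g' t, h' t])) F"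
proof -
  have e: "(vector [a, b] :: real^2) = a *\<^sub>R axis 1 1 + b *\<^sub>R axis 2 1" for a b
    by (simp add: vec_eq_iff forall_2 axis_def)
  show ?thesis unfolding e by (intro derivative_intros assms)
qed

lemma smooth2_chain:
  assumes "smooth2 f" "0 < g t" "(g has_real_derivative g') (at t)" "(h has_real_derivative h') (at t)"
  shows "((\<lambda>s. f (g s) (h s)) has_real_derivative Dx f (g t) (h t) * g' + Dy f (g t) (h t) * h') (at t)"
proof -
  have v: "((\<lambda>s. vector [g s, h s] :: real^2) has_derivative (\<lambda>s. vector [g' * s, h' * s])) (at t)"
    using assms(3,4) by (intro has_derivative_vec2) (auto simp: has_field_derivative_def)
  have "((\<lambda>s. f ((vector [g s, h s] :: real^2)$1) ((vector [g s, h s] :: real^2)$2)) has_derivative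
     (\<lambda>s. Dx f (g t) (h t) * (vector [g' * s, h' * s] :: real^2)$1 + Dy f (g t) (h t) * (vector [g' * s, h' * s] :: real^2)$2)) (at t)"
    by (rule has_derivative_compose[OF v smooth2_has_derivative[OF assms(1,2)]])
  moreover have "(\<lambda>s. Dx f (g t) (h t) * (vector [g' * s, h' * s] :: real^2)$1 + Dy f (g t) (h t) * (vector [g' * s, h' * s] :: real^2)$2)
     = (*) (Dx f (g t) (h t) * g' + Dy f (g t) (h t) * h')"
    by (simp add: fun_eq_iff algebra_simps)
  ultimately show ?thesis
    by (simp add: has_field_derivative_def)
qed

lemma smooth2_dx: "smooth2 f \<Longrightarrow> 0 < x \<Longrightarrow> ((\<lambda>t. f t y) has_real_derivative Dx f x y) (at x)"
  using smooth2_chain[of f "\<lambda>t. t" x 1 "\<lambda>t. y" 0] by simp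

lemma smooth2_dy: "smooth2 f \<Longrightarrow> 0 < x \<Longrightarrow> ((\<lambda>t. f x t) has_real_derivative Dy f x y) (at y)"
  using smooth2_chain[of f "\<lambda>t. x" y 0 "\<lambda>t. t" 1] by simp

lemma smooth2_cong: "smooth2 f \<Longrightarrow> (\<And>x y. 0 < x \<Longrightarrow> g x y = f x y) \<Longrightarrow> smooth2 g"
  unfolding smooth2_def by (erule smooth_on_cong[OF open_half_plane]) (simp add: half_plane_def)

text \<open>\<open>Dx\<close> is defined through the total derivative; smoothness guarantees that
  the latter exists, so that the one-variable derivative determines \<open>Dx\<close>.\<close>

lemma Dx_eqI: "smooth2 f \<Longrightarrow> 0 < x \<Longrightarrow> ((\<lambda>t. f t y) has_real_derivative d) (at x) \<Longrightarrow> Dx f x y = d"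
  using smooth2_dx DERIV_unique by blast

lemma Dy_eqI: "smooth2 f \<Longrightarrow> 0 < x \<Longrightarrow> ((\<lambda>t. f x t) has_real_derivative d) (at y) \<Longrightarrow> Dy f x y = d"
  using smooth2_dy DERIV_unique by blast

lemma Dx_cong: "smooth2 f \<Longrightarrow> (\<And>x y. 0 < x \<Longrightarrow> g x y = f x y) \<Longrightarrow> 0 < x \<Longrightarrow> Dx g x y = Dx f x y"
  by (auto simp: Dx_def pd_def half_plane_def fun_eq_iff
     intro!: fun_cong[OF frechet_derivative_cong_open[OF open_half_plane]])

lemma Dy_cong: "smooth2 f \<Longrightarrow> (\<And>x y. 0 < x \<Longrightarrow> g x y = f x y) \<Longrightarrow> 0 < x \<Longrightarrow> Dy g x y = Dy f x y"
  by (auto simp: Dy_def pd_def half_plane_def fun_eq_iff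
     intro!: fun_cong[OF frechet_derivative_cong_open[OF open_half_plane]])

lemma smooth2_lincomb:
  assumes "smooth2 f" "smooth2 g"
  shows "smooth2 (\<lambda>x y. a * f x y + b * g x y)"
  using smooth_on_linear_combination[OF open_half_plane assms[unfolded smooth2_def]
     bounded_linear_mult_right[of a] bounded_linear_mult_right[of b]]
  unfolding smooth2_def by simp

lemma Dx_lincomb:
  assumes "smooth2 f" "smooth2 g" "0 < x"
  shows "Dx (\<lambda>x y. a * f x y + b * g x y) x y = a * Dx f x y + b * Dx g x y"
  by (rule Dx_eqI[OF smooth2_lincomb[OF assms(1,2)] assms(3)])
     (auto intro!: derivative_eq_intros smooth2_dx assms)

lemma Dy_lincomb:
  assumes "smooth2 f" "smooth2 g" "0 < x"
  shows "Dy (\<lambda>x y. a * f x y + b * g x y) x y = a * Dy f x y + b * Dy g x y"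
  by (rule Dy_eqI[OF smooth2_lincomb[OF assms(1,2)] assms(3)])
     (auto intro!: derivative_eq_intros smooth2_dy assms)

lemma smooth2_dilate:
  assumes "smooth2 f" shows "smooth2 (\<lambda>x y. f (2 * x) (2 * y))"
  using smooth_on_dilate[OF open_half_plane assms[unfolded smooth2_def], of 2]
  unfolding smooth2_def by (simp add: half_plane_def)

lemma Dx_dilate:
  assumes "smooth2 f" "0 < x" shows "Dx (\<lambda>x y. f (2 * x) (2 * y)) x y = 2 * Dx f (2 * x) (2 * y)"
proof (rule Dx_eqI[OF smooth2_dilate[OF assms(1)] assms(2)])
  have "((\<lambda>t. 2 * t) has_real_derivative 2) (at x)" by (auto intro!: derivative_eq_intros)
  from smooth2_chain[of f "\<lambda>t. 2 * t", OF assms(1) _ this, of "\<lambda>t. 2 * y" 0]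
  show "((\<lambda>t. f (2 * t) (2 * y)) has_real_derivative 2 * Dx f (2 * x) (2 * y)) (at x)"
    using assms(2) by (simp add: mult.commute)
qed

lemma Dy_dilate:
  assumes "smooth2 f" "0 < x" shows "Dy (\<lambda>x y. f (2 * x) (2 * y)) x y = 2 * Dy f (2 * x) (2 * y)"
proof (rule Dy_eqI[OF smooth2_dilate[OF assms(1)] assms(2)])
  have "((\<lambda>t. 2 * t) has_real_derivative 2) (at y)" by (auto intro!: derivative_eq_intros)
  from smooth2_chain[of f "\<lambda>t. 2 * x" y 0 "\<lambda>t. 2 * t" 2, OF assms(1) _ _ this]
  show "((\<lambda>t. f (2 * x) (2 * t)) has_real_derivative 2 * Dy f (2 * x) (2 * y)) (at y)"
    using assms(2) by (simp add: mult.commute)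
qed

lemma smooth2_continuous:
  assumes "smooth2 f" "0 < x" shows "isCont (\<lambda>p::real^2. f (p$1) (p$2)) (vector [x, y])"
  using smooth2_has_derivative[OF assms] has_derivative_continuous by blast

text \<open>Schwarz's theorem. The second difference of \<open>f\<close> over a square of side
  \<open>h\<close> is \<open>h^2\<close> times a value of either mixed derivative, according to the
  order in which the mean value theorem is applied; continuity forces equality in the limit.\<close>

lemma Dx_Dy_commute:
  assumes f: "smooth2 f" and x: "0 < x"
  shows "Dx (Dy f) x y = Dy (Dx f) x y"
proof -
  let ?d = "Dx (Dy f)" and ?e = "Dy (Dx f)"
  have S: "smooth2 ?d" "smooth2 ?e" using smooth2_Dx[OF smooth2_Dy[OF f]] smooth2_Dy[OF smooth2_Dx[OF f]] .
  have "\<exists>s t s' t'. x < s \<and> s < x + h \<and> y < t \<and> t < y + h \<and> x < s' \<and> s' < x + h \<and> y < t' \<and> t' < y + h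
      \<and> ?d s t = ?e s' t'" if h: "0 < h" for h
  proof -
    let ?D = "f (x + h) (y + h) - f (x + h) y - f x (y + h) + f x y"
    have "\<exists>s>x. s < x + h \<and> (\<lambda>s. f s (y + h) - f s y) (x + h) - (\<lambda>s. f s (y + h) - f s y) x
        = (x + h - x) * (Dx f s (y + h) - Dx f s y)"
      by (rule MVT2) (use h x in \<open>auto intro!: derivative_eq_intros smooth2_dx[OF f]\<close>)
    then obtain s where s: "x < s" "s < x + h" "?D = h * (Dx f s (y + h) - Dx f s y)" by auto
    have "\<exists>t>y. t < y + h \<and> Dx f s (y + h) - Dx f s y = (y + h - y) * ?e s t"
      by (rule MVT2) (use h x s in \<open>auto intro!: derivative_eq_intros smooth2_dy[OF smooth2_Dx[OF f]]\<close>)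
    then obtain t where t: "y < t" "t < y + h" "?D = h * (h * ?e s t)" using s by auto
    have "\<exists>s>y. s < y + h \<and> (\<lambda>s. f (x + h) s - f x s) (y + h) - (\<lambda>s. f (x + h) s - f x s) y
        = (y + h - y) * (Dy f (x + h) s - Dy f x s)"
      by (rule MVT2) (use h x in \<open>auto intro!: derivative_eq_intros smooth2_dy[OF f]\<close>)
    then obtain s' where s': "y < s'" "s' < y + h" "?D = h * (Dy f (x + h) s' - Dy f x s')" by auto
    have "\<exists>t>x. t < x + h \<and> Dy f (x + h) s' - Dy f x s' = (x + h - x) * ?d t s'"
      by (rule MVT2) (use h x s in \<open>auto intro!: derivative_eq_intros smooth2_dx[OF smooth2_Dy[OF f]]\<close>)
    then obtain t' where t': "x < t'" "t' < x + h" "?D = h * (h * ?d t' s')" using s' by auto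
    have "?d t' s' = ?e s t" using t(3) t'(3) h by simp
    with s t s' t' show ?thesis by blast
  qed
  then have *: "\<exists>s t s' t'. x < s \<and> s < x + h \<and> y < t \<and> t < y + h \<and> x < s' \<and> s' < x + h \<and> y < t' \<and> t' < y + h
      \<and> ?d s t = ?e s' t'" if "0 < h" for h using that by blast
  have dist: "dist (vector [s, t] :: real^2) (vector [x, y]) < 2 * h"
    if "x < s" "s < x + h" "y < t" "t < y + h" for s t h
  proof -
    have "dist (vector [s, t] :: real^2) (vector [x, y]) \<le> \<bar>s - x\<bar> + \<bar>t - y\<bar>"
      unfolding dist_norm by (rule order_trans[OF norm_le_l1_cart]) (simp add: sum_2)
    then show ?thesis using that by simp
  qed
  have "dist (?d x y) (?e x y) < 2 * e" if e: "0 < e" for e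
  proof -
    obtain a where a: "a > 0" "\<And>p::real^2. dist p (vector [x, y]) < a \<Longrightarrow> dist (?d (p$1) (p$2)) (?d x y) < e"
      using smooth2_continuous[OF S(1) x, of y] e unfolding continuous_at_eps_delta by auto
    obtain b where b: "b > 0" "\<And>p::real^2. dist p (vector [x, y]) < b \<Longrightarrow> dist (?e (p$1) (p$2)) (?e x y) < e"
      using smooth2_continuous[OF S(2) x, of y] e unfolding continuous_at_eps_delta by auto
    \<comment> \<open>Points of the square are at distance less than \<open>2 * h\<close> from its
      corner, hence the half.\<close>
    define h where "h = min a b / 2"
    have h: "h > 0" "2 * h \<le> a" "2 * h \<le> b" using a b by (auto simp: h_def)
    from *[OF h(1)] obtain s t s' t' where
      st: "x < s" "s < x + h" "y < t" "t < y + h" "x < s'" "s' < x + h" "y < t'" "t' < y + h" "?d s t = ?e s' t'"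
      by blast
    have "dist (?d s t) (?d x y) < e" using a(2)[of "vector [s, t]"] dist[OF st(1-4)] h by auto
    moreover have "dist (?e s' t') (?e x y) < e" using b(2)[of "vector [s', t']"] dist[OF st(5-8)] h by auto
    ultimately show ?thesis using st(9) by (auto simp: dist_real_def)
  qed
  from this[of "dist (?d x y) (?e x y) / 2"] show ?thesis by (cases "?d x y = ?e x y") auto
qed

section \<open>The Killing system\<close>

lemma vector_8:
  fixes a b c d e f g h :: "'a::zero"
  shows "(vector [a, b, c, d, e, f, g, h] :: 'a^8)$1 = a"
    "(vector [a, b, c, d, e, f, g, h] :: 'a^8)$2 = b"
    "(vector [a, b, c, d, e, f, g, h] :: 'a^8)$3 = c"
    "(vector [a, b, c, d, e, f, g, h] :: 'a^8)$4 = d"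
    "(vector [a, b, c, d, e, f, g, h] :: 'a^8)$5 = e"
    "(vector [a, b, c, d, e, f, g, h] :: 'a^8)$6 = f"
    "(vector [a, b, c, d, e, f, g, h] :: 'a^8)$7 = g"
    "(vector [a, b, c, d, e, f, g, h] :: 'a^8)$8 = h"
  by (simp_all add: vector_def)

lemma exhaust_8:
  fixes x :: 8
  shows "x = 1 \<or> x = 2 \<or> x = 3 \<or> x = 4 \<or> x = 5 \<or> x = 6 \<or> x = 7 \<or> x = 8"
proof (induct x)
  case (of_int z)
  then have "z = 0 \<or> z = 1 \<or> z = 2 \<or> z = 3 \<or> z = 4 \<or> z = 5 \<or> z = 6 \<or> z = 7" by auto
  then show ?case by auto
qed

lemma forall_8: "(\<forall>i::8. P i) \<longleftrightarrow> P 1 \<and> P 2 \<and> P 3 \<and> P 4 \<and> P 5 \<and> P 6 \<and> P 7 \<and> P 8"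
  by (metis exhaust_8)

text \<open>\<open>model A B C D E F S T\<close> has symmetric part \<open>A, \<dots>, F\<close> and torsion parameters \<open>(S, T)\<close>.\<close>

definition model :: "real \<Rightarrow> real \<Rightarrow> real \<Rightarrow> real \<Rightarrow> real \<Rightarrow> real \<Rightarrow> real \<Rightarrow> real \<Rightarrow> real^8"
  where "model A B C D E F S T = vector [A, B, C + S, D + T, C - S, D - T, E, F]"

lemma ex_model: "\<exists>A B C D E F S T. \<xi> = model A B C D E F S T"
proof -
  have "\<xi> = model (\<xi>$1) (\<xi>$2) ((\<xi>$3 + \<xi>$5) / 2) ((\<xi>$4 + \<xi>$6) / 2) (\<xi>$7) (\<xi>$8) ((\<xi>$3 - \<xi>$5) / 2) ((\<xi>$4 - \<xi>$6) / 2)"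
    by (simp add: vec_eq_iff forall_8 model_def vector_8 field_simps)
  then show ?thesis by blast
qed

text \<open>The Killing equations without denominators. Second derivatives are symmetric, so the
  equations for the indices (1,2,k) and (2,1,k) are replaced by their half sum, in which only the
  symmetric part occurs, and their half difference, the invariance of the torsion. \<open>v\<close>
  itself is absent because the symbols do not depend on y.\<close>

definition killing_eqs where
  "killing_eqs A B C D E F S T x u ux uy uxx uxy uyy vx vy vxx vxy vyy \<longleftrightarrow>
      x\<^sup>2 * uxx - A * u + x * (A * ux - B * uy + 2 * C * vx) = 0 \<and>
      x\<^sup>2 * vxx - B * u + x * ((2 * D - A) * vx - B * vy + 2 * B * ux) = 0 \<and>
      x\<^sup>2 * uxy - C * u + x * ((A - D) * uy + C * vy + E * vx) = 0 \<and>
      x\<^sup>2 * vxy - D * u + x * ((F - C) * vx + B * uy + D * ux) = 0 \<and>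
      x\<^sup>2 * uyy - E * u + x * ((2 * C - F) * uy - E * ux + 2 * E * vy) = 0 \<and>
      x\<^sup>2 * vyy - F * u + x * (2 * D * uy - E * vx + F * vy) = 0 \<and>
      S * u = x * (S * vy - T * uy) \<and> T * u = x * (T * ux - S * vx)"
  for A B C D E F S T x u ux uy uxx uxy uyy vx vy vxx vxy vyy :: real

definition kfield where
  "kfield A B C D E F S T u v \<longleftrightarrow> smooth2 u \<and> smooth2 v \<and> (\<forall>x>0. \<forall>y.
     killing_eqs A B C D E F S T x (u x y) (Dx u x y) (Dy u x y)
       (Dx (Dx u) x y) (Dy (Dx u) x y) (Dy (Dy u) x y)
       (Dx v x y) (Dy v x y) (Dx (Dx v) x y) (Dy (Dx v) x y) (Dy (Dy v) x y))"

lemma pd_cong: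
  assumes "p \<in> half_plane" "\<And>q. q \<in> half_plane \<Longrightarrow> f q = g q"
  shows "pd i f p = pd i g p"
  unfolding pd_def using frechet_derivative_cong_open[OF open_half_plane assms] by simp

lemma pd_const_over_x:
  assumes "p \<in> half_plane"
  shows "pd 1 (\<lambda>q. c / q$1) p = - (c / (p$1)\<^sup>2)" "pd 2 (\<lambda>q. c / q$1) p = 0"
proof -
  have "((\<lambda>q::real^2. q$1) has_derivative (\<lambda>h. h$1)) (at p)"
    by (rule bounded_linear_imp_has_derivative[OF bounded_linear_vec_nth])
  then have "((\<lambda>q::real^2. c / q$1) has_derivative (\<lambda>h. - c * h$1 / (p$1)\<^sup>2)) (at p)"
    using assms unfolding half_plane_def
    by (auto intro!: derivative_eq_intros simp: power2_eq_square field_simps)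
  from frechet_derivative_at[OF this, symmetric]
  show "pd 1 (\<lambda>q. c / q$1) p = - (c / (p$1)\<^sup>2)" "pd 2 (\<lambda>q. c / q$1) p = 0"
    unfolding pd_def by (simp_all add: axis_def)
qed

lemma smooth_on_half_plane_iff:
  fixes Y :: "real^2 \<Rightarrow> real^2"
  assumes "\<And>q. q \<in> half_plane \<Longrightarrow> Y q = vector [u (q$1) (q$2), v (q$1) (q$2)]"
  shows "smooth_on half_plane Y \<longleftrightarrow> smooth2 u \<and> smooth2 v"
proof
  assume Y: "smooth_on half_plane Y"
  have "smooth_on half_plane (\<lambda>q. Y q $ 1)" "smooth_on half_plane (\<lambda>q. Y q $ 2)"
    by (rule smooth_on_bounded_linear[OF open_half_plane Y bounded_linear_vec_nth])+
  from this[THEN smooth_on_cong[OF open_half_plane]] show "smooth2 u \<and> smooth2 v"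
    unfolding smooth2_def by (simp add: assms)
next
  assume "smooth2 u \<and> smooth2 v"
  then have "smooth_on half_plane (\<lambda>p. u (p$1) (p$2) *\<^sub>R axis 1 1 + v (p$1) (p$2) *\<^sub>R (axis 2 1 :: real^2))"
    unfolding smooth2_def by (intro smooth_on_linear_combination open_half_plane bounded_linear_scaleR_left) auto
  then show "smooth_on half_plane Y"
    by (rule smooth_on_cong[OF open_half_plane]) (simp add: assms vec_eq_iff forall_2 axis_def)
qed

text \<open>The right-hand side lists the eight equations as they come out of expanding the index
  sums; this explains their order and the terms that cancel.\<close>

lemma killing_eqs_iff:
  assumes x: "0 < x"
  shows "killing_eqs A B C D E F S T x u ux uy uxx uxy uyy vx vy vxx vxy vyy \<longleftrightarrow>
    uxx - u * A / x\<^sup>2 - A * ux / x + A * ux / x + A * ux / x - B * uy / x + (C + S) * vx / x + (C - S) * vx / x = 0 \<and>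
    vxx - u * B / x\<^sup>2 - A * vx / x + B * ux / x + B * ux / x - B * vy / x + (D + T) * vx / x + (D - T) * vx / x = 0 \<and>
    uxy - u * (C + S) / x\<^sup>2 - (C + S) * ux / x + A * uy / x + (C + S) * ux / x - (D + T) * uy / x + (C + S) * vy / x + E * vx / x = 0 \<and>
    vxy - u * (D + T) / x\<^sup>2 - (C + S) * vx / x + B * uy / x + (D + T) * ux / x - (D + T) * vy / x + (D + T) * vy / x + F * vx / x = 0 \<and>
    uxy - u * (C - S) / x\<^sup>2 - (C - S) * ux / x + (C - S) * ux / x + A * uy / x - (D - T) * uy / x + E * vx / x + (C - S) * vy / x = 0 \<and>
    vxy - u * (D - T) / x\<^sup>2 - (C - S) * vx / x + (D - T) * ux / x + B * uy / x - (D - T) * vy / x + F * vx / x + (D - T) * vy / x = 0 \<and>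
    uyy - u * E / x\<^sup>2 - E * ux / x + (C - S) * uy / x + (C + S) * uy / x - F * uy / x + E * vy / x + E * vy / x = 0 \<and>
    vyy - u * F / x\<^sup>2 - E * vx / x + (D - T) * uy / x + (D + T) * uy / x - F * vy / x + F * vy / x + F * vy / x = 0"
proof -
  have "uxx - u * A / x\<^sup>2 - A * ux / x + A * ux / x + A * ux / x - B * uy / x + (C + S) * vx / x + (C - S) * vx / x = (x\<^sup>2 * uxx - A * u + x * (A * ux - B * uy + 2 * C * vx)) / x\<^sup>2"
    and "vxx - u * B / x\<^sup>2 - A * vx / x + B * ux / x + B * ux / x - B * vy / x + (D + T) * vx / x + (D - T) * vx / x = (x\<^sup>2 * vxx - B * u + x * ((2 * D - A) * vx - B * vy + 2 * B * ux)) / x\<^sup>2"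
    and "uxy - u * (C + S) / x\<^sup>2 - (C + S) * ux / x + A * uy / x + (C + S) * ux / x - (D + T) * uy / x + (C + S) * vy / x + E * vx / x = ((x\<^sup>2 * uxy - C * u + x * ((A - D) * uy + C * vy + E * vx) + (x * (S * vy - T * uy) - S * u))) / x\<^sup>2"
    and "vxy - u * (D + T) / x\<^sup>2 - (C + S) * vx / x + B * uy / x + (D + T) * ux / x - (D + T) * vy / x + (D + T) * vy / x + F * vx / x = ((x\<^sup>2 * vxy - D * u + x * ((F - C) * vx + B * uy + D * ux) + (x * (T * ux - S * vx) - T * u))) / x\<^sup>2"
    and "uxy - u * (C - S) / x\<^sup>2 - (C - S) * ux / x + (C - S) * ux / x + A * uy / x - (D - T) * uy / x + E * vx / x + (C - S) * vy / x = ((x\<^sup>2 * uxy - C * u + x * ((A - D) * uy + C * vy + E * vx) - (x * (S * vy - T * uy) - S * u))) / x\<^sup>2"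
    and "vxy - u * (D - T) / x\<^sup>2 - (C - S) * vx / x + (D - T) * ux / x + B * uy / x - (D - T) * vy / x + F * vx / x + (D - T) * vy / x = ((x\<^sup>2 * vxy - D * u + x * ((F - C) * vx + B * uy + D * ux) - (x * (T * ux - S * vx) - T * u))) / x\<^sup>2"
    and "uyy - u * E / x\<^sup>2 - E * ux / x + (C - S) * uy / x + (C + S) * uy / x - F * uy / x + E * vy / x + E * vy / x = (x\<^sup>2 * uyy - E * u + x * ((2 * C - F) * uy - E * ux + 2 * E * vy)) / x\<^sup>2"
    and "vyy - u * F / x\<^sup>2 - E * vx / x + (D - T) * uy / x + (D + T) * uy / x - F * vy / x + F * vy / x + F * vy / x = (x\<^sup>2 * vyy - F * u + x * (2 * D * uy - E * vx + F * vy)) / x\<^sup>2"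
    using x by (simp_all add: field_simps power2_eq_square)
  note e = this
  have z: "a / x\<^sup>2 = 0 \<longleftrightarrow> a = 0" for a using x by simp
  \<comment> \<open>For the mixed indices, \<open>p + q = 0\<close> and \<open>p - q = 0\<close>
    together amount to \<open>p = 0\<close> and \<open>q = 0\<close>.\<close>
  show ?thesis unfolding e z killing_eqs_def by (safe; linarith)
qed

lemma killing_iff_kfield:
  assumes Y: "\<And>q. q \<in> half_plane \<Longrightarrow> Y q = vector [u (q$1) (q$2), v (q$1) (q$2)]"
    and 0: "\<And>q. q \<notin> half_plane \<Longrightarrow> Y q = 0"
  shows "Y \<in> killing (model A B C D E F S T) \<longleftrightarrow> kfield A B C D E F S T u v"
proof (cases "smooth2 u \<and> smooth2 v")
  case False
  moreover have "smooth_on half_plane Y \<longleftrightarrow> smooth2 u \<and> smooth2 v" by (rule smooth_on_half_plane_iff) (rule Y)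
  ultimately show ?thesis by (auto simp: killing_def kfield_def)
next
  case True
  then have uv: "smooth2 u" "smooth2 v" by auto
  have smY: "smooth_on half_plane Y" using uv smooth_on_half_plane_iff[of Y u v] Y by blast
  let ?xi = "model A B C D E F S T"
  have d: "pd 1 (\<lambda>q. Y q $ 1) p = Dx u (p$1) (p$2)" "pd 2 (\<lambda>q. Y q $ 1) p = Dy u (p$1) (p$2)"
    "pd 1 (\<lambda>q. Y q $ 2) p = Dx v (p$1) (p$2)" "pd 2 (\<lambda>q. Y q $ 2) p = Dy v (p$1) (p$2)"
    if "p \<in> half_plane" for p
    unfolding Dx_def Dy_def vector2_eta by (rule pd_cong[OF that], simp add: Y)+
  have dd: "pd i (pd 1 (\<lambda>q. Y q $ 1)) p = pd i (\<lambda>q. Dx u (q$1) (q$2)) p"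
    "pd i (pd 2 (\<lambda>q. Y q $ 1)) p = pd i (\<lambda>q. Dy u (q$1) (q$2)) p"
    "pd i (pd 1 (\<lambda>q. Y q $ 2)) p = pd i (\<lambda>q. Dx v (q$1) (q$2)) p"
    "pd i (pd 2 (\<lambda>q. Y q $ 2)) p = pd i (\<lambda>q. Dy v (q$1) (q$2)) p"
    if "p \<in> half_plane" for p i
    by (rule pd_cong[OF that], simp add: d)+
  have DD: "pd 1 (\<lambda>q. f (q$1) (q$2)) p = Dx f (p$1) (p$2)" "pd 2 (\<lambda>q. f (q$1) (q$2)) p = Dy f (p$1) (p$2)" for f p
    unfolding Dx_def Dy_def vector2_eta by auto
  let ?E = "\<lambda>p i j k. 0 = pd i (pd j (\<lambda>q. Y q $ k)) p
        + (\<Sum>l\<in>UNIV.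
              Y p $ l * pd l (\<lambda>q. christoffel ?xi q i j k) p
            - christoffel ?xi p i j l * pd l (\<lambda>q. Y q $ k) p
            + christoffel ?xi p i l k * pd j (\<lambda>q. Y q $ l) p
            + christoffel ?xi p l j k * pd i (\<lambda>q. Y q $ l) p)"
  let ?K = "\<lambda>x y. killing_eqs A B C D E F S T x (u x y) (Dx u x y) (Dy u x y)
       (Dx (Dx u) x y) (Dy (Dx u) x y) (Dy (Dy u) x y)
       (Dx v x y) (Dy v x y) (Dx (Dx v) x y) (Dy (Dx v) x y) (Dy (Dy v) x y)"
  have *: "(\<forall>i j k. ?E p i j k) \<longleftrightarrow> ?K (p$1) (p$2)" if p: "p \<in> half_plane" for p
  proof -
    have x: "0 < p$1" using p by (simp add: half_plane_def)
    \<comment> \<open>The shape of each component after expansion: a second derivative plus the two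
      summands of the index \<open>l\<close>. The matching is done equation by equation.\<close>
    have c: "0 = a + (b + c) \<longleftrightarrow> 0 = r" if "r = a + (b + c)" for a b c r :: real using that by simp
    show ?thesis
      unfolding killing_eqs_iff[OF x] forall_2 sum_2 conj_assoc
      by (simp only: eq_commute[of _ "0::real"], intro arg_cong2[where f = "(\<and>)"] c)
         (simp_all add: pd_const_over_x[OF p] d[OF p] dd[OF p] DD Y[OF p] x[THEN less_imp_neq[symmetric]]
         christoffel_def model_def vector_8 Dx_Dy_commute[OF uv(1) x] Dx_Dy_commute[OF uv(2) x])
  qed
  have "(\<forall>p\<in>half_plane. \<forall>i j k. ?E p i j k) \<longleftrightarrow> (\<forall>x>0. \<forall>y. ?K x y)"
  proof (intro iffI allI impI ballI)
    fix x y :: real assume "\<forall>p\<in>half_plane. \<forall>i j k. ?E p i j k" "0 < x"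
    then show "?K x y" using *[of "vector [x, y]"] by simp
  next
    fix p i j k assume "\<forall>x>0. \<forall>y. ?K x y" "p \<in> half_plane"
    then show "?E p i j k" using *[of p] unfolding half_plane_def by blast
  qed
  then show ?thesis using smY uv 0 unfolding killing_def kfield_def by blast
qed

lemma kfield_smooth2: "kfield A B C D E F S T u v \<Longrightarrow> smooth2 u \<and> smooth2 v" by (simp add: kfield_def)

lemma killing_eqsD:
  assumes "kfield A B C D E F S T u v" "0 < x"
  shows "killing_eqs A B C D E F S T x (u x y) (Dx u x y) (Dy u x y)
       (Dx (Dx u) x y) (Dy (Dx u) x y) (Dy (Dy u) x y)
       (Dx v x y) (Dy v x y) (Dx (Dx v) x y) (Dy (Dx v) x y) (Dy (Dy v) x y)"
  using assms by (simp add: kfield_def)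

text \<open>A class closed under both partial derivatives and containing the ingredients of all
  listed fields, so that \<open>smooth_on_coinduct\<close> applies. Powers and logarithms are taken
  of the first coordinate alone, which is positive on the half plane.\<close>

inductive elementary :: "(real \<Rightarrow> real \<Rightarrow> real) \<Rightarrow> bool" where
  const: "elementary (\<lambda>x y. c)"
| fst: "elementary (\<lambda>x y. x)"
| snd: "elementary (\<lambda>x y. y)"
| powr: "elementary (\<lambda>x y. x powr c)"
| ln: "elementary (\<lambda>x y. ln x)"
| add: "elementary f \<Longrightarrow> elementary g \<Longrightarrow> elementary (\<lambda>x y. f x y + g x y)"
| mult: "elementary f \<Longrightarrow> elementary g \<Longrightarrow> elementary (\<lambda>x y. f x y * g x y)"

lemma elementary_has_derivative:
  assumes "elementary f"
  shows "\<exists>g h. elementary g \<and> elementary h \<and> (\<forall>p\<in>half_plane.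
    ((\<lambda>p::real^2. f (p$1) (p$2)) has_derivative (\<lambda>v. g (p$1) (p$2) * v$1 + h (p$1) (p$2) * v$2)) (at p))"
proof -
  have D: "((\<lambda>p::real^2. p$i) has_derivative (\<lambda>v. v$i)) (at p)" for i p
    by (rule bounded_linear_imp_has_derivative[OF bounded_linear_vec_nth])
  show ?thesis
    using assms
  proof induction
    case (const c)
    show ?case
      by (intro exI[of _ "\<lambda>x y. 0"] conjI ballI elementary.intros) simp
  next
    case fst
    show ?case
      by (intro exI[of _ "\<lambda>x y. 1"] exI[of _ "\<lambda>x y. 0"] conjI ballI elementary.intros) (simp add: D)
  next
    case snd
    show ?case
      by (intro exI[of _ "\<lambda>x y. 0"] exI[of _ "\<lambda>x y. 1"] conjI ballI elementary.intros) (simp add: D)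
  next
    case (powr c)
    have "((\<lambda>p::real^2. p$1 powr c) has_derivative (\<lambda>v. c * p$1 powr (c - 1) * v$1 + 0 * v$2)) (at p)"
      if "p \<in> half_plane" for p
    proof -
      have "((\<lambda>x. x powr c) has_derivative (\<lambda>h. c * p$1 powr (c - 1) * h)) (at (p$1))"
        using that has_real_derivative_powr[of "p$1" c]
        by (simp add: half_plane_def has_field_derivative_def)
      from has_derivative_compose[OF D this] show ?thesis by simp
    qed
    then show ?case
      by (intro exI[of _ "\<lambda>x y. c * x powr (c - 1)"] exI[of _ "\<lambda>x y. 0"] conjI ballI elementary.intros)
  next
    case ln
    \<comment> \<open>Quotients are not in the class, so \<open>1 / x\<close> is written as the
      power with exponent \<open>- 1\<close>.\<close>
    have "((\<lambda>p::real^2. ln (p$1)) has_derivative (\<lambda>v. p$1 powr (- 1) * v$1 + 0 * v$2)) (at p)"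
      if "p \<in> half_plane" for p
    proof -
      have "(ln has_derivative (\<lambda>h. p$1 powr (- 1) * h)) (at (p$1))"
        using that DERIV_ln[of "p$1"]
        by (simp add: half_plane_def has_field_derivative_def powr_minus)
      from has_derivative_compose[OF D this] show ?thesis by simp
    qed
    then show ?case
      by (intro exI[of _ "\<lambda>x y. x powr (- 1)"] exI[of _ "\<lambda>x y. 0"] conjI ballI elementary.intros)
  next
    case (add f1 f2)
    then obtain g1 h1 g2 h2 where e: "elementary g1" "elementary h1" "elementary g2" "elementary h2"
      and "\<forall>p\<in>half_plane. ((\<lambda>p::real^2. f1 (p$1) (p$2)) has_derivative (\<lambda>v. g1 (p$1) (p$2) * v$1 + h1 (p$1) (p$2) * v$2)) (at p)"
      and "\<forall>p\<in>half_plane. ((\<lambda>p::real^2. f2 (p$1) (p$2)) has_derivative (\<lambda>v. g2 (p$1) (p$2) * v$1 + h2 (p$1) (p$2) * v$2)) (at p)"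
      by blast
    then have "((\<lambda>p::real^2. f1 (p$1) (p$2) + f2 (p$1) (p$2)) has_derivative
        (\<lambda>v. (g1 (p$1) (p$2) + g2 (p$1) (p$2)) * v$1 + (h1 (p$1) (p$2) + h2 (p$1) (p$2)) * v$2)) (at p)"
      if "p \<in> half_plane" for p
      using has_derivative_add[of "\<lambda>p::real^2. f1 (p$1) (p$2)" _ "at p" "\<lambda>p::real^2. f2 (p$1) (p$2)"] that
      by (fastforce simp: algebra_simps)
    with e show ?case
      by (intro exI[of _ "\<lambda>x y. g1 x y + g2 x y"] exI[of _ "\<lambda>x y. h1 x y + h2 x y"] conjI ballI elementary.intros)
  next
    case (mult f1 f2)
    then obtain g1 h1 g2 h2 where e: "elementary g1" "elementary h1" "elementary g2" "elementary h2"
      and d: "\<forall>p\<in>half_plane. ((\<lambda>p::real^2. f1 (p$1) (p$2)) has_derivative (\<lambda>v. g1 (p$1) (p$2) * v$1 + h1 (p$1) (p$2) * v$2)) (at p)"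
      "\<forall>p\<in>half_plane. ((\<lambda>p::real^2. f2 (p$1) (p$2)) has_derivative (\<lambda>v. g2 (p$1) (p$2) * v$1 + h2 (p$1) (p$2) * v$2)) (at p)"
      by blast
    have "((\<lambda>p::real^2. f1 (p$1) (p$2) * f2 (p$1) (p$2)) has_derivative
        (\<lambda>v. (f1 (p$1) (p$2) * g2 (p$1) (p$2) + f2 (p$1) (p$2) * g1 (p$1) (p$2)) * v$1
           + (f1 (p$1) (p$2) * h2 (p$1) (p$2) + f2 (p$1) (p$2) * h1 (p$1) (p$2)) * v$2)) (at p)"
      if "p \<in> half_plane" for p
      using has_derivative_mult[OF d(1)[rule_format, OF that] d(2)[rule_format, OF that]]
      by (simp add: algebra_simps)
    with e mult.hyps show ?case
      by (intro exI[of _ "\<lambda>x y. f1 x y * g2 x y + f2 x y * g1 x y"] exI[of _ "\<lambda>x y. f1 x y * h2 x y + f2 x y * h1 x y"]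
          conjI ballI elementary.intros)
  qed
qed

lemma elementary_smooth2:
  assumes "elementary f" shows "smooth2 f"
  unfolding smooth2_def
proof (rule smooth_on_coinduct[OF open_half_plane, where G = "\<lambda>h. \<exists>f. elementary f \<and> h = (\<lambda>p. f (p$1) (p$2))"])
  show "\<exists>g. elementary g \<and> (\<lambda>p. f (p$1) (p$2)) = (\<lambda>p. g (p$1) (p$2))" using assms by blast
  fix h :: "real^2 \<Rightarrow> real" assume "\<exists>f. elementary f \<and> h = (\<lambda>p. f (p$1) (p$2))"
  then obtain f where f: "elementary f" "h = (\<lambda>p. f (p$1) (p$2))" by blast
  from elementary_has_derivative[OF f(1)] obtain g k where e: "elementary g" "elementary k"
    and d: "\<forall>p\<in>half_plane. (h has_derivative (\<lambda>v. g (p$1) (p$2) * v$1 + k (p$1) (p$2) * v$2)) (at p)"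
    unfolding f(2) by blast
  show "h differentiable (at p)" if "p \<in> half_plane" for p
    using d that differentiableI by blast
  show "\<exists>j. (\<exists>f. elementary f \<and> j = (\<lambda>p. f (p$1) (p$2))) \<and> (\<forall>p\<in>half_plane. frechet_derivative h (at p) v = j p)" for v
  proof (intro exI conjI ballI)
    show "elementary (\<lambda>x y. g x y * v$1 + k x y * v$2)" using e by (intro elementary.intros)
    show "frechet_derivative h (at p) v = (\<lambda>p. g (p$1) (p$2) * v$1 + k (p$1) (p$2) * v$2) p" if "p \<in> half_plane" for p
      using frechet_derivative_at[OF d[rule_format, OF that], symmetric] by simp
  qed simp
qed

lemma killing_vf: "vf (\<lambda>x y. (u x y, v x y)) \<in> killing (model A B C D E F S T) \<longleftrightarrow> kfield A B C D E F S T u v"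
  by (rule killing_iff_kfield) (simp_all add: vf_def)

lemma killing_cases:
  assumes "Y \<in> killing (model A B C D E F S T)"
  obtains u v where "kfield A B C D E F S T u v" "Y = vf (\<lambda>x y. (u x y, v x y))"
proof -
  let ?u = "\<lambda>x y. Y (vector [x, y]) $ 1" and ?v = "\<lambda>x y. Y (vector [x, y]) $ 2"
  have "Y = vf (\<lambda>x y. (?u x y, ?v x y))"
    using assms by (auto simp: fun_eq_iff vf_def vector2_eta killing_def vec_eq_iff forall_2)
  with assms that[of ?u ?v] killing_vf[of ?u ?v] show ?thesis by simp
qed

section \<open>Operations that preserve Killing fields\<close>

lemma kfield_lincomb:
  assumes "kfield A B C D E F S T u v" "kfield A B C D E F S T u' v'"
  shows "kfield A B C D E F S T (\<lambda>x y. a * u x y + b * u' x y) (\<lambda>x y. a * v x y + b * v' x y)"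
proof -
  have S: "smooth2 u" "smooth2 v" "smooth2 u'" "smooth2 v'" using assms by (auto simp: kfield_def)
  have d2: "Dx (Dx (\<lambda>x y. a * f x y + b * g x y)) x y = a * Dx (Dx f) x y + b * Dx (Dx g) x y"
    "Dy (Dx (\<lambda>x y. a * f x y + b * g x y)) x y = a * Dy (Dx f) x y + b * Dy (Dx g) x y"
    "Dy (Dy (\<lambda>x y. a * f x y + b * g x y)) x y = a * Dy (Dy f) x y + b * Dy (Dy g) x y"
    if "smooth2 f" "smooth2 g" "0 < x" for f g x y
  proof -
    have e: "Dx (\<lambda>x y. a * f x y + b * g x y) x y = a * Dx f x y + b * Dx g x y"
      "Dy (\<lambda>x y. a * f x y + b * g x y) x y = a * Dy f x y + b * Dy g x y" if "0 < x" for x y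
      using Dx_lincomb Dy_lincomb \<open>smooth2 f\<close> \<open>smooth2 g\<close> that by auto
    show "Dx (Dx (\<lambda>x y. a * f x y + b * g x y)) x y = a * Dx (Dx f) x y + b * Dx (Dx g) x y"
      using Dx_cong[OF smooth2_lincomb[OF smooth2_Dx[OF that(1)] smooth2_Dx[OF that(2)], of a b] e(1) that(3)]
        Dx_lincomb[OF smooth2_Dx[OF that(1)] smooth2_Dx[OF that(2)] that(3)] by simp
    show "Dy (Dx (\<lambda>x y. a * f x y + b * g x y)) x y = a * Dy (Dx f) x y + b * Dy (Dx g) x y"
      using Dy_cong[OF smooth2_lincomb[OF smooth2_Dx[OF that(1)] smooth2_Dx[OF that(2)], of a b] e(1) that(3)]
        Dy_lincomb[OF smooth2_Dx[OF that(1)] smooth2_Dx[OF that(2)] that(3)] by simp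
    show "Dy (Dy (\<lambda>x y. a * f x y + b * g x y)) x y = a * Dy (Dy f) x y + b * Dy (Dy g) x y"
      using Dy_cong[OF smooth2_lincomb[OF smooth2_Dy[OF that(1)] smooth2_Dy[OF that(2)], of a b] e(2) that(3)]
        Dy_lincomb[OF smooth2_Dy[OF that(1)] smooth2_Dy[OF that(2)] that(3)] by simp
  qed
  have lin: "killing_eqs A B C D E F S T x (a * u + b * u') (a * ux + b * ux') (a * uy + b * uy')
      (a * uxx + b * uxx') (a * uxy + b * uxy') (a * uyy + b * uyy') (a * vx + b * vx') (a * vy + b * vy')
      (a * vxx + b * vxx') (a * vxy + b * vxy') (a * vyy + b * vyy')"
    if "killing_eqs A B C D E F S T x u ux uy uxx uxy uyy vx vy vxx vxy vyy"
      "killing_eqs A B C D E F S T x u' ux' uy' uxx' uxy' uyy' vx' vy' vxx' vxy' vyy'"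
    for x u ux uy uxx uxy uyy vx vy vxx vxy vyy u' ux' uy' uxx' uxy' uyy' vx' vy' vxx' vxy' vyy'
    using that unfolding killing_eqs_def by (elim conjE, intro conjI; algebra)
  show ?thesis
    using assms unfolding kfield_def
    by (simp add: S smooth2_lincomb d2 Dx_lincomb Dy_lincomb lin)
qed

lemma zero_has_derivative:
  fixes g :: "real \<Rightarrow> real"
  assumes "(g has_real_derivative d) (at y)" "\<And>t. g t = 0" shows "d = 0"
proof -
  have "g = (\<lambda>t. 0)" using assms(2) by auto
  with assms(1) show ?thesis using DERIV_unique[OF _ DERIV_const] by blast
qed

text \<open>The equations are linear in the derivatives, with coefficients depending on
  \<open>x\<close> alone, so they may be differentiated along a line of constant
  \<open>x\<close>.\<close>

lemma killing_eqs_deriv: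
  assumes "\<And>t. killing_eqs A B C D E F S T x (u t) (ux t) (uy t) (uxx t) (uxy t) (uyy t) (vx t) (vy t) (vxx t) (vxy t) (vyy t)"
    and d: "(u has_real_derivative u') (at y)" "(ux has_real_derivative ux') (at y)" "(uy has_real_derivative uy') (at y)"
    "(uxx has_real_derivative uxx') (at y)" "(uxy has_real_derivative uxy') (at y)" "(uyy has_real_derivative uyy') (at y)"
    "(vx has_real_derivative vx') (at y)" "(vy has_real_derivative vy') (at y)"
    "(vxx has_real_derivative vxx') (at y)" "(vxy has_real_derivative vxy') (at y)" "(vyy has_real_derivative vyy') (at y)"
  shows "killing_eqs A B C D E F S T x u' ux' uy' uxx' uxy' uyy' vx' vy' vxx' vxy' vyy'"
proof -
  note k = assms(1)[unfolded killing_eqs_def]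
  have e1: "x\<^sup>2 * uxx' - A * u' + x * (A * ux' - B * uy' + 2 * C * vx') = 0"
    by (rule zero_has_derivative[where g = "\<lambda>t. x\<^sup>2 * uxx t - A * u t + x * (A * ux t - B * uy t + 2 * C * vx t)"], (auto intro!: derivative_eq_intros d)[1], simp add: k)
  have e2: "x\<^sup>2 * vxx' - B * u' + x * ((2 * D - A) * vx' - B * vy' + 2 * B * ux') = 0"
    by (rule zero_has_derivative[where g = "\<lambda>t. x\<^sup>2 * vxx t - B * u t + x * ((2 * D - A) * vx t - B * vy t + 2 * B * ux t)"], (auto intro!: derivative_eq_intros d)[1], simp add: k)
  have e3: "x\<^sup>2 * uxy' - C * u' + x * ((A - D) * uy' + C * vy' + E * vx') = 0"
    by (rule zero_has_derivative[where g = "\<lambda>t. x\<^sup>2 * uxy t - C * u t + x * ((A - D) * uy t + C * vy t + E * vx t)"], (auto intro!: derivative_eq_intros d)[1], simp add: k)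
  have e4: "x\<^sup>2 * vxy' - D * u' + x * ((F - C) * vx' + B * uy' + D * ux') = 0"
    by (rule zero_has_derivative[where g = "\<lambda>t. x\<^sup>2 * vxy t - D * u t + x * ((F - C) * vx t + B * uy t + D * ux t)"], (auto intro!: derivative_eq_intros d)[1], simp add: k)
  have e5: "x\<^sup>2 * uyy' - E * u' + x * ((2 * C - F) * uy' - E * ux' + 2 * E * vy') = 0"
    by (rule zero_has_derivative[where g = "\<lambda>t. x\<^sup>2 * uyy t - E * u t + x * ((2 * C - F) * uy t - E * ux t + 2 * E * vy t)"], (auto intro!: derivative_eq_intros d)[1], simp add: k)
  have e6: "x\<^sup>2 * vyy' - F * u' + x * (2 * D * uy' - E * vx' + F * vy') = 0"
    by (rule zero_has_derivative[where g = "\<lambda>t. x\<^sup>2 * vyy t - F * u t + x * (2 * D * uy t - E * vx t + F * vy t)"], (auto intro!: derivative_eq_intros d)[1], simp add: k)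
  have e7: "S * u' - x * (S * vy' - T * uy') = 0"
    by (rule zero_has_derivative[where g = "\<lambda>t. S * u t - x * (S * vy t - T * uy t)"], (auto intro!: derivative_eq_intros d)[1], simp add: k)
  have e8: "T * u' - x * (T * ux' - S * vx') = 0"
    by (rule zero_has_derivative[where g = "\<lambda>t. T * u t - x * (T * ux t - S * vx t)"], (auto intro!: derivative_eq_intros d)[1], simp add: k)
  show ?thesis unfolding killing_eqs_def using e1 e2 e3 e4 e5 e6 e7 e8 by simp
qed

text \<open>The bracket with d/dy, in components. Commuting partial derivatives turns each
  derivative of \<open>Dy u\<close> and \<open>Dy v\<close> into a y-derivative of a quantity that
  already occurs in the system.\<close>

lemma kfield_Dy:
  assumes "kfield A B C D E F S T u v"
  shows "kfield A B C D E F S T (Dy u) (Dy v)"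
proof -
  have S: "smooth2 u" "smooth2 v" using kfield_smooth2[OF assms] by auto
  note k = killing_eqsD[OF assms]
  have c: "Dx (Dy f) x y = Dy (Dx f) x y" "Dx (Dx (Dy f)) x y = Dy (Dx (Dx f)) x y"
    "Dy (Dx (Dy f)) x y = Dy (Dy (Dx f)) x y" if "smooth2 f" "0 < x" for f x y
  proof -
    show "Dx (Dy f) x y = Dy (Dx f) x y" by (rule Dx_Dy_commute[OF that])
    show "Dx (Dx (Dy f)) x y = Dy (Dx (Dx f)) x y"
      using Dx_cong[OF smooth2_Dy[OF smooth2_Dx[OF that(1)]] Dx_Dy_commute[OF that(1)] that(2)]
        Dx_Dy_commute[OF smooth2_Dx[OF that(1)] that(2)] by simp
    show "Dy (Dx (Dy f)) x y = Dy (Dy (Dx f)) x y"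
      by (rule Dy_cong[OF smooth2_Dy[OF smooth2_Dx[OF that(1)]] Dx_Dy_commute[OF that(1)] that(2)])
  qed
  show ?thesis
    unfolding kfield_def
  proof (intro conjI allI impI)
    fix x y :: real assume x: "0 < x"
    show "killing_eqs A B C D E F S T x (Dy u x y) (Dx (Dy u) x y) (Dy (Dy u) x y)
       (Dx (Dx (Dy u)) x y) (Dy (Dx (Dy u)) x y) (Dy (Dy (Dy u)) x y)
       (Dx (Dy v) x y) (Dy (Dy v) x y) (Dx (Dx (Dy v)) x y) (Dy (Dx (Dy v)) x y) (Dy (Dy (Dy v)) x y)"
      unfolding c[OF S(1) x] c[OF S(2) x]
      by (rule killing_eqs_deriv[OF k[OF x]]; rule smooth2_dy[OF _ x]; intro smooth2_Dx smooth2_Dy S)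
  qed (intro smooth2_Dy S)+
qed

text \<open>Symbols of degree -1 make homotheties affine maps. This is the pullback under
  \<open>p \<mapsto> 2 p\<close> up to the factor 1/2, which linearity makes harmless.\<close>

lemma kfield_dilate:
  assumes "kfield A B C D E F S T u v"
  shows "kfield A B C D E F S T (\<lambda>x y. u (2 * x) (2 * y)) (\<lambda>x y. v (2 * x) (2 * y))"
proof -
  have S: "smooth2 u" "smooth2 v" using kfield_smooth2[OF assms] by auto
  note k = killing_eqsD[OF assms]
  have d2: "Dx (Dx (\<lambda>x y. f (2 * x) (2 * y))) x y = 4 * Dx (Dx f) (2 * x) (2 * y)"
    "Dy (Dx (\<lambda>x y. f (2 * x) (2 * y))) x y = 4 * Dy (Dx f) (2 * x) (2 * y)"
    "Dy (Dy (\<lambda>x y. f (2 * x) (2 * y))) x y = 4 * Dy (Dy f) (2 * x) (2 * y)"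
    if "smooth2 f" "0 < x" for f x y
  proof -
    have e: "Dx (\<lambda>x y. f (2 * x) (2 * y)) x y = 2 * Dx f (2 * x) (2 * y) + 0 * Dx f (2 * x) (2 * y)"
       "Dy (\<lambda>x y. f (2 * x) (2 * y)) x y = 2 * Dy f (2 * x) (2 * y) + 0 * Dy f (2 * x) (2 * y)" if "0 < x" for x y
      using Dx_dilate[OF \<open>smooth2 f\<close> that] Dy_dilate[OF \<open>smooth2 f\<close> that] by simp_all
    note S = smooth2_dilate[OF smooth2_Dx[OF that(1)]] smooth2_dilate[OF smooth2_Dy[OF that(1)]]
    show "Dx (Dx (\<lambda>x y. f (2 * x) (2 * y))) x y = 4 * Dx (Dx f) (2 * x) (2 * y)"
      using Dx_cong[OF smooth2_lincomb[OF S(1) S(1), of 2 0] e(1) that(2)]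
        Dx_lincomb[OF S(1) S(1) that(2), of 2 0] Dx_dilate[OF smooth2_Dx[OF that(1)] that(2)] by simp
    show "Dy (Dx (\<lambda>x y. f (2 * x) (2 * y))) x y = 4 * Dy (Dx f) (2 * x) (2 * y)"
      using Dy_cong[OF smooth2_lincomb[OF S(1) S(1), of 2 0] e(1) that(2)]
        Dy_lincomb[OF S(1) S(1) that(2), of 2 0] Dy_dilate[OF smooth2_Dx[OF that(1)] that(2)] by simp
    show "Dy (Dy (\<lambda>x y. f (2 * x) (2 * y))) x y = 4 * Dy (Dy f) (2 * x) (2 * y)"
      using Dy_cong[OF smooth2_lincomb[OF S(2) S(2), of 2 0] e(2) that(2)]
        Dy_lincomb[OF S(2) S(2) that(2), of 2 0] Dy_dilate[OF smooth2_Dy[OF that(1)] that(2)] by simp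
  qed
  \<comment> \<open>Each derivative brings a factor 2, and in the equations a derivative of order k
    is always accompanied by the k-th power of \<open>x\<close>.\<close>
  have scale: "killing_eqs A B C D E F S T x u (2 * ux) (2 * uy) (4 * uxx) (4 * uxy) (4 * uyy) (2 * vx) (2 * vy) (4 * vxx) (4 * vxy) (4 * vyy)"
    if "killing_eqs A B C D E F S T (2 * x) u ux uy uxx uxy uyy vx vy vxx vxy vyy"
    for x u ux uy uxx uxy uyy vx vy vxx vxy vyy
    using that unfolding killing_eqs_def by (elim conjE, intro conjI; algebra)
  show ?thesis
    unfolding kfield_def using k by (simp add: S smooth2_dilate d2 Dx_dilate Dy_dilate scale)
qed

section \<open>Uniqueness of a Killing field with a given 1-jet\<close>

lemma vanishing_of_linear_bound:
  fixes z dz :: "'i \<Rightarrow> real \<Rightarrow> real"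
  assumes I: "finite I" and c: "c \<in> {a..b}" "\<And>i. i \<in> I \<Longrightarrow> z i c = 0"
    and der: "\<And>i t. i \<in> I \<Longrightarrow> t \<in> {a..b} \<Longrightarrow> (z i has_real_derivative dz i t) (at t)"
    and bound: "\<And>i t. i \<in> I \<Longrightarrow> t \<in> {a..b} \<Longrightarrow> \<bar>dz i t\<bar> \<le> K * (\<Sum>j\<in>I. \<bar>z j t\<bar>)"
    and t: "t \<in> {a..b}" and i: "i \<in> I"
  shows "z i t = 0"
proof -
  let ?s = "\<lambda>t. \<Sum>j\<in>I. \<bar>z j t\<bar>"
  \<comment> \<open>Gronwall's argument is run on the sum of squares, which is differentiable,
    unlike the sum of absolute values in the hypothesis.\<close>
  define g where "g t = (\<Sum>j\<in>I. (z j t)\<^sup>2)" for t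
  define g' where "g' t = (\<Sum>j\<in>I. 2 * z j t * dz j t)" for t
  \<comment> \<open>The factor \<open>card I\<close> comes from the Cauchy-Schwarz inequality for
    the square of the sum of absolute values.\<close>
  define L where "L = 2 * \<bar>K\<bar> * card I"
  have g: "(g has_real_derivative g' t) (at t)" if "t \<in> {a..b}" for t
    unfolding g_def g'_def using der[OF _ that]
    by (auto intro!: derivative_eq_intros sum.cong simp: power2_eq_square)
  have gb: "\<bar>g' t\<bar> \<le> L * g t" if t: "t \<in> {a..b}" for t
  proof -
    have "\<bar>g' t\<bar> \<le> (\<Sum>j\<in>I. \<bar>2 * z j t * dz j t\<bar>)" unfolding g'_def by (rule sum_abs)
    also have "\<dots> \<le> (\<Sum>j\<in>I. 2 * \<bar>z j t\<bar> * (\<bar>K\<bar> * ?s t))"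
    proof (rule sum_mono)
      fix j assume j: "j \<in> I"
      have "K * ?s t \<le> \<bar>K\<bar> * ?s t" by (intro mult_right_mono sum_nonneg) auto
      then have "\<bar>dz j t\<bar> \<le> \<bar>K\<bar> * ?s t" using bound[OF j t] by linarith
      then have "2 * \<bar>z j t\<bar> * \<bar>dz j t\<bar> \<le> 2 * \<bar>z j t\<bar> * (\<bar>K\<bar> * ?s t)" by (intro mult_left_mono) auto
      then show "\<bar>2 * z j t * dz j t\<bar> \<le> 2 * \<bar>z j t\<bar> * (\<bar>K\<bar> * ?s t)" by (simp add: abs_mult)
    qed
    also have "\<dots> = 2 * \<bar>K\<bar> * (?s t)\<^sup>2"
      by (simp add: sum_distrib_left[symmetric] sum_distrib_right[symmetric] power2_eq_square)
    also have "\<dots> \<le> 2 * \<bar>K\<bar> * (card I * (\<Sum>j\<in>I. \<bar>z j t\<bar>\<^sup>2))"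
      using sum_squared_le_sum_of_squares[of "\<lambda>j. \<bar>z j t\<bar>" I]
      by (intro mult_left_mono) (auto simp: mult.commute)
    finally show ?thesis by (simp add: L_def g_def mult.assoc)
  qed
  have g0: "g c = 0" unfolding g_def using c(2) by simp
  have "g t \<le> 0"
  proof (cases "c \<le> t")
    case True
    have "g t * exp (- L * t) \<le> g c * exp (- L * c)"
    proof (rule DERIV_nonpos_imp_nonincreasing[OF True])
      fix s assume "c \<le> s" "s \<le> t"
      then have s: "s \<in> {a..b}" using c(1) t by auto
      have "((\<lambda>t. g t * exp (- L * t)) has_real_derivative (g' s - L * g s) * exp (- L * s)) (at s)"
        using g[OF s] by (auto intro!: derivative_eq_intros simp: algebra_simps)
      moreover have "(g' s - L * g s) * exp (- L * s) \<le> 0"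
        using gb[OF s] by (intro mult_nonpos_nonneg) auto
      ultimately show "\<exists>y. ((\<lambda>t. g t * exp (- L * t)) has_real_derivative y) (at s) \<and> y \<le> 0" by blast
    qed
    then show ?thesis using g0 by (simp add: mult_le_0_iff)
  next
    case False
    then have le: "t \<le> c" by simp
    \<comment> \<open>To the left of \<open>c\<close> the weight is inverted: the product is
      nondecreasing up to \<open>c\<close>, where it vanishes.\<close>
    have "g t * exp (L * t) \<le> g c * exp (L * c)"
    proof (rule DERIV_nonneg_imp_nondecreasing[OF le])
      fix s assume "t \<le> s" "s \<le> c"
      then have s: "s \<in> {a..b}" using c(1) t by auto
      have "((\<lambda>t. g t * exp (L * t)) has_real_derivative (g' s + L * g s) * exp (L * s)) (at s)"
        using g[OF s] by (auto intro!: derivative_eq_intros simp: algebra_simps)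
      moreover have "0 \<le> (g' s + L * g s) * exp (L * s)"
        using gb[OF s] by (intro mult_nonneg_nonneg) auto
      ultimately show "\<exists>y. ((\<lambda>t. g t * exp (L * t)) has_real_derivative y) (at s) \<and> 0 \<le> y" by blast
    qed
    then show ?thesis using g0 by (simp add: mult_le_0_iff)
  qed
  moreover have "(z i t)\<^sup>2 \<le> g t" unfolding g_def by (rule member_le_sum[OF i]) (auto simp: I)
  ultimately have "(z i t)\<^sup>2 \<le> 0" by linarith
  from order_antisym[OF this zero_le_power2] show ?thesis by simp
qed

text \<open>The system expresses all second derivatives linearly in the 1-jet, with coefficients
  that stay bounded for \<open>x \<ge> m\<close>. \<open>v\<close> is included in
  \<open>\<sigma>\<close> so that \<open>\<sigma>\<close> measures the whole 1-jet.\<close>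

lemma killing_eqs_bounds:
  fixes x v :: real
  assumes k: "killing_eqs A B C D E F S T x u ux uy uxx uxy uyy vx vy vxx vxy vyy" and x: "0 < m" "m \<le> x"
  defines "P \<equiv> \<bar>A\<bar> + \<bar>B\<bar> + \<bar>C\<bar> + \<bar>D\<bar> + \<bar>E\<bar> + \<bar>F\<bar>"
    and "\<sigma> \<equiv> \<bar>u\<bar> + \<bar>v\<bar> + \<bar>ux\<bar> + \<bar>uy\<bar> + \<bar>vx\<bar> + \<bar>vy\<bar>"
  shows "{\<bar>uxx\<bar>, \<bar>uxy\<bar>, \<bar>uyy\<bar>, \<bar>vxx\<bar>, \<bar>vxy\<bar>, \<bar>vyy\<bar>} \<subseteq> {.. (P / m\<^sup>2 + 6 * P / m) * \<sigma>}"
proof -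
  have P0: "0 \<le> P" "0 \<le> \<sigma>" by (simp_all add: P_def \<sigma>_def)
  have b: "\<bar>c * z\<bar> \<le> P * \<sigma>" if "\<bar>c\<bar> \<le> P" "\<bar>z\<bar> \<le> \<sigma>" for c z
    unfolding abs_mult using that P0 by (intro mult_mono) auto
  have main: "\<bar>w\<bar> \<le> (P / m\<^sup>2 + 6 * P / m) * \<sigma>"
    if w: "x\<^sup>2 * w - c * u + x * r = 0" and c: "\<bar>c\<bar> \<le> P" and r: "\<bar>r\<bar> \<le> 6 * (P * \<sigma>)" for w c r
  proof -
    have "w = c * u / x\<^sup>2 - r / x" using w x by (simp add: field_simps power2_eq_square)
    then have "\<bar>w\<bar> \<le> \<bar>c * u\<bar> / x\<^sup>2 + \<bar>r\<bar> / x"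
      using x abs_triangle_ineq4[of "c * u / x\<^sup>2" "r / x"] by (simp add: abs_divide)
    also have "\<dots> \<le> P * \<sigma> / m\<^sup>2 + 6 * (P * \<sigma>) / m"
    proof (intro add_mono frac_le)
      show "\<bar>c * u\<bar> \<le> P * \<sigma>" by (rule b[OF c]) (simp add: \<sigma>_def)
      show "m\<^sup>2 \<le> x\<^sup>2" using x by (intro power_mono) auto
    qed (use r x P0 in auto)
    finally show ?thesis by (simp add: algebra_simps)
  qed
  have c: "\<bar>A\<bar> \<le> P" "\<bar>B\<bar> \<le> P" "\<bar>C\<bar> \<le> P" "\<bar>D\<bar> \<le> P" "\<bar>E\<bar> \<le> P" "\<bar>F\<bar> \<le> P" by (auto simp: P_def)
  have z: "\<bar>ux\<bar> \<le> \<sigma>" "\<bar>uy\<bar> \<le> \<sigma>" "\<bar>vx\<bar> \<le> \<sigma>" "\<bar>vy\<bar> \<le> \<sigma>" by (auto simp: \<sigma>_def)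
  note bs = c[THEN b, OF z(1)] c[THEN b, OF z(2)] c[THEN b, OF z(3)] c[THEN b, OF z(4)]
  \<comment> \<open>The number 6 counts products of a parameter and a derivative with multiplicity;
    the second and fifth brackets reach it.\<close>
  have "\<bar>A * ux - B * uy + 2 * C * vx\<bar> \<le> 6 * (P * \<sigma>)"
    "\<bar>(2 * D - A) * vx - B * vy + 2 * B * ux\<bar> \<le> 6 * (P * \<sigma>)"
    "\<bar>(A - D) * uy + C * vy + E * vx\<bar> \<le> 6 * (P * \<sigma>)"
    "\<bar>(F - C) * vx + B * uy + D * ux\<bar> \<le> 6 * (P * \<sigma>)"
    "\<bar>(2 * C - F) * uy - E * ux + 2 * E * vy\<bar> \<le> 6 * (P * \<sigma>)"
    "\<bar>2 * D * uy - E * vx + F * vy\<bar> \<le> 6 * (P * \<sigma>)"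
    using bs unfolding abs_le_iff left_diff_distrib distrib_right by (safe; linarith)+
  with k show ?thesis unfolding killing_eqs_def
    by (auto intro: main[OF _ c(1)] main[OF _ c(2)] main[OF _ c(3)] main[OF _ c(4)] main[OF _ c(5)] main[OF _ c(6)])
qed

text \<open>The 1-jet satisfies a closed linear first-order system along each coordinate line.
  Uniqueness is applied on the horizontal segment from \<open>(1, 0)\<close> to
  \<open>(x, 0)\<close> and on the vertical one from there to \<open>(x, y)\<close>.\<close>

lemma kfield_zero_jet:
  assumes kfield: "kfield A B C D E F S T u v"
    and jet: "u 1 0 = 0" "Dx u 1 0 = 0" "Dy u 1 0 = 0" "v 1 0 = 0" "Dx v 1 0 = 0" "Dy v 1 0 = 0"
    and x: "0 < x"
  shows "u x y = 0 \<and> v x y = 0"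
proof -
  have S: "smooth2 u" "smooth2 v" using kfield_smooth2[OF kfield] by auto
  note k = killing_eqsD[OF kfield]
  define fs where "fs = [u, v, Dx u, Dy u, Dx v, Dy v]"
  \<comment> \<open>Keeps the segment between 1 and \<open>x\<close> away from the singular line
    \<open>x = 0\<close>.\<close>
  define m where "m = min 1 x"
  have m: "0 < m" "m \<le> 1" "m \<le> x" using x by (auto simp: m_def)
  define P where "P = \<bar>A\<bar> + \<bar>B\<bar> + \<bar>C\<bar> + \<bar>D\<bar> + \<bar>E\<bar> + \<bar>F\<bar>"
  \<comment> \<open>The summand 1 serves the derivatives of \<open>u\<close> and \<open>v\<close>,
    which are themselves entries of \<open>fs\<close>; the rest bounds the second
    derivatives.\<close>
  define K where "K = 1 + (P / m\<^sup>2 + 6 * P / m)"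
  have I: "{..<6::nat} = {0, 1, 2, 3, 4, 5}" by auto
  have sum6: "(\<Sum>j<6. \<bar>(fs ! j) s t\<bar>) = \<bar>u s t\<bar> + \<bar>v s t\<bar> + \<bar>Dx u s t\<bar> + \<bar>Dy u s t\<bar> + \<bar>Dx v s t\<bar> + \<bar>Dy v s t\<bar>" for s t
    unfolding I by (simp add: fs_def)
  have bound: "\<bar>Dx (fs ! i) s t\<bar> \<le> K * (\<Sum>j<6. \<bar>(fs ! j) s t\<bar>)" "\<bar>Dy (fs ! i) s t\<bar> \<le> K * (\<Sum>j<6. \<bar>(fs ! j) s t\<bar>)"
    if i: "i < 6" and s: "m \<le> s" for i s t
  proof -
    define \<sigma> where "\<sigma> = \<bar>u s t\<bar> + \<bar>v s t\<bar> + \<bar>Dx u s t\<bar> + \<bar>Dy u s t\<bar> + \<bar>Dx v s t\<bar> + \<bar>Dy v s t\<bar>"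
    have s0: "0 < s" using m s by auto
    have 0: "0 \<le> \<sigma>" "0 \<le> P / m\<^sup>2 + 6 * P / m" using m by (auto simp: \<sigma>_def P_def)
    have c: "Dx (Dy u) s t = Dy (Dx u) s t" "Dx (Dy v) s t = Dy (Dx v) s t"
      using Dx_Dy_commute S s0 by auto
    have "1 * \<sigma> \<le> K * \<sigma>" "(P / m\<^sup>2 + 6 * P / m) * \<sigma> \<le> K * \<sigma>"
      unfolding K_def using 0 by (intro mult_right_mono; simp)+
    then have K: "w \<le> K * \<sigma>" if "w \<le> \<sigma> \<or> w \<le> (P / m\<^sup>2 + 6 * P / m) * \<sigma>" for w
      using that by auto
    have B1: "\<bar>Dx u s t\<bar> \<le> K * \<sigma>" "\<bar>Dy u s t\<bar> \<le> K * \<sigma>" "\<bar>Dx v s t\<bar> \<le> K * \<sigma>" "\<bar>Dy v s t\<bar> \<le> K * \<sigma>"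
      by (rule K, simp add: \<sigma>_def)+
    note q = killing_eqs_bounds[OF k[OF s0] m(1) s, of t "v s t", folded P_def, folded \<sigma>_def]
    have B2: "\<bar>Dx (Dx u) s t\<bar> \<le> K * \<sigma>" "\<bar>Dy (Dx u) s t\<bar> \<le> K * \<sigma>" "\<bar>Dy (Dy u) s t\<bar> \<le> K * \<sigma>"
      "\<bar>Dx (Dx v) s t\<bar> \<le> K * \<sigma>" "\<bar>Dy (Dx v) s t\<bar> \<le> K * \<sigma>" "\<bar>Dy (Dy v) s t\<bar> \<le> K * \<sigma>"
      using q by (simp_all only: insert_subset atMost_iff K simp_thms)
    have "i \<in> {0, 1, 2, 3, 4, 5}" using i I by blast
    then show "\<bar>Dx (fs ! i) s t\<bar> \<le> K * (\<Sum>j<6. \<bar>(fs ! j) s t\<bar>)" "\<bar>Dy (fs ! i) s t\<bar> \<le> K * (\<Sum>j<6. \<bar>(fs ! j) s t\<bar>)"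
      unfolding sum6 \<sigma>_def[symmetric] by (elim insertE emptyE; simp add: fs_def B1 B2 c)+
  qed
  have S': "smooth2 (fs ! i)" if "i < 6" for i
  proof -
    have "i \<in> {0, 1, 2, 3, 4, 5}" using that I by blast
    then show ?thesis by (auto simp: fs_def S smooth2_Dx smooth2_Dy)
  qed
  have 1: "(fs ! i) x 0 = 0" if i: "i < 6" for i
  proof (rule vanishing_of_linear_bound[where I = "{..<6}" and z = "\<lambda>i t. (fs ! i) t 0" and dz = "\<lambda>i t. Dx (fs ! i) t 0"
        and a = m and b = "max 1 x" and c = 1 and K = K])
    show "(fs ! i) 1 0 = 0" if "i \<in> {..<6}" for i
    proof -
      have "i \<in> {0, 1, 2, 3, 4, 5}" using that I by blast
      then show ?thesis using jet by (auto simp: fs_def)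
    qed
  qed (use m i bound(1) smooth2_dx[OF S'] in auto)
  have 2: "(fs ! i) x y = 0" if i: "i < 6" for i
    by (rule vanishing_of_linear_bound[where I = "{..<6}" and z = "\<lambda>i t. (fs ! i) x t" and dz = "\<lambda>i t. Dy (fs ! i) x t"
        and a = "min 0 y" and b = "max 0 y" and c = 0 and K = K])
      (use m i x 1 bound(2)[OF _ m(3)] smooth2_dy[OF S'] in auto)
  from 2[of 0] 2[of 1] show ?thesis by (simp add: fs_def)
qed

section \<open>Nilpotency and classification\<close>

lemma vector_6:
  fixes a b c d e f :: "'a::zero"
  shows "(vector [a, b, c, d, e, f] :: 'a^6)$1 = a"
    "(vector [a, b, c, d, e, f] :: 'a^6)$2 = b"
    "(vector [a, b, c, d, e, f] :: 'a^6)$3 = c"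
    "(vector [a, b, c, d, e, f] :: 'a^6)$4 = d"
    "(vector [a, b, c, d, e, f] :: 'a^6)$5 = e"
    "(vector [a, b, c, d, e, f] :: 'a^6)$6 = f"
  by (simp_all add: vector_def)

lemma exhaust_6:
  fixes x :: 6
  shows "x = 1 \<or> x = 2 \<or> x = 3 \<or> x = 4 \<or> x = 5 \<or> x = 6"
proof (induct x)
  case (of_int z)
  then have "z = 0 \<or> z = 1 \<or> z = 2 \<or> z = 3 \<or> z = 4 \<or> z = 5" by auto
  then show ?case by auto
qed

lemma forall_6: "(\<forall>i::6. P i) \<longleftrightarrow> P 1 \<and> P 2 \<and> P 3 \<and> P 4 \<and> P 5 \<and> P 6"
  by (metis exhaust_6)

lemmas vec6_simps = vec_eq_iff forall_6 vector_6

text \<open>More vectors than the dimension are dependent, and dividing by the last nonzero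
  coefficient makes the relation monic. Applied to the powers of a matrix it takes the place of the
  Cayley-Hamilton theorem.\<close>

lemma euclidean_sequence_relation:
  fixes g :: "nat \<Rightarrow> 'a::euclidean_space"
  obtains c d where "c d = 1" "(\<Sum>i\<le>d. c i *\<^sub>R g i) = 0"
proof -
  let ?n = "DIM('a)"
  have "\<exists>c. (\<exists>i\<le>?n. c i \<noteq> 0) \<and> (\<Sum>i\<le>?n. c i *\<^sub>R g i) = 0"
  \<comment> \<open>If two members coincide, dependence of the set of members says nothing about the
    sequence; the difference of the equal members is then the relation.\<close>
  proof (cases "inj_on g {..?n}")
    case True
    then have "card (g ` {..?n}) = ?n + 1" by (simp add: card_image)
    then have "dependent (g ` {..?n})" by (intro dependent_biggerset) auto
    then obtain u where "\<exists>v\<in>g ` {..?n}. u v \<noteq> 0" "(\<Sum>v\<in>g ` {..?n}. u v *\<^sub>R v) = 0"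
      by (auto simp: dependent_finite)
    then show ?thesis
      using True by (intro exI[of _ "\<lambda>i. u (g i)"]) (auto simp: sum.reindex)
  next
    case False
    then obtain i j where ij: "i \<le> ?n" "j \<le> ?n" "i \<noteq> j" "g i = g j" by (auto simp: inj_on_def)
    let ?c = "\<lambda>k. if k = i then 1 else if k = j then - 1 else (0 :: real)"
    have "(\<Sum>k\<le>?n. ?c k *\<^sub>R g k) = (\<Sum>k\<le>?n. (if k = i then g i else 0) + (if k = j then - g j else 0))"
      by (rule sum.cong) (use ij in auto)
    also have "\<dots> = 0" using ij by (simp add: sum.distrib)
    finally show ?thesis using ij by (intro exI[of _ ?c]) auto
  qed
  then obtain c where c: "\<exists>i\<le>?n. c i \<noteq> 0" "(\<Sum>i\<le>?n. c i *\<^sub>R g i) = 0" by blast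
  define d where "d = Max {i. i \<le> ?n \<and> c i \<noteq> 0}"
  have fin: "finite {i. i \<le> ?n \<and> c i \<noteq> 0}" by simp
  have d: "d \<le> ?n" "c d \<noteq> 0" using Max_in[OF fin] c(1) unfolding d_def[symmetric] by auto
  have z: "c i = 0" if "d < i" "i \<le> ?n" for i
    using Max_ge[OF fin, of i] that unfolding d_def[symmetric] by force
  have "(\<Sum>i\<le>d. c i *\<^sub>R g i) = (\<Sum>i\<le>?n. c i *\<^sub>R g i)"
    by (rule sum.mono_neutral_left) (use d z in \<open>auto simp: not_le\<close>)
  then have s: "(\<Sum>i\<le>d. c i *\<^sub>R g i) = 0" using c(2) by simp
  have "(\<Sum>i\<le>d. (c i / c d) *\<^sub>R g i) = (1 / c d) *\<^sub>R (\<Sum>i\<le>d. c i *\<^sub>R g i)"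
    unfolding scaleR_sum_right by (rule sum.cong) auto
  then have "(\<Sum>i\<le>d. (c i / c d) *\<^sub>R g i) = 0" using s by simp
  then show ?thesis using that[of "\<lambda>i. c i / c d" d] d by simp
qed

lemma smooth2_Dy_iter: "smooth2 f \<Longrightarrow> smooth2 ((Dy ^^ i) f)"
  by (induction i) (auto intro: smooth2_Dy)

lemma kfield_Dy_iter: "kfield A B C D E F S T u v \<Longrightarrow> kfield A B C D E F S T ((Dy ^^ i) u) ((Dy ^^ i) v)"
  by (induction i) (auto intro: kfield_Dy)

lemma smooth2_sum:
  assumes "\<And>i. smooth2 (f i)"
  shows "smooth2 (\<lambda>x y. \<Sum>i\<le>(d::nat). c i * f i x y)"
proof (induction d)
  case 0
  show ?case using smooth2_lincomb[OF assms assms, of "c 0" 0 0 0] by simp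
next
  case (Suc d)
  show ?case using smooth2_lincomb[OF Suc assms, of 1 "c (Suc d)" "Suc d"] by simp
qed

lemma Dx_sum:
  assumes "\<And>i. smooth2 (f i)" "0 < x"
  shows "Dx (\<lambda>x y. \<Sum>i\<le>(d::nat). c i * f i x y) x y = (\<Sum>i\<le>d. c i * Dx (f i) x y)"
  by (rule Dx_eqI[OF smooth2_sum[OF assms(1)] assms(2)])
     (auto intro!: derivative_eq_intros smooth2_dx assms simp: mult.commute)

lemma Dy_sum:
  assumes "\<And>i. smooth2 (f i)" "0 < x"
  shows "Dy (\<lambda>x y. \<Sum>i\<le>(d::nat). c i * f i x y) x y = (\<Sum>i\<le>d. c i * Dy (f i) x y)"
  by (rule Dy_eqI[OF smooth2_sum[OF assms(1)] assms(2)])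
     (auto intro!: derivative_eq_intros smooth2_dy assms simp: mult.commute)

lemma kfield_sum:
  assumes "\<And>i. kfield A B C D E F S T (f i) (g i)"
  shows "kfield A B C D E F S T (\<lambda>x y. \<Sum>i\<le>(d::nat). c i * f i x y) (\<lambda>x y. \<Sum>i\<le>d. c i * g i x y)"
proof (induction d)
  case 0
  show ?case using kfield_lincomb[OF assms assms, of "c 0" 0 0 0] by simp
next
  case (Suc d)
  show ?case using kfield_lincomb[OF Suc assms, of 1 "c (Suc d)" "Suc d"] by simp
qed

text \<open>At the base point \<open>(1, 0)\<close> powers of \<open>x\<close> are 1 and
  \<open>ln x\<close> is 0, so the jets of the listed fields have explicit entries.\<close>

definition jet :: "(real \<Rightarrow> real \<Rightarrow> real) \<Rightarrow> (real \<Rightarrow> real \<Rightarrow> real) \<Rightarrow> real^6"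
  where "jet u v = vector [u 1 0, Dx u 1 0, Dy u 1 0, v 1 0, Dx v 1 0, Dy v 1 0]"

text \<open>On Killing fields the second derivatives are functions of the 1-jet, so d/dy acts on
  jets at the base point by one fixed matrix. A relation between its powers annihilates the jet,
  hence the field, with the same coefficients for all Killing fields.\<close>

lemma kfield_Dy_relation:
  obtains c d where "c d = 1"
    "\<And>u v x y. kfield A B C D E F S T u v \<Longrightarrow> 0 < x \<Longrightarrow>
      (\<Sum>i\<le>d. c i * (Dy ^^ i) u x y) = 0 \<and> (\<Sum>i\<le>d. c i * (Dy ^^ i) v x y) = 0"
proof -
  \<comment> \<open>For \<open>z = (u, ux, uy, v, vx, vy)\<close> the entries are
    \<open>uy, uxy, uyy, vy, vxy, vyy\<close>, read off the Killing system at
    \<open>x = 1\<close>.\<close>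
  define L :: "real^6 \<Rightarrow> real^6" where "L z = vector [z$3,
      C * z$1 - ((A - D) * z$3 + C * z$6 + E * z$5), E * z$1 - ((2 * C - F) * z$3 - E * z$2 + 2 * E * z$6),
      z$6, D * z$1 - ((F - C) * z$5 + B * z$3 + D * z$2), F * z$1 - (2 * D * z$3 - E * z$5 + F * z$6)]" for z
  have "linear L"
    by (rule linearI) (simp_all add: L_def vec6_simps algebra_simps)
  define N where "N i = ((**) (matrix L) ^^ i) (mat 1)" for i
  have L: "jet (Dy u) (Dy v) = matrix L *v jet u v" if "kfield A B C D E F S T u v" for u v
  proof -
    have S: "smooth2 u" "smooth2 v" using kfield_smooth2[OF that] by auto
    with killing_eqsD[OF that zero_less_one, of 0] have "jet (Dy u) (Dy v) = L (jet u v)"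
      by (simp add: jet_def L_def vec6_simps killing_eqs_def Dx_Dy_commute)
    then show ?thesis using matrix_vector_mul(2)[OF \<open>linear L\<close>] by metis
  qed
  have J: "jet ((Dy ^^ i) u) ((Dy ^^ i) v) = N i *v jet u v" if "kfield A B C D E F S T u v" for u v i
    by (induction i) (simp_all add: N_def L kfield_Dy_iter[OF that] matrix_vector_mul_assoc)
  from euclidean_sequence_relation[of N] obtain c d where c: "c d = 1" "(\<Sum>i\<le>d. c i *\<^sub>R N i) = 0" by metis
  have "(\<Sum>i\<le>d. c i * (Dy ^^ i) u x y) = 0 \<and> (\<Sum>i\<le>d. c i * (Dy ^^ i) v x y) = 0"
    if k: "kfield A B C D E F S T u v" and x: "0 < x" for u v x y
  proof (rule kfield_zero_jet[OF kfield_sum[OF kfield_Dy_iter[OF k]] _ _ _ _ _ _ x])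
    have S: "smooth2 ((Dy ^^ i) u)" "smooth2 ((Dy ^^ i) v)" for i using kfield_smooth2[OF k] smooth2_Dy_iter by auto
    have "(\<Sum>i\<le>d. c i *\<^sub>R jet ((Dy ^^ i) u) ((Dy ^^ i) v)) = (\<Sum>i\<le>d. c i *\<^sub>R N i) *v jet u v"
      unfolding J[OF k] by (induction d) (simp_all add: matrix_vector_mult_add_rdistrib scaleR_matrix_vector_assoc)
    then have "(\<Sum>i\<le>d. c i *\<^sub>R jet ((Dy ^^ i) u) ((Dy ^^ i) v)) = 0" using c(2) by simp
    then have *: "(\<Sum>i\<le>d. c i * jet ((Dy ^^ i) u) ((Dy ^^ i) v) $ j) = 0" for j
      by (simp add: vec_eq_iff)
    from *[of 1] *[of 2] *[of 3] *[of 4] *[of 5] *[of 6]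
    show "(\<Sum>i\<le>d. c i * (Dy ^^ i) u 1 0) = 0" "(\<Sum>i\<le>d. c i * (Dy ^^ i) v 1 0) = 0"
      "Dx (\<lambda>x y. \<Sum>i\<le>d. c i * (Dy ^^ i) u x y) 1 0 = 0"
      "Dy (\<lambda>x y. \<Sum>i\<le>d. c i * (Dy ^^ i) u x y) 1 0 = 0"
      "Dx (\<lambda>x y. \<Sum>i\<le>d. c i * (Dy ^^ i) v x y) 1 0 = 0"
      "Dy (\<lambda>x y. \<Sum>i\<le>d. c i * (Dy ^^ i) v x y) 1 0 = 0"
      unfolding Dx_sum[of "\<lambda>i. (Dy ^^ i) u", OF S(1) zero_less_one] Dx_sum[of "\<lambda>i. (Dy ^^ i) v", OF S(2) zero_less_one]
        Dy_sum[of "\<lambda>i. (Dy ^^ i) u", OF S(1) zero_less_one] Dy_sum[of "\<lambda>i. (Dy ^^ i) v", OF S(2) zero_less_one]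
      by (simp_all add: jet_def vector_6)
  qed
  with that c(1) show ?thesis by blast
qed

text \<open>Membership of \<open>\<alpha> X + \<beta> d/dy\<close> in \<open>span {XX, D2}\<close>,
  expressed on components over the half plane.\<close>

definition frame_field :: "(real \<Rightarrow> real \<Rightarrow> real) \<Rightarrow> (real \<Rightarrow> real \<Rightarrow> real) \<Rightarrow> bool"
  where "frame_field u v \<longleftrightarrow> (\<exists>\<alpha> \<beta>. \<forall>x>0. \<forall>y. u x y = \<alpha> * x \<and> v x y = \<alpha> * y + \<beta>)"

lemma frame_field_lincomb:
  assumes "frame_field u v" "frame_field u' v'"
  shows "frame_field (\<lambda>x y. a * u x y + b * u' x y) (\<lambda>x y. a * v x y + b * v' x y)"
proof -
  obtain \<alpha> \<beta> \<alpha>' \<beta>' where "\<forall>x>0. \<forall>y. u x y = \<alpha> * x \<and> v x y = \<alpha> * y + \<beta>"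
    "\<forall>x>0. \<forall>y. u' x y = \<alpha>' * x \<and> v' x y = \<alpha>' * y + \<beta>'"
    using assms unfolding frame_field_def by blast
  then show ?thesis unfolding frame_field_def
    by (intro exI[of _ "a * \<alpha> + b * \<alpha>'"] exI[of _ "a * \<beta> + b * \<beta>'"]) (simp add: algebra_simps)
qed

lemma Dy_iter_dilate:
  assumes "smooth2 f" "0 < x"
  shows "(Dy ^^ i) (\<lambda>x y. f (2 * x) (2 * y)) x y = 2 ^ i * (Dy ^^ i) f (2 * x) (2 * y)"
  using assms(2)
proof (induction i arbitrary: x y)
  case (Suc i)
  let ?g = "\<lambda>x y. (Dy ^^ i) f (2 * x) (2 * y)"
  have S: "smooth2 ((Dy ^^ i) f)" by (rule smooth2_Dy_iter[OF assms(1)])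
  have S': "smooth2 ?g" by (rule smooth2_dilate[OF S])
  have "Dy ((Dy ^^ i) (\<lambda>x y. f (2 * x) (2 * y))) x y = Dy (\<lambda>x y. 2 ^ i * ?g x y + 0 * ?g x y) x y"
    by (rule Dy_cong[OF smooth2_lincomb[OF S' S'] _ Suc.prems]) (simp add: Suc.IH)
  then show ?case
    using Dy_lincomb[OF S' S' Suc.prems, of "2 ^ i" 0] Dy_dilate[OF S Suc.prems] by simp
qed simp

text \<open>Comparing a minimal polynomial relation for \<open>\<partial>\<^sub>2\<close> modulo \<open>span {X, \<partial>\<^sub>2}\<close> with its conjugate under
  the homothety \<open>p \<mapsto> 2 p\<close>, which multiplies \<open>\<partial>\<^sub>2\<close> by 2, shows that the relation is a pure power.\<close>

lemma kfield_Dy_nilpotent: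
  obtains d where "\<And>u v. kfield A B C D E F S T u v \<Longrightarrow> frame_field ((Dy ^^ d) u) ((Dy ^^ d) v)"
proof -
  define s where "s d c f = (\<lambda>x y. \<Sum>i\<le>(d::nat). c i * (Dy ^^ i) f x y)" for d and c :: "nat \<Rightarrow> real" and f
  define P where "P d \<longleftrightarrow> (\<exists>c. c d \<noteq> 0 \<and> (\<forall>u v. kfield A B C D E F S T u v \<longrightarrow> frame_field (s d c u) (s d c v)))" for d
  obtain c0 d0 where c0: "c0 d0 = (1::real)" "\<And>u v x y. kfield A B C D E F S T u v \<Longrightarrow> 0 < x \<Longrightarrow>
      (\<Sum>i\<le>d0. c0 i * (Dy ^^ i) u x y) = 0 \<and> (\<Sum>i\<le>d0. c0 i * (Dy ^^ i) v x y) = 0"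
    by (rule kfield_Dy_relation[of A B C D E F S T]) blast
  have "frame_field (s d0 c0 u) (s d0 c0 v)" if "kfield A B C D E F S T u v" for u v
    unfolding frame_field_def s_def using c0(2)[OF that] by (intro exI[of _ 0]) simp
  then have "P d0" unfolding P_def using c0(1) by (intro exI[of _ c0]) auto
  \<comment> \<open>The least degree of a polynomial in d/dy that sends every Killing field to a
    frame field.\<close>
  define d where "d = (LEAST d. P d)"
  have Pd: "P d" unfolding d_def using \<open>P d0\<close> by (rule LeastI)
  have least: "\<not> P e" if "e < d" for e using not_less_Least that unfolding d_def by blast
  from Pd obtain c where c: "c d \<noteq> 0" "\<And>u v. kfield A B C D E F S T u v \<Longrightarrow> frame_field (s d c u) (s d c v)"
    unfolding P_def by blast
  \<comment> \<open>Conjugation by the homothety multiplies the \<open>i\<close>-th coefficient by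
    \<open>2 ^ i\<close>. Subtracting \<open>2 ^ d\<close> times the original relation cancels the
    leading term and keeps every other nonzero coefficient nonzero.\<close>
  define c' where "c' i = c i * (2 ^ i - 2 ^ d)" for i
  have c': "frame_field (s d c' u) (s d c' v)" if k: "kfield A B C D E F S T u v" for u v
  proof -
    from c(2)[OF kfield_dilate[OF k]] obtain \<alpha> \<beta> where ab: "\<forall>x>0. \<forall>y. s d c (\<lambda>x y. u (2 * x) (2 * y)) x y = \<alpha> * x
        \<and> s d c (\<lambda>x y. v (2 * x) (2 * y)) x y = \<alpha> * y + \<beta>" unfolding frame_field_def by blast
    have "frame_field (s d (\<lambda>i. c i * 2 ^ i) u) (s d (\<lambda>i. c i * 2 ^ i) v)"
      unfolding frame_field_def
    proof (intro exI allI impI)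
      fix x y :: real assume x: "0 < x"
      have "s d (\<lambda>i. c i * 2 ^ i) f x y = s d c (\<lambda>x y. f (2 * x) (2 * y)) (x / 2) (y / 2)" if "smooth2 f" for f
        unfolding s_def using x by (intro sum.cong) (auto simp: Dy_iter_dilate[OF that])
      then show "s d (\<lambda>i. c i * 2 ^ i) u x y = (\<alpha> / 2) * x \<and> s d (\<lambda>i. c i * 2 ^ i) v x y = (\<alpha> / 2) * y + \<beta>"
        using kfield_smooth2[OF k] ab[rule_format, of "x / 2" "y / 2"] x by simp
    qed
    from frame_field_lincomb[OF this c(2)[OF k], of 1 "- (2 ^ d)"] show ?thesis
      unfolding s_def c'_def by (simp add: sum_distrib_left sum.distrib[symmetric] algebra_simps sum_subtractf)
  qed
  have z: "c i = 0" if i: "i < d" for i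
  proof (rule ccontr)
    assume "c i \<noteq> 0"
    \<comment> \<open>With \<open>e\<close> the largest surviving index below \<open>d\<close>, the
      relation \<open>c'\<close> has degree \<open>e\<close>, against the minimality of
      \<open>d\<close>.\<close>
    define e where "e = Max {i. i < d \<and> c i \<noteq> 0}"
    have fin: "finite {i. i < d \<and> c i \<noteq> 0}" by simp
    have e: "e < d" "c e \<noteq> 0" using Max_in[OF fin] i \<open>c i \<noteq> 0\<close> unfolding e_def[symmetric] by auto
    have z: "c' j = 0" if "e < j" "j \<le> d" for j
      using Max_ge[OF fin, of j] that unfolding e_def[symmetric] by (force simp: c'_def)
    have "s e c' f = s d c' f" for f
      unfolding s_def fun_eq_iff by (intro allI sum.mono_neutral_left) (use e z in \<open>auto simp: not_le\<close>)
    moreover have "c' e \<noteq> 0" using e power_strict_increasing[of e d "2::real"] by (simp add: c'_def)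
    ultimately have "P e" unfolding P_def using c' by (intro exI[of _ c']) auto
    with least e show False by blast
  qed
  have "frame_field ((Dy ^^ d) u) ((Dy ^^ d) v)" if k: "kfield A B C D E F S T u v" for u v
  proof -
    have "s d c f = (\<lambda>x y. c d * (Dy ^^ d) f x y)" for f
      unfolding s_def fun_eq_iff using z by (simp add: lessThan_Suc_atMost[symmetric])
    with frame_field_lincomb[OF c(2)[OF k] c(2)[OF k], of "1 / c d" 0] c(1) show ?thesis by simp
  qed
  then show ?thesis by (rule that)
qed

section \<open>Reduction to ordinary differential equations\<close>

lemma exists_kfield_Dy_frame_field:
  assumes "kfield A B C D E F S T u0 v0" "\<not> frame_field u0 v0"
  obtains u v where "kfield A B C D E F S T u v" "\<not> frame_field u v" "frame_field (Dy u) (Dy v)"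
proof -
  obtain d where d: "\<And>u v. kfield A B C D E F S T u v \<Longrightarrow> frame_field ((Dy ^^ d) u) ((Dy ^^ d) v)"
    by (rule kfield_Dy_nilpotent[of A B C D E F S T]) blast
  define e where "e = (LEAST e. frame_field ((Dy ^^ e) u0) ((Dy ^^ e) v0))"
  have e: "frame_field ((Dy ^^ e) u0) ((Dy ^^ e) v0)" unfolding e_def using d[OF assms(1)] by (rule LeastI)
  \<comment> \<open>The earliest iterate that is a frame field is not the zeroth; the one before it
    is the required field.\<close>
  then obtain k where k: "e = Suc k" using assms(2) by (cases e) auto
  then have "\<not> frame_field ((Dy ^^ k) u0) ((Dy ^^ k) v0)"
    using not_less_Least[of k "\<lambda>e. frame_field ((Dy ^^ e) u0) ((Dy ^^ e) v0)"] unfolding e_def[symmetric] by simp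
  with e k that kfield_Dy_iter[OF assms(1), of k] show ?thesis by auto
qed

text \<open>The Killing system for \<open>(f x + \<alpha> x y) \<partial>\<^sub>1 + (g x + \<alpha> y\<^sup>2 / 2) \<partial>\<^sub>2\<close>, where \<open>f1, f2\<close> are the derivatives
  of \<open>f\<close>, and \<open>g1, g2\<close> those of \<open>g\<close>.\<close>

definition reduced_eqs where
  "reduced_eqs A B C D E F S T \<alpha> x f f1 f2 g1 g2 \<longleftrightarrow>
     x\<^sup>2 * f2 - A * f + x * (A * f1 - B * \<alpha> * x + 2 * C * g1) = 0 \<and>
     x\<^sup>2 * g2 - B * f + x * ((2 * D - A) * g1 + 2 * B * f1) = 0 \<and>
     \<alpha> * x\<^sup>2 - C * f + x * ((A - D) * \<alpha> * x + E * g1) = 0 \<and>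
     - D * f + x * ((F - C) * g1 + B * \<alpha> * x + D * f1) = 0 \<and>
     - E * f + x * ((2 * C - F) * \<alpha> * x - E * f1) = 0 \<and>
     \<alpha> * x\<^sup>2 - F * f + x * (2 * D * \<alpha> * x - E * g1) = 0 \<and>
     S * f = - (T * \<alpha> * x\<^sup>2) \<and> T * f = x * (T * f1 - S * g1)"
  for A B C D E F S T \<alpha> x f f1 f2 g1 g2 :: real

definition reduced_system where
  "reduced_system A B C D E F S T \<alpha> f f1 f2 g1 g2 \<longleftrightarrow> (\<forall>x>0.
     (f has_real_derivative f1 x) (at x) \<and> (f1 has_real_derivative f2 x) (at x) \<and> (g1 has_real_derivative g2 x) (at x) \<and>
     reduced_eqs A B C D E F S T \<alpha> x (f x) (f1 x) (f2 x) (g1 x) (g2 x))"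

lemma reduced_system_of_not_frame_field:
  assumes "kfield A B C D E F S T u0 v0" "\<not> frame_field u0 v0"
  obtains \<alpha> f f1 f2 g1 g2 where "reduced_system A B C D E F S T \<alpha> f f1 f2 g1 g2"
    "\<alpha> = 0 \<or> \<alpha> = 1" "\<alpha> = 0 \<Longrightarrow> \<exists>x>0. f x \<noteq> 0 \<or> g1 x \<noteq> 0"
proof -
  obtain u v where k: "kfield A B C D E F S T u v" and n: "\<not> frame_field u v" and "frame_field (Dy u) (Dy v)"
    by (rule exists_kfield_Dy_frame_field[OF assms])
  then obtain \<alpha> \<beta> where ab: "\<And>x y. 0 < x \<Longrightarrow> Dy u x y = \<alpha> * x" "\<And>x y. 0 < x \<Longrightarrow> Dy v x y = \<alpha> * y + \<beta>"
    unfolding frame_field_def by blast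
  have S: "smooth2 u" "smooth2 v" using kfield_smooth2[OF k] by auto
  have id: "smooth2 (\<lambda>x y. \<alpha> * x)" "smooth2 (\<lambda>x y. \<alpha> * y + \<beta>)" by (intro elementary_smooth2 elementary.intros)+
  have d2: "Dy (Dx u) x y = \<alpha>" "Dy (Dy u) x y = 0" "Dy (Dx v) x y = 0" "Dy (Dy v) x y = \<alpha>" if x: "0 < x" for x y
  proof -
    have "Dy (Dx u) x y = Dx (Dy u) x y" "Dy (Dx v) x y = Dx (Dy v) x y" using Dx_Dy_commute S x by auto
    moreover have "Dx (\<lambda>x y. \<alpha> * x) x y = \<alpha>" "Dx (\<lambda>x y. \<alpha> * y + \<beta>) x y = 0"
      by (rule Dx_eqI[OF id(1) x] Dx_eqI[OF id(2) x], auto intro!: derivative_eq_intros)+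
    moreover have "Dy (\<lambda>x y. \<alpha> * x) x y = 0" "Dy (\<lambda>x y. \<alpha> * y + \<beta>) x y = \<alpha>"
      by (rule Dy_eqI[OF id(1) x] Dy_eqI[OF id(2) x], auto intro!: derivative_eq_intros)+
    moreover have "Dx (Dy u) x y = Dx (\<lambda>x y. \<alpha> * x) x y" by (rule Dx_cong[OF id(1) _ x]) (simp add: ab)
    moreover have "Dx (Dy v) x y = Dx (\<lambda>x y. \<alpha> * y + \<beta>) x y" by (rule Dx_cong[OF id(2) _ x]) (simp add: ab)
    moreover have "Dy (Dy u) x y = Dy (\<lambda>x y. \<alpha> * x) x y" by (rule Dy_cong[OF id(1) _ x]) (simp add: ab)
    moreover have "Dy (Dy v) x y = Dy (\<lambda>x y. \<alpha> * y + \<beta>) x y" by (rule Dy_cong[OF id(2) _ x]) (simp add: ab)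
    ultimately show "Dy (Dx u) x y = \<alpha>" "Dy (Dy u) x y = 0" "Dy (Dx v) x y = 0" "Dy (Dy v) x y = \<alpha>"
      by simp_all
  qed
  \<comment> \<open>Subtracting \<open>\<beta> X\<close> removes the constant \<open>\<beta>\<close>
    from the bracket with d/dy. What is left is determined by its values on the line
    \<open>y = 0\<close>, and only the derivative of \<open>g\<close> enters the system.\<close>
  define f f1 f2 g1 g2 where "f x = u x 0 - \<beta> * x" and "f1 x = Dx u x 0 - \<beta>" and "f2 x = Dx (Dx u) x 0"
    and "g1 x = Dx v x 0" and "g2 x = Dx (Dx v) x 0" for x
  have sys: "reduced_system A B C D E F S T \<alpha> f f1 f2 g1 g2"
    unfolding reduced_system_def
  proof (intro allI impI)
    fix x :: real assume x: "0 < x"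
    have "(f has_real_derivative f1 x) (at x)" "(f1 has_real_derivative f2 x) (at x)" "(g1 has_real_derivative g2 x) (at x)"
      unfolding f_def f1_def f2_def g1_def g2_def
      by (auto intro!: derivative_eq_intros smooth2_dx S smooth2_Dx x)
    moreover have "killing_eqs A B C D E F S T x (f x + \<beta> * x) (f1 x + \<beta>) (\<alpha> * x)
       (f2 x) \<alpha> 0 (g1 x) \<beta> (g2 x) 0 \<alpha>"
      using killing_eqsD[OF k x, of 0] by (simp add: d2[OF x] ab[OF x] f_def f1_def f2_def g1_def g2_def)
    ultimately show "(f has_real_derivative f1 x) (at x) \<and> (f1 has_real_derivative f2 x) (at x) \<and> (g1 has_real_derivative g2 x) (at x) \<and>
     reduced_eqs A B C D E F S T \<alpha> x (f x) (f1 x) (f2 x) (g1 x) (g2 x)"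
      unfolding killing_eqs_def reduced_eqs_def power2_eq_square
      by (-, elim conjE, intro conjI; (assumption | simp add: algebra_simps))
  qed
  \<comment> \<open>With \<open>\<alpha> = 0\<close>, if \<open>f\<close> and the derivative of
    \<open>g\<close> vanish, the field is \<open>\<beta> X\<close> plus a constant multiple of d/dy,
    hence a frame field.\<close>
  have nz: "\<exists>x>0. f x \<noteq> 0 \<or> g1 x \<noteq> 0" if "\<alpha> = 0"
  proof (rule ccontr)
    assume "\<not> (\<exists>x>0. f x \<noteq> 0 \<or> g1 x \<noteq> 0)"
    then have z: "\<And>x. 0 < x \<Longrightarrow> u x 0 = \<beta> * x" "\<And>x. 0 < x \<Longrightarrow> Dx v x 0 = 0" unfolding f_def g1_def by auto
    have "((\<lambda>t. v t 0) has_real_derivative 0) (at x within {0<..})" if x: "x \<in> {0<..}" for x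
    proof -
      have "0 < x" using x by simp
      from smooth2_dx[OF S(2) this, of 0] have "((\<lambda>t. v t 0) has_real_derivative 0) (at x)"
        unfolding z(2)[OF \<open>0 < x\<close>] .
      then show ?thesis by (rule has_field_derivative_at_within)
    qed
    from has_field_derivative_zero_constant[OF convex_real_interval(3) this]
    obtain c where "\<And>x. x \<in> {0<..} \<Longrightarrow> v x 0 = c" by blast
    then have v0: "v x 0 = v 1 0" if "0 < x" for x using that by simp
    have uv: "u x y = u x 0 \<and> v x y - \<beta> * y = v x 0 - \<beta> * 0" if x: "0 < x" for x y
    proof
      show "u x y = u x 0"
        by (rule DERIV_isconst_all[of "\<lambda>t. u x t"]) (use smooth2_dy[OF S(1) x] ab(1)[OF x] \<open>\<alpha> = 0\<close> in simp)
      have "((\<lambda>t. v x t - \<beta> * t) has_real_derivative 0) (at t)" for t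
        using smooth2_dy[OF S(2) x, of t] ab(2)[OF x, of t] \<open>\<alpha> = 0\<close> by (auto intro!: derivative_eq_intros)
      then show "v x y - \<beta> * y = v x 0 - \<beta> * 0"
        by (intro DERIV_isconst_all[of "\<lambda>t. v x t - \<beta> * t"]) simp
    qed
    have "frame_field u v"
      unfolding frame_field_def
    proof (intro exI allI impI)
      fix x y :: real assume x: "0 < x"
      show "u x y = \<beta> * x \<and> v x y = \<beta> * y + v 1 0"
        using uv[OF x, of y] z(1)[OF x] v0[OF x] by simp
    qed
    with n show False by simp
  qed
  show ?thesis
  proof (cases "\<alpha> = 0")
    case True
    then show ?thesis using that[OF sys] nz by simp
  next
    case False
    \<comment> \<open>The system is linear jointly in \<open>\<alpha>\<close>, \<open>f\<close> and
      \<open>g\<close>, so a nonzero \<open>\<alpha>\<close> can be normalised to 1.\<close>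
    have scale: "reduced_eqs A B C D E F S T (c * \<alpha>) x (c * f) (c * f1) (c * f2) (c * g1) (c * g2)"
      if "reduced_eqs A B C D E F S T \<alpha> x f f1 f2 g1 g2" for c x f f1 f2 g1 g2
      using that unfolding reduced_eqs_def by (elim conjE, intro conjI; algebra)
    have "reduced_system A B C D E F S T (c * \<alpha>) (\<lambda>x. c * f x) (\<lambda>x. c * f1 x) (\<lambda>x. c * f2 x) (\<lambda>x. c * g1 x) (\<lambda>x. c * g2 x)" for c
      using sys unfolding reduced_system_def by (auto intro!: DERIV_cmult scale)
    from this[of "1 / \<alpha>"] False show ?thesis using that by simp
  qed
qed

section \<open>Algebraic relations forced by the reduced system\<close>

lemma DERIV_unique_pos:
  fixes h k :: "real \<Rightarrow> real"
  assumes "(h has_real_derivative p) (at x)" "(k has_real_derivative q) (at x)" "\<And>x. 0 < x \<Longrightarrow> h x = k x" "0 < x"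
  shows "p = q"
proof -
  have "(k has_real_derivative p) (at x)"
    by (rule has_field_derivative_transform_within_open[OF assms(1), of "{0<..}"]) (use assms in auto)
  with assms(2) DERIV_unique show ?thesis by blast
qed

text \<open>The fifth and sixth reduced equations contain no second derivatives and hold for all
  positive \<open>x\<close>; differentiating them supplies further relations for eliminating
  \<open>f2\<close> and \<open>g2\<close>.\<close>

lemma reduced_system_derived:
  assumes "reduced_system A B C D E F S T \<alpha> f f1 f2 g1 g2" "0 < x"
  shows "2 * (2 * C - F) * \<alpha> * x = 2 * E * f1 x + x * E * f2 x"
    "2 * \<alpha> * x * (1 + 2 * D) = F * f1 x + E * g1 x + x * E * g2 x"
proof -
  have d: "(f has_real_derivative f1 x) (at x)" "(f1 has_real_derivative f2 x) (at x)" "(g1 has_real_derivative g2 x) (at x)"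
    and e: "\<And>x. 0 < x \<Longrightarrow> - E * f x + x * ((2 * C - F) * \<alpha> * x - E * f1 x) = 0"
     "\<And>x. 0 < x \<Longrightarrow> \<alpha> * x\<^sup>2 - F * f x + x * (2 * D * \<alpha> * x - E * g1 x) = 0"
    using assms unfolding reduced_system_def reduced_eqs_def by auto
  have "((\<lambda>x. - E * f x + x * ((2 * C - F) * \<alpha> * x - E * f1 x)) has_real_derivative
      2 * (2 * C - F) * \<alpha> * x - 2 * E * f1 x - x * E * f2 x) (at x)"
    by (auto intro!: derivative_eq_intros d simp: algebra_simps)
  from DERIV_unique_pos[OF this DERIV_const e(1) assms(2)]
  show "2 * (2 * C - F) * \<alpha> * x = 2 * E * f1 x + x * E * f2 x" by simp
  have "((\<lambda>x. \<alpha> * x\<^sup>2 - F * f x + x * (2 * D * \<alpha> * x - E * g1 x)) has_real_derivative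
      2 * \<alpha> * x * (1 + 2 * D) - F * f1 x - E * g1 x - x * E * g2 x) (at x)"
    by (auto intro!: derivative_eq_intros d simp: algebra_simps)
  from DERIV_unique_pos[OF this DERIV_const e(2) assms(2)]
  show "2 * \<alpha> * x * (1 + 2 * D) = F * f1 x + E * g1 x + x * E * g2 x" by simp
qed

text \<open>If \<open>E = 0\<close>, a nonzero solution leads to the degenerate family. If
  \<open>E \<noteq> 0\<close>, the fifth equation is \<open>x f1 = - f\<close>, so \<open>f\<close>
  is a multiple of \<open>1 / x\<close>, and all other parameters become functions of
  \<open>E\<close> and \<open>F\<close>.\<close>

lemma reduced_system_zero:
  assumes s: "reduced_system A B C D E F S T 0 f f1 f2 g1 g2" and n: "\<exists>x>0. f x \<noteq> 0 \<or> g1 x \<noteq> 0"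
  shows "(C = 0 \<and> E = 0 \<and> F = 0 \<and> S = 0) \<or>
    (E \<noteq> 0 \<and> C = - F \<and> E * D = - (F\<^sup>2) \<and> A = 1 - D \<and> E * B = F * (1 - D) \<and> S = 0 \<and> T = 0)"
proof -
  have e: "x\<^sup>2 * f2 x - A * f x + x * (A * f1 x + 2 * C * g1 x) = 0"
    "x\<^sup>2 * g2 x - B * f x + x * ((2 * D - A) * g1 x + 2 * B * f1 x) = 0"
    "- C * f x + x * (E * g1 x) = 0"
    "- D * f x + x * ((F - C) * g1 x + D * f1 x) = 0"
    "- E * f x - x * (E * f1 x) = 0"
    "- F * f x - x * (E * g1 x) = 0"
    "S * f x = 0" "T * f x = x * (T * f1 x - S * g1 x)" if "0 < x" for x
    using s that unfolding reduced_system_def reduced_eqs_def by auto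
  show ?thesis
  proof (cases "E = 0")
    case True
    show ?thesis
    proof (cases "\<exists>x>0. f x \<noteq> 0")
      case True
      then obtain x where "0 < x" "f x \<noteq> 0" by blast
      with e(3,6,7)[of x] \<open>E = 0\<close> show ?thesis by simp
    next
      case False
      \<comment> \<open>If \<open>f\<close> vanishes identically, so do its derivatives, and a point
        with \<open>g1 \<noteq> 0\<close> gives \<open>C = 0\<close>, \<open>F = C\<close> and
        \<open>S = 0\<close> through the first, fourth and eighth equations.\<close>
      then have f0: "f x = 0" if "0 < x" for x using that by blast
      have z: "d x = 0" if "\<And>x. 0 < x \<Longrightarrow> h x = 0" "\<And>x. 0 < x \<Longrightarrow> (h has_real_derivative d x) (at x)" "0 < x"
        for h d and x :: real
        by (rule DERIV_unique_pos[of h _ x "\<lambda>x. 0"]) (use that in auto)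
      have d: "\<And>x. 0 < x \<Longrightarrow> (f has_real_derivative f1 x) (at x)" "\<And>x. 0 < x \<Longrightarrow> (f1 has_real_derivative f2 x) (at x)"
        using s unfolding reduced_system_def reduced_eqs_def by auto
      have f1: "f1 x = 0" if "0 < x" for x by (rule z[OF f0 d(1) that])
      have f2: "f2 x = 0" if "0 < x" for x by (rule z[OF f1 d(2) that])
      from n f0 obtain x where x: "0 < x" "g1 x \<noteq> 0" by blast
      then show ?thesis using e(1,4,8)[OF x(1)] f0[OF x(1)] f1[OF x(1)] f2[OF x(1)] True by simp
    qed
  next
    case False
    from n obtain x where x: "0 < x" "f x \<noteq> 0 \<or> g1 x \<noteq> 0" by blast
    have f: "f x \<noteq> 0" using x e(6)[OF x(1)] False by auto
    \<comment> \<open>Positions 9 and 10 of \<open>e\<close> are the two differentiated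
      equations.\<close>
    note e = e[OF x(1)] reduced_system_derived[OF s x(1)]
    have f1: "x * f1 x = - f x" using e(5) False by algebra
    have f2: "x\<^sup>2 * f2 x = 2 * f x" using e(9) f1 False by algebra
    have C: "C = - F" using e(3,6) f by algebra
    have g1: "x * E * g1 x = - F * f x" using e(6) by algebra
    have Df: "D * f x = F * (x * g1 x)" using e(4) f1 C by algebra
    have D: "E * D = - (F\<^sup>2)" using Df g1 f by algebra
    have A: "A = 1 - D" using e(1) f1 f2 C Df f by algebra
    have g2: "E * x\<^sup>2 * g2 x = 2 * F * f x" using e(10) f1 g1 by algebra
    have B: "E * B = F * (1 - D)" using e(2) g1 f1 g2 A f by algebra
    have S: "S = 0" using e(7) f by simp
    have T: "T = 0" using e(8) f1 f S by algebra
    show ?thesis using False A B C D S T by simp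
  qed
qed

text \<open>The condition that some field \<open>(a x^2 + x y) d/dx + (b x^2 + y^2) / 2 d/dy\<close>
  is Killing: the reduced system with \<open>\<alpha> = 1\<close>, \<open>f = a x^2\<close> and
  \<open>g1 = b x\<close>, evaluated at \<open>x = 1\<close>.\<close>

definition quadratic_killing where
  "quadratic_killing A B C D E F S T \<longleftrightarrow> (\<exists>a b.
      a * (2 + A) - B + 2 * C * b = 0 \<and> b * (1 - A + 2 * D) + 3 * a * B = 0 \<and>
      1 + A - D + E * b = C * a \<and> D * a + (F - C) * b + B = 0 \<and>
      3 * E * a = 2 * C - F \<and> 1 + 2 * D = F * a + E * b \<and> S * a = - T \<and> T * a = S * b)"
  for A B C D E F S T :: real

text \<open>Outside the degenerate family some combination of the equations has the form
  \<open>p f = q x^2\<close> with \<open>p \<noteq> 0\<close>. So \<open>f\<close> is quadratic, a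
  further equation makes \<open>g1\<close> linear, and the quadratic Killing field appears. The case
  distinction is the search for a nonzero \<open>p\<close>.\<close>

lemma reduced_system_one:
  assumes s: "reduced_system A B C D E F S T 1 f f1 f2 g1 g2"
  shows "(C = 0 \<and> E = 0 \<and> F = 0 \<and> S = 0) \<or> quadratic_killing A B C D E F S T"
proof (rule disjCI)
  assume n: "\<not> quadratic_killing A B C D E F S T"
  have d: "(f has_real_derivative f1 x) (at x)" "(f1 has_real_derivative f2 x) (at x)" "(g1 has_real_derivative g2 x) (at x)"
    and e: "x\<^sup>2 * f2 x - A * f x + x * (A * f1 x - B * x + 2 * C * g1 x) = 0"
     "x\<^sup>2 * g2 x - B * f x + x * ((2 * D - A) * g1 x + 2 * B * f1 x) = 0"
     "x\<^sup>2 - C * f x + x * ((A - D) * x + E * g1 x) = 0"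
     "- D * f x + x * ((F - C) * g1 x + B * x + D * f1 x) = 0"
     "- E * f x + x * ((2 * C - F) * x - E * f1 x) = 0"
     "x\<^sup>2 - F * f x + x * (2 * D * x - E * g1 x) = 0"
     "S * f x = - (T * x\<^sup>2)" "T * f x = x * (T * f1 x - S * g1 x)" if "0 < x" for x
    using s that unfolding reduced_system_def reduced_eqs_def by auto
  have f1: "f1 x = 2 * a * x" if "\<And>x. 0 < x \<Longrightarrow> f x = a * x\<^sup>2" "0 < x" for a x
    by (rule DERIV_unique_pos[OF d(1)[OF that(2)] _ that]) (auto intro!: derivative_eq_intros)
  have fin: False if f: "\<And>x. 0 < x \<Longrightarrow> f x = a * x\<^sup>2" and g: "\<And>x. 0 < x \<Longrightarrow> g1 x = b * x" for a b
  proof -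
    have f2: "f2 1 = 2 * a"
      by (rule DERIV_unique_pos[OF d(2) _ f1[OF f]]) (auto intro!: derivative_eq_intros)
    have g2: "g2 1 = b"
      by (rule DERIV_unique_pos[OF d(3) _ g]) (auto intro!: derivative_eq_intros)
    have v: "f 1 = a" "f1 1 = 2 * a" "f2 1 = 2 * a" "g1 1 = b" "g2 1 = b"
      using f[of 1] f1[OF f, of 1] g[of 1] f2 g2 by simp_all
    note e1 = e[OF zero_less_one, unfolded v power_one mult_1_left mult_1_right]
    have "quadratic_killing A B C D E F S T"
      unfolding quadratic_killing_def
    proof (rule exI[of _ a], rule exI[of _ b], intro conjI)
      show "a * (2 + A) - B + 2 * C * b = 0" using e1(1) by (simp add: algebra_simps)
      show "b * (1 - A + 2 * D) + 3 * a * B = 0" using e1(2) by (simp add: algebra_simps)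
      show "1 + A - D + E * b = C * a" using e1(3) by (simp add: algebra_simps)
      show "D * a + (F - C) * b + B = 0" using e1(4) by (simp add: algebra_simps)
      show "3 * E * a = 2 * C - F" using e1(5) by (simp add: algebra_simps)
      show "1 + 2 * D = F * a + E * b" using e1(6) by (simp add: algebra_simps)
      show "S * a = - T" using e1(7) by (simp add: algebra_simps)
      show "T * a = S * b" using e1(8) by (simp add: algebra_simps)
    qed
    with n show False by simp
  qed
  have quad: "\<exists>a. \<forall>x>0. f x = a * x\<^sup>2" if "p \<noteq> 0" "\<And>x. 0 < x \<Longrightarrow> p * f x = q * x\<^sup>2" for p q
    by (rule exI[of _ "q / p"]) (use that in \<open>auto simp: field_simps\<close>)
  show "C = 0 \<and> E = 0 \<and> F = 0 \<and> S = 0"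
  proof (cases "E = 0")
    case False
    have "\<exists>a. \<forall>x>0. f x = a * x\<^sup>2"
    proof (cases "C + F = 0")
      case False
      show ?thesis
      proof (rule quad[OF False])
        fix x :: real assume x: "0 < x"
        \<comment> \<open>In the sum of the third and sixth equations the term \<open>E g1\<close>
          cancels.\<close>
        show "(C + F) * f x = (2 + A + D) * x\<^sup>2" using e(3,6)[OF x] by algebra
      qed
    next
      case True
      then have F: "F = - C" by simp
      have AD: "A = - 2 - D" using e(3)[of 1] e(6)[of 1] F by (simp add: algebra_simps)
      show ?thesis
      \<comment> \<open>That sum now only relates \<open>A\<close> and \<open>D\<close>. Eliminating
        \<open>f1\<close> and \<open>g1\<close> from the fourth, fifth and sixth equations gives the
        coefficient \<open>2 * (D * E + C^2)\<close>; if it vanishes too, the first equation, with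
        \<open>f2\<close> taken from the differentiated fifth, gives \<open>6 * E\<close>.\<close>
      proof (cases "D * E + C\<^sup>2 = 0")
        case False
        show ?thesis
        proof (rule quad[of "2 * (D * E + C\<^sup>2)" "B * E - 2 * C * (1 + 2 * D) + 3 * C * D"])
          fix x :: real assume x: "0 < x"
          show "2 * (D * E + C\<^sup>2) * f x = (B * E - 2 * C * (1 + 2 * D) + 3 * C * D) * x\<^sup>2"
            using e(4,5,6)[OF x] F by algebra
        qed (use False in simp)
      next
        case True
        show ?thesis
        proof (rule quad[of "6 * E" "B * E - 2 * C * (1 + 2 * D) - 3 * A * C"])
          fix x :: real assume x: "0 < x"
          have "E * (x\<^sup>2 * f2 x) = 2 * E * f x"
            using reduced_system_derived(1)[OF s x] e(5)[OF x] F by algebra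
          then show "6 * E * f x = (B * E - 2 * C * (1 + 2 * D) - 3 * A * C) * x\<^sup>2"
            using e(1,5,6)[OF x] F AD True by algebra
        qed (use \<open>E \<noteq> 0\<close> in simp)
      qed
    qed
    then obtain a where a: "\<And>x. 0 < x \<Longrightarrow> f x = a * x\<^sup>2" by blast
    have "g1 x = ((1 + 2 * D - F * a) / E) * x" if x: "0 < x" for x
    proof -
      have "x * (E * g1 x) = x * ((1 + 2 * D - F * a) * x)" using e(6)[OF x] a[OF x] by algebra
      from this[unfolded mult_cancel_left] x have "E * g1 x = (1 + 2 * D - F * a) * x" by simp
      then show ?thesis using False by (simp add: field_simps)
    qed
    from fin[OF a this] show ?thesis ..
  next
    case E: True
    have F: "F = 2 * C" using e(5)[of 1] E by simp
    show ?thesis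
    proof (cases "C = 0")
      case False
      have "\<exists>a. \<forall>x>0. f x = a * x\<^sup>2"
      proof (rule quad[OF False])
        fix x :: real assume x: "0 < x"
        show "C * f x = (1 + A - D) * x\<^sup>2" using e(3)[OF x] E by algebra
      qed
      then obtain a where a: "\<And>x. 0 < x \<Longrightarrow> f x = a * x\<^sup>2" by blast
      have "g1 x = (- (B + D * a) / C) * x" if x: "0 < x" for x
      proof -
        have "x * (C * g1 x) = x * (- (B + D * a) * x)" using e(4)[OF x] a[OF x] f1[OF a x] F by algebra
        from this[unfolded mult_cancel_left] x have "C * g1 x = - (B + D * a) * x" by simp
        then show ?thesis using False by (simp add: field_simps)
      qed
      from fin[OF a this] show ?thesis ..
    next
      case True
      \<comment> \<open>With \<open>C = E = F = 0\<close> the torsion equations take over: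
        \<open>S \<noteq> 0\<close> would again make \<open>f\<close> quadratic and
        \<open>g1\<close> linear.\<close>
      have "S = 0"
      proof (rule ccontr)
        assume S: "S \<noteq> 0"
        have "\<exists>a. \<forall>x>0. f x = a * x\<^sup>2"
          by (rule quad[OF S, of "- T"]) (use e(7) in simp)
        then obtain a where a: "\<And>x. 0 < x \<Longrightarrow> f x = a * x\<^sup>2" by blast
        have "g1 x = (T * a / S) * x" if x: "0 < x" for x
        proof -
          have "x * (S * g1 x) = x * (T * a * x)" using e(8)[OF x] a[OF x] f1[OF a x] by algebra
          from this[unfolded mult_cancel_left] x have "S * g1 x = T * a * x" by simp
          then show ?thesis using S by (simp add: field_simps)
        qed
        from fin[OF a this] show False .
      qed
      then show ?thesis using E F True by simp
    qed
  qed
qed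

theorem killing_classification:
  assumes "kfield A B C D E F S T u v" "\<not> frame_field u v"
  shows "(C = 0 \<and> E = 0 \<and> F = 0 \<and> S = 0) \<or>
    (E \<noteq> 0 \<and> C = - F \<and> E * D = - (F\<^sup>2) \<and> A = 1 - D \<and> E * B = F * (1 - D) \<and> S = 0 \<and> T = 0) \<or>
    quadratic_killing A B C D E F S T"
proof -
  obtain \<alpha> f f1 f2 g1 g2 where r: "reduced_system A B C D E F S T \<alpha> f f1 f2 g1 g2"
    "\<alpha> = 0 \<or> \<alpha> = 1" "\<alpha> = 0 \<Longrightarrow> \<exists>x>0. f x \<noteq> 0 \<or> g1 x \<noteq> 0"
    by (rule reduced_system_of_not_frame_field[OF assms]) blast
  show ?thesis
  proof (cases "\<alpha> = 0")
    case True
    from reduced_system_zero[OF r(1)[unfolded True] r(3)[OF True]] show ?thesis by blast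
  next
    case False
    then have "\<alpha> = 1" using r(2) by simp
    from reduced_system_one[OF r(1)[unfolded this]] show ?thesis by blast
  qed
qed

section \<open>Spans of Killing fields\<close>

text \<open>A certificate that the introduction rules assemble, so that the derivatives of a
  concrete field are computed by resolution. The witness \<open>e\<close> is there because quotients
  and differences only equal elementary functions on the half plane, without having their
  form.\<close>

definition partials where
  "partials f fx fy fxx fxy fyy \<longleftrightarrow>
     (\<exists>e. elementary e \<and> (\<forall>x>0. \<forall>y. f x y = e x y)) \<and>
     (\<forall>x>0. \<forall>y. ((\<lambda>t. f t y) has_real_derivative fx x y) (at x) \<and> ((\<lambda>t. f x t) has_real_derivative fy x y) (at y) \<and>
       ((\<lambda>t. fx t y) has_real_derivative fxx x y) (at x) \<and> ((\<lambda>t. fx x t) has_real_derivative fxy x y) (at y) \<and>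
       ((\<lambda>t. fy x t) has_real_derivative fyy x y) (at y))"

lemma partials_const: "partials (\<lambda>x y. c) (\<lambda>x y. 0) (\<lambda>x y. 0) (\<lambda>x y. 0) (\<lambda>x y. 0) (\<lambda>x y. 0)"
  unfolding partials_def by (auto intro!: exI[of _ "\<lambda>x y. c"] elementary.intros)

lemma partials_fst: "partials (\<lambda>x y. x) (\<lambda>x y. 1) (\<lambda>x y. 0) (\<lambda>x y. 0) (\<lambda>x y. 0) (\<lambda>x y. 0)"
  unfolding partials_def by (auto intro!: exI[of _ "\<lambda>x y. x"] elementary.intros)

lemma partials_snd: "partials (\<lambda>x y. y) (\<lambda>x y. 0) (\<lambda>x y. 1) (\<lambda>x y. 0) (\<lambda>x y. 0) (\<lambda>x y. 0)"
  unfolding partials_def by (auto intro!: exI[of _ "\<lambda>x y. y"] elementary.intros)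

lemma partials_powr: "partials (\<lambda>x y. x powr c) (\<lambda>x y. c * x powr c / x) (\<lambda>x y. 0)
    (\<lambda>x y. c * (c - 1) * x powr c / x\<^sup>2) (\<lambda>x y. 0) (\<lambda>x y. 0)"
proof -
  have d: "((\<lambda>x. x powr c) has_real_derivative c * x powr c / x) (at x)" if "0 < x" for x c :: real
    using has_real_derivative_powr[OF that, of c] that by (simp add: powr_diff)
  have "((\<lambda>x. c * x powr c / x) has_real_derivative c * (c - 1) * x powr c / x\<^sup>2) (at x)" if x: "0 < x" for x :: real
    by (rule DERIV_cong[OF DERIV_divide[OF DERIV_cmult[OF d[OF x]] DERIV_ident]])
       (use x in \<open>simp_all add: field_simps power2_eq_square\<close>)
  with d show ?thesis
    unfolding partials_def by (auto intro!: exI[of _ "\<lambda>x y. x powr c"] elementary.intros)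
qed

lemma partials_ln: "partials (\<lambda>x y. ln x) (\<lambda>x y. 1 / x) (\<lambda>x y. 0) (\<lambda>x y. - 1 / x\<^sup>2) (\<lambda>x y. 0) (\<lambda>x y. 0)"
  unfolding partials_def
  by (auto intro!: exI[of _ "\<lambda>x y. ln x"] elementary.intros derivative_eq_intros simp: power2_eq_square)

lemma partials_mult:
  assumes "partials f fx fy fxx fxy fyy" "partials g gx gy gxx gxy gyy"
  shows "partials (\<lambda>x y. f x y * g x y) (\<lambda>x y. fx x y * g x y + f x y * gx x y) (\<lambda>x y. fy x y * g x y + f x y * gy x y)
    (\<lambda>x y. fxx x y * g x y + 2 * (fx x y * gx x y) + f x y * gxx x y)
    (\<lambda>x y. fxy x y * g x y + fx x y * gy x y + fy x y * gx x y + f x y * gxy x y)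
    (\<lambda>x y. fyy x y * g x y + 2 * (fy x y * gy x y) + f x y * gyy x y)"
proof -
  obtain e e' where e: "elementary e" "\<forall>x>0. \<forall>y. f x y = e x y" "elementary e'" "\<forall>x>0. \<forall>y. g x y = e' x y"
    using assms unfolding partials_def by blast
  note d = assms[unfolded partials_def, THEN conjunct2, rule_format]
  show ?thesis unfolding partials_def
  proof (intro conjI allI impI)
    show "\<exists>k. elementary k \<and> (\<forall>x>0. \<forall>y. f x y * g x y = k x y)"
      using e elementary.mult[OF e(1,3)] by (intro exI[of _ "\<lambda>x y. e x y * e' x y"]) auto
  qed (use d in \<open>auto intro!: derivative_eq_intros\<close>)
qed

lemma partials_add:
  assumes "partials f fx fy fxx fxy fyy" "partials g gx gy gxx gxy gyy"
  shows "partials (\<lambda>x y. f x y + g x y) (\<lambda>x y. fx x y + gx x y) (\<lambda>x y. fy x y + gy x y)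
    (\<lambda>x y. fxx x y + gxx x y) (\<lambda>x y. fxy x y + gxy x y) (\<lambda>x y. fyy x y + gyy x y)"
proof -
  obtain e e' where e: "elementary e" "\<forall>x>0. \<forall>y. f x y = e x y" "elementary e'" "\<forall>x>0. \<forall>y. g x y = e' x y"
    using assms unfolding partials_def by blast
  note d = assms[unfolded partials_def, THEN conjunct2, rule_format]
  show ?thesis unfolding partials_def
  proof (intro conjI allI impI)
    show "\<exists>k. elementary k \<and> (\<forall>x>0. \<forall>y. f x y + g x y = k x y)"
      using e elementary.add[OF e(1,3)] by (intro exI[of _ "\<lambda>x y. e x y + e' x y"]) auto
  qed (use d in \<open>auto intro!: derivative_eq_intros\<close>)
qed

lemma partials_minus:
  assumes "partials f fx fy fxx fxy fyy"
  shows "partials (\<lambda>x y. - f x y) (\<lambda>x y. - fx x y) (\<lambda>x y. - fy x y) (\<lambda>x y. - fxx x y) (\<lambda>x y. - fxy x y) (\<lambda>x y. - fyy x y)"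
  using partials_mult[OF partials_const[of "- 1"] assms] by simp

lemma partials_diff:
  assumes "partials f fx fy fxx fxy fyy" "partials g gx gy gxx gxy gyy"
  shows "partials (\<lambda>x y. f x y - g x y) (\<lambda>x y. fx x y - gx x y) (\<lambda>x y. fy x y - gy x y)
    (\<lambda>x y. fxx x y - gxx x y) (\<lambda>x y. fxy x y - gxy x y) (\<lambda>x y. fyy x y - gyy x y)"
  using partials_add[OF assms(1) partials_minus[OF assms(2)]] by simp

lemma partials_power2:
  assumes "partials f fx fy fxx fxy fyy"
  shows "partials (\<lambda>x y. (f x y)\<^sup>2) (\<lambda>x y. 2 * (f x y * fx x y)) (\<lambda>x y. 2 * (f x y * fy x y))
    (\<lambda>x y. 2 * ((fx x y)\<^sup>2 + f x y * fxx x y)) (\<lambda>x y. 2 * (fx x y * fy x y + f x y * fxy x y))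
    (\<lambda>x y. 2 * ((fy x y)\<^sup>2 + f x y * fyy x y))"
  using partials_mult[OF assms assms] by (simp add: power2_eq_square algebra_simps)

lemma partials_divide:
  assumes "partials f fx fy fxx fxy fyy"
  shows "partials (\<lambda>x y. f x y / x) (\<lambda>x y. fx x y / x - f x y / x\<^sup>2) (\<lambda>x y. fy x y / x)
    (\<lambda>x y. fxx x y / x - 2 * fx x y / x\<^sup>2 + 2 * f x y / (x * x\<^sup>2)) (\<lambda>x y. fxy x y / x - fy x y / x\<^sup>2) (\<lambda>x y. fyy x y / x)"
proof -
  obtain e where e: "elementary e" "\<forall>x>0. \<forall>y. f x y = e x y"
    using assms unfolding partials_def by blast
  note d = assms[unfolded partials_def, THEN conjunct2, rule_format]
  show ?thesis unfolding partials_def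
  proof (intro conjI allI impI)
    show "\<exists>k. elementary k \<and> (\<forall>x>0. \<forall>y. f x y / x = k x y)"
      using e elementary.mult[OF e(1) elementary.powr[of "- 1"]]
      by (intro exI[of _ "\<lambda>x y. e x y * x powr (- 1)"]) (auto simp: powr_minus divide_inverse)
  qed (use d in \<open>auto intro!: derivative_eq_intros simp: field_simps power2_eq_square\<close>)
qed

lemmas partials_intros = partials_const partials_fst partials_snd partials_powr partials_ln partials_power2 partials_mult
  partials_add partials_diff partials_minus partials_divide

lemmas killing_eqs_simps = killing_eqs_def field_simps power2_eq_square

lemma partials_smooth2: "partials f fx fy fxx fxy fyy \<Longrightarrow> smooth2 f"
  unfolding partials_def using elementary_smooth2 smooth2_cong by (metis (no_types, lifting))

lemma partials_Dx_Dy: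
  assumes "partials f fx fy fxx fxy fyy" "0 < x"
  shows "Dx f x y = fx x y" "Dy f x y = fy x y" "Dx (Dx f) x y = fxx x y" "Dy (Dx f) x y = fxy x y" "Dy (Dy f) x y = fyy x y"
proof -
  note d = assms(1)[unfolded partials_def, THEN conjunct2, rule_format]
  have S: "smooth2 f" by (rule partials_smooth2[OF assms(1)])
  have 1: "Dx f x y = fx x y" "Dy f x y = fy x y" if "0 < x" for x y
    using Dx_eqI[OF S that] Dy_eqI[OF S that] d[OF that] by blast+
  show "Dx f x y = fx x y" "Dy f x y = fy x y" using 1 assms(2) by auto
  have Sx: "smooth2 fx" by (rule smooth2_cong[OF smooth2_Dx[OF S]]) (simp add: 1)
  have Sy: "smooth2 fy" by (rule smooth2_cong[OF smooth2_Dy[OF S]]) (simp add: 1)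
  have "Dx fx x y = fxx x y" "Dy fx x y = fxy x y" "Dy fy x y = fyy x y"
    using Dx_eqI[OF Sx assms(2)] Dy_eqI[OF Sx assms(2)] Dy_eqI[OF Sy assms(2)] d[OF assms(2)] by blast+
  moreover have "Dx (Dx f) x y = Dx fx x y" by (rule Dx_cong[OF Sx _ assms(2)]) (simp add: 1)
  moreover have "Dy (Dx f) x y = Dy fx x y" by (rule Dy_cong[OF Sx _ assms(2)]) (simp add: 1)
  moreover have "Dy (Dy f) x y = Dy fy x y" by (rule Dy_cong[OF Sy _ assms(2)]) (simp add: 1)
  ultimately show "Dx (Dx f) x y = fxx x y" "Dy (Dx f) x y = fxy x y" "Dy (Dy f) x y = fyy x y" by simp_all
qed

section \<open>Spans determined by 1-jets at the base point\<close>

definition kfield_jet where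
  "kfield_jet A B C D E F S T w j \<longleftrightarrow> kfield A B C D E F S T (fst w) (snd w) \<and> jet (fst w) (snd w) = j"

text \<open>Once \<open>partials_intros\<close> has instantiated all derivatives, what remains is
  arithmetic in \<open>x\<close> and \<open>y\<close> and an evaluation at
  \<open>(1, 0)\<close>.\<close>

lemma kfield_jetI:
  assumes "partials u ux uy uxx uxy uyy" "partials v vx vy vxx vxy vyy"
    "\<And>x y. 0 < x \<Longrightarrow> killing_eqs A B C D E F S T x (u x y) (ux x y) (uy x y) (uxx x y) (uxy x y) (uyy x y)
      (vx x y) (vy x y) (vxx x y) (vxy x y) (vyy x y)"
    "j = vector [u 1 0, ux 1 0, uy 1 0, v 1 0, vx 1 0, vy 1 0]"
  shows "kfield_jet A B C D E F S T (u, v) j"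
  using assms partials_smooth2[OF assms(1)] partials_smooth2[OF assms(2)]
  by (simp add: kfield_jet_def kfield_def jet_def partials_Dx_Dy[OF assms(1)] partials_Dx_Dy[OF assms(2)])

lemma jet_lincomb:
  assumes "smooth2 u" "smooth2 v" "smooth2 u'" "smooth2 v'"
  shows "jet (\<lambda>x y. a * u x y + b * u' x y) (\<lambda>x y. a * v x y + b * v' x y) = a *\<^sub>R jet u v + b *\<^sub>R jet u' v'"
  by (simp add: jet_def vec6_simps Dx_lincomb Dy_lincomb assms)

definition vf2 :: "(real \<Rightarrow> real \<Rightarrow> real) \<times> (real \<Rightarrow> real \<Rightarrow> real) \<Rightarrow> real^2 \<Rightarrow> real^2"
  where "vf2 w = vf (\<lambda>x y. (fst w x y, snd w x y))"

lemma vf_cong: "(\<And>x y. 0 < x \<Longrightarrow> F x y = G x y) \<Longrightarrow> vf F = vf G"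
  by (auto simp: vf_def half_plane_def)

lemma vf_lincomb: "vf (\<lambda>x y. (a * u x y + b * u' x y, a * v x y + b * v' x y))
    = a *\<^sub>R vf (\<lambda>x y. (u x y, v x y)) + b *\<^sub>R vf (\<lambda>x y. (u' x y, v' x y))"
  by (simp add: fun_eq_iff vf_def scaleR_fun_def vec_eq_iff forall_2)

text \<open>Multiples of the generators are subtracted one at a time; the last field has zero jet
  and therefore vanishes. Lists pair each coefficient with its generator.\<close>

lemma vf_in_span:
  assumes "list_all2 (kfield_jet A B C D E F S T) gs js"
    "kfield A B C D E F S T u v" "length cs = length js" "jet u v = (\<Sum>(c, j)\<leftarrow>zip cs js. c *\<^sub>R j)"
  shows "vf (\<lambda>x y. (u x y, v x y)) \<in> span (vf2 ` set gs)"
  using assms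
proof (induction arbitrary: cs u v rule: list_all2_induct)
  case Nil
  then have "u 1 0 = 0" "Dx u 1 0 = 0" "Dy u 1 0 = 0" "v 1 0 = 0" "Dx v 1 0 = 0" "Dy v 1 0 = 0"
    by (simp_all add: jet_def vec6_simps)
  then have "u x y = 0 \<and> v x y = 0" if "0 < x" for x y by (rule kfield_zero_jet[OF Nil(1) _ _ _ _ _ _ that])
  then have "vf (\<lambda>x y. (u x y, v x y)) = 0"
    by (simp add: fun_eq_iff vf_def half_plane_def vec_eq_iff forall_2)
  then show ?case using span_zero by metis
next
  case (Cons w gs j js)
  obtain c cs' where cs: "cs = c # cs'" "length cs' = length js" using Cons.prems(2) by (cases cs) auto
  have w: "kfield A B C D E F S T (fst w) (snd w)" "jet (fst w) (snd w) = j"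
    using Cons.hyps(1) by (simp_all add: kfield_jet_def)
  let ?u = "\<lambda>x y. 1 * u x y + (- c) * fst w x y" and ?v = "\<lambda>x y. 1 * v x y + (- c) * snd w x y"
  have "vf (\<lambda>x y. (?u x y, ?v x y)) \<in> span (vf2 ` set gs)"
  proof (rule Cons.IH[OF kfield_lincomb[OF Cons.prems(1) w(1)] cs(2)])
    have "jet ?u ?v = 1 *\<^sub>R jet u v + (- c) *\<^sub>R jet (fst w) (snd w)"
      using kfield_smooth2[OF Cons.prems(1)] kfield_smooth2[OF w(1)] by (intro jet_lincomb) auto
    then show "jet ?u ?v = (\<Sum>(c, j)\<leftarrow>zip cs' js. c *\<^sub>R j)"
      using Cons.prems(3) cs w(2) by simp
  qed
  then have "vf (\<lambda>x y. (?u x y, ?v x y)) + c *\<^sub>R vf2 w \<in> span (vf2 ` set (w # gs))"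
    by (intro span_add span_scale) (auto intro: span_base subsetD[OF span_mono, of "vf2 ` set gs"])
  moreover have "vf (\<lambda>x y. (?u x y, ?v x y)) + c *\<^sub>R vf2 w = vf (\<lambda>x y. (u x y, v x y))"
    unfolding vf_lincomb vf2_def by simp
  ultimately show ?case by simp
qed

lemma subspace_killing: "subspace (killing (model A B C D E F S T))"
proof (rule subspaceI)
  have "kfield_jet A B C D E F S T (\<lambda>x y. 0, \<lambda>x y. 0) 0"
    by (rule kfield_jetI[OF partials_const partials_const]) (simp_all add: killing_eqs_def vec6_simps)
  then have "vf (\<lambda>x y. (0, 0)) \<in> killing (model A B C D E F S T)" by (simp add: kfield_jet_def killing_vf)
  moreover have "vf (\<lambda>x y. (0, 0)) = 0" by (simp add: fun_eq_iff vf_def vec_eq_iff forall_2)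
  ultimately show "0 \<in> killing (model A B C D E F S T)" by simp
next
  fix Y Z assume Y: "Y \<in> killing (model A B C D E F S T)" and Z: "Z \<in> killing (model A B C D E F S T)"
  obtain u v where 1: "kfield A B C D E F S T u v" "Y = vf (\<lambda>x y. (u x y, v x y))"
    using Y by (rule killing_cases)
  obtain u' v' where 2: "kfield A B C D E F S T u' v'" "Z = vf (\<lambda>x y. (u' x y, v' x y))"
    using Z by (rule killing_cases)
  have "Y + Z = vf (\<lambda>x y. (1 * u x y + 1 * u' x y, 1 * v x y + 1 * v' x y))"
    unfolding 1(2) 2(2) vf_lincomb by simp
  then show "Y + Z \<in> killing (model A B C D E F S T)"
    by (simp only: killing_vf kfield_lincomb[OF 1(1) 2(1)])
next
  fix c Y assume Y: "Y \<in> killing (model A B C D E F S T)"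
  obtain u v where 1: "kfield A B C D E F S T u v" "Y = vf (\<lambda>x y. (u x y, v x y))"
    using Y by (rule killing_cases)
  have "c *\<^sub>R Y = vf (\<lambda>x y. (c * u x y + 0 * u x y, c * v x y + 0 * v x y))"
    unfolding 1(2) vf_lincomb by simp
  then show "c *\<^sub>R Y \<in> killing (model A B C D E F S T)"
    by (simp only: killing_vf kfield_lincomb[OF 1(1) 1(1)])
qed

text \<open>The second premise carries the upper bound. In applications, constraints on
  \<open>j1\<close> to \<open>j6\<close> come from torsion or curvature, and \<open>cs\<close>
  solves the resulting linear system.\<close>

lemma killing_eq_span:
  assumes "list_all2 (kfield_jet A B C D E F S T) gs js"
    "\<And>u v j1 j2 j3 j4 j5 j6. kfield A B C D E F S T u v \<Longrightarrow> jet u v = vector [j1, j2, j3, j4, j5, j6] \<Longrightarrow>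
      \<exists>cs. length cs = length js \<and> vector [j1, j2, j3, j4, j5, j6] = (\<Sum>(c, j)\<leftarrow>zip cs js. c *\<^sub>R j)"
  shows "killing (model A B C D E F S T) = span (vf2 ` set gs)"
proof
  show "killing (model A B C D E F S T) \<subseteq> span (vf2 ` set gs)"
  proof
    fix Y assume "Y \<in> killing (model A B C D E F S T)"
    then obtain u v where k: "kfield A B C D E F S T u v" "Y = vf (\<lambda>x y. (u x y, v x y))" by (rule killing_cases)
    from assms(2)[OF k(1) jet_def] obtain cs where "length cs = length js" "jet u v = (\<Sum>(c, j)\<leftarrow>zip cs js. c *\<^sub>R j)"
      unfolding jet_def[symmetric] by blast
    then show "Y \<in> span (vf2 ` set gs)" unfolding k(2) by (rule vf_in_span[OF assms(1) k(1)])
  qed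
  have "vf2 ` set gs \<subseteq> killing (model A B C D E F S T)"
    using assms(1) by (induction rule: list_all2_induct) (auto simp: vf2_def killing_vf kfield_jet_def)
  then show "span (vf2 ` set gs) \<subseteq> killing (model A B C D E F S T)"
    by (rule span_minimal[OF _ subspace_killing])
qed

lemmas span_coefficient_simps = zip_Cons_Cons zip_Nil list.map prod.case sum_list.Cons sum_list.Nil list.size

text \<open>The classification read contrapositively; it gives the algebra of each listed model at
  the excluded torsion values.\<close>

lemma killing_eq_span_XX_D2:
  assumes "\<not> (C = 0 \<and> E = 0 \<and> F = 0 \<and> S = 0)"
    "\<not> (E \<noteq> 0 \<and> C = - F \<and> E * D = - (F\<^sup>2) \<and> A = 1 - D \<and> E * B = F * (1 - D) \<and> S = 0 \<and> T = 0)"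
    "\<not> quadratic_killing A B C D E F S T"
  shows "killing (model A B C D E F S T) = span {XX, D2}"
proof
  have "kfield_jet A B C D E F S T (\<lambda>x y. x, \<lambda>x y. y) (vector [1, 1, 0, 0, 0, 1])"
    "kfield_jet A B C D E F S T (\<lambda>x y. 0, \<lambda>x y. 1) (vector [0, 0, 0, 1, 0, 0])"
    by (rule kfield_jetI, (rule partials_intros)+, simp_all add: killing_eqs_def algebra_simps)+
  then have "{XX, D2} \<subseteq> killing (model A B C D E F S T)"
    by (simp add: XX_def D2_def killing_vf kfield_jet_def)
  then show "span {XX, D2} \<subseteq> killing (model A B C D E F S T)"
    by (rule span_minimal[OF _ subspace_killing])
  show "killing (model A B C D E F S T) \<subseteq> span {XX, D2}"
  proof
    fix Y assume "Y \<in> killing (model A B C D E F S T)"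
    then obtain u v where k: "kfield A B C D E F S T u v" "Y = vf (\<lambda>x y. (u x y, v x y))" by (rule killing_cases)
    then have "frame_field u v" using killing_classification assms by blast
    then obtain \<alpha> \<beta> where ab: "\<And>x y. 0 < x \<Longrightarrow> u x y = \<alpha> * x \<and> v x y = \<alpha> * y + \<beta>" unfolding frame_field_def by blast
    have "Y = \<alpha> *\<^sub>R XX + \<beta> *\<^sub>R D2"
      unfolding k(2) XX_def D2_def vf_lincomb[symmetric] by (rule vf_cong) (simp add: ab)
    then show "Y \<in> span {XX, D2}" by (simp add: span_add span_scale span_base)
  qed
qed

lemma dim_span_XX_D2: "dim (span {XX, D2}) \<le> 2"
proof -
  have "dim (span {XX, D2}) = dim {XX, D2}" by (rule dim_span)
  also have "\<dots> \<le> card {XX, D2}" by (rule dim_le_card') simp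
  also have "\<dots> \<le> 2" by (simp add: card_insert_if)
  finally show ?thesis .
qed

text \<open>The compatibility conditions of the Killing system: the Lie derivative of the Ricci tensor
  of the symmetric part of the connection vanishes.\<close>

lemma kfield_ricci:
  assumes k: "kfield A B C D E F S T u v" and x: "0 < x"
  defines "r11 \<equiv> D * (1 + A - D) + B * (F - C)" and "r12 \<equiv> F - E * B + C * D"
    and "r21 \<equiv> - C + D * C - B * E" and "r22 \<equiv> E * (A - 1 - D) + C * (F - C)"
  shows "- 2 * u x y * r11 + x * (2 * r11 * Dx u x y + (r12 + r21) * Dx v x y) = 0"
    "- 2 * u x y * r12 + x * (r12 * Dx u x y + r22 * Dx v x y + r11 * Dy u x y + r12 * Dy v x y) = 0"
    "- 2 * u x y * r21 + x * (r21 * Dx u x y + r22 * Dx v x y + r11 * Dy u x y + r21 * Dy v x y) = 0"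
    "- 2 * u x y * r22 + x * ((r12 + r21) * Dy u x y + 2 * r22 * Dy v x y) = 0"
proof -
  have S: "smooth2 u" "smooth2 v" using kfield_smooth2[OF k] by auto
  note e = killing_eqsD[OF k, unfolded killing_eqs_def]
  have c: "Dx (Dy f) x y = Dy (Dx f) x y" "Dx (Dy (Dx f)) x y = Dy (Dx (Dx f)) x y"
    "Dx (Dy (Dy f)) x y = Dy (Dy (Dx f)) x y" if "smooth2 f" for f
  proof -
    show "Dx (Dy f) x y = Dy (Dx f) x y" by (rule Dx_Dy_commute[OF that x])
    show "Dx (Dy (Dx f)) x y = Dy (Dx (Dx f)) x y" by (rule Dx_Dy_commute[OF smooth2_Dx[OF that] x])
    show "Dx (Dy (Dy f)) x y = Dy (Dy (Dx f)) x y"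
      using Dx_Dy_commute[OF smooth2_Dy[OF that] x]
        Dy_cong[OF smooth2_Dy[OF smooth2_Dx[OF that]] Dx_Dy_commute[OF that] x] by simp
  qed
  have dy: "((\<lambda>t. f x t) has_real_derivative Dy f x y) (at y)" if "smooth2 f" for f using smooth2_dy[OF that x] .
  have dx: "((\<lambda>t. f t y) has_real_derivative Dx f x y) (at x)" if "smooth2 f" for f using smooth2_dx[OF that x] .
  note d = dy[OF S(1)] dy[OF S(2)] dy[OF smooth2_Dx[OF S(1)]] dy[OF smooth2_Dx[OF S(2)]] dy[OF smooth2_Dy[OF S(1)]] dy[OF smooth2_Dy[OF S(2)]]
    dy[OF smooth2_Dx[OF smooth2_Dx[OF S(1)]]] dy[OF smooth2_Dx[OF smooth2_Dx[OF S(2)]]] dy[OF smooth2_Dy[OF smooth2_Dx[OF S(1)]]] dy[OF smooth2_Dy[OF smooth2_Dx[OF S(2)]]]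
  note d' = dx[OF S(1)] dx[OF S(2)] dx[OF smooth2_Dx[OF S(1)]] dx[OF smooth2_Dx[OF S(2)]] dx[OF smooth2_Dy[OF S(1)]] dx[OF smooth2_Dy[OF S(2)]]
    dx[OF smooth2_Dy[OF smooth2_Dx[OF S(1)]]] dx[OF smooth2_Dy[OF smooth2_Dx[OF S(2)]]] dx[OF smooth2_Dy[OF smooth2_Dy[OF S(1)]]] dx[OF smooth2_Dy[OF smooth2_Dy[OF S(2)]]]
  define u0 ux uy vx vy uxx uxy uyy vxx vxy vyy where "u0 = u x y"
    and "ux = Dx u x y" and "uy = Dy u x y" and "vx = Dx v x y" and "vy = Dy v x y"
    and "uxx = Dx (Dx u) x y" and "uxy = Dy (Dx u) x y" and "uyy = Dy (Dy u) x y"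
    and "vxx = Dx (Dx v) x y" and "vxy = Dy (Dx v) x y" and "vyy = Dy (Dy v) x y"
  note u_defs = u0_def ux_def uy_def vx_def vy_def uxx_def uxy_def uyy_def vxx_def vxy_def vyy_def
  define uxxy uxyy vxxy vxyy where "uxxy = Dy (Dx (Dx u)) x y" and "uxyy = Dy (Dy (Dx u)) x y"
    and "vxxy = Dy (Dx (Dx v)) x y" and "vxyy = Dy (Dy (Dx v)) x y"
  note defs = u_defs uxxy_def uxyy_def vxxy_def vxyy_def
  \<comment> \<open>Each of \<open>uxxy\<close>, \<open>vxxy\<close>, \<open>uxyy\<close>,
    \<open>vxyy\<close> is obtained twice, from one equation differentiated in y and another
    differentiated in x. Comparing the two and eliminating second derivatives leaves a first-order
    equation.\<close>
  have y1: "x\<^sup>2 * uxxy - A * uy + x * (A * uxy - B * uyy + 2 * C * vxy) = 0"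
    by (rule zero_has_derivative[of "\<lambda>t. x\<^sup>2 * Dx (Dx u) x t - A * u x t + x * (A * Dx u x t - B * Dy u x t + 2 * C * Dx v x t)"],
        (auto intro!: derivative_eq_intros d simp: defs)[1], use e[OF x] in blast)
  have y2: "x\<^sup>2 * vxxy - B * uy + x * ((2 * D - A) * vxy - B * vyy + 2 * B * uxy) = 0"
    by (rule zero_has_derivative[of "\<lambda>t. x\<^sup>2 * Dx (Dx v) x t - B * u x t + x * ((2 * D - A) * Dx v x t - B * Dy v x t + 2 * B * Dx u x t)"],
        (auto intro!: derivative_eq_intros d simp: defs)[1], use e[OF x] in blast)
  have y3: "x\<^sup>2 * uxyy - C * uy + x * ((A - D) * uyy + C * vyy + E * vxy) = 0"
    by (rule zero_has_derivative[of "\<lambda>t. x\<^sup>2 * Dy (Dx u) x t - C * u x t + x * ((A - D) * Dy u x t + C * Dy v x t + E * Dx v x t)"],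
        (auto intro!: derivative_eq_intros d simp: defs)[1], use e[OF x] in blast)
  have y4: "x\<^sup>2 * vxyy - D * uy + x * ((F - C) * vxy + B * uyy + D * uxy) = 0"
    by (rule zero_has_derivative[of "\<lambda>t. x\<^sup>2 * Dy (Dx v) x t - D * u x t + x * ((F - C) * Dx v x t + B * Dy u x t + D * Dx u x t)"],
        (auto intro!: derivative_eq_intros d simp: defs)[1], use e[OF x] in blast)
  have x3: "2 * x * uxy + x\<^sup>2 * uxxy - C * ux + ((A - D) * uy + C * vy + E * vx) + x * ((A - D) * uxy + C * vxy + E * vxx) = 0"
    by (rule DERIV_unique_pos[of "\<lambda>t. t\<^sup>2 * Dy (Dx u) t y - C * u t y + t * ((A - D) * Dy u t y + C * Dy v t y + E * Dx v t y)" _ x "\<lambda>t. 0"],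
        (auto intro!: derivative_eq_intros d' simp: defs c[OF S(1)] c[OF S(2)])[1], simp, use e in blast, rule x)
  have x4: "2 * x * vxy + x\<^sup>2 * vxxy - D * ux + ((F - C) * vx + B * uy + D * ux) + x * ((F - C) * vxx + B * uxy + D * uxx) = 0"
    by (rule DERIV_unique_pos[of "\<lambda>t. t\<^sup>2 * Dy (Dx v) t y - D * u t y + t * ((F - C) * Dx v t y + B * Dy u t y + D * Dx u t y)" _ x "\<lambda>t. 0"],
        (auto intro!: derivative_eq_intros d' simp: defs c[OF S(1)] c[OF S(2)])[1], simp, use e in blast, rule x)
  have x5: "2 * x * uyy + x\<^sup>2 * uxyy - E * ux + ((2 * C - F) * uy - E * ux + 2 * E * vy) + x * ((2 * C - F) * uxy - E * uxx + 2 * E * vxy) = 0"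
    by (rule DERIV_unique_pos[of "\<lambda>t. t\<^sup>2 * Dy (Dy u) t y - E * u t y + t * ((2 * C - F) * Dy u t y - E * Dx u t y + 2 * E * Dy v t y)" _ x "\<lambda>t. 0"],
        (auto intro!: derivative_eq_intros d' simp: defs c[OF S(1)] c[OF S(2)])[1], simp, use e in blast, rule x)
  have x6: "2 * x * vyy + x\<^sup>2 * vxyy - F * ux + (2 * D * uy - E * vx + F * vy) + x * (2 * D * uxy - E * vxx + F * vxy) = 0"
    by (rule DERIV_unique_pos[of "\<lambda>t. t\<^sup>2 * Dy (Dy v) t y - F * u t y + t * (2 * D * Dy u t y - E * Dx v t y + F * Dy v t y)" _ x "\<lambda>t. 0"],
        (auto intro!: derivative_eq_intros d' simp: defs c[OF S(1)] c[OF S(2)])[1], simp, use e in blast, rule x)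
  note k = e[OF x, of y, folded u_defs]
  have k: "x\<^sup>2 * uxx - A * u0 + x * (A * ux - B * uy + 2 * C * vx) = 0"
    "x\<^sup>2 * vxx - B * u0 + x * ((2 * D - A) * vx - B * vy + 2 * B * ux) = 0"
    "x\<^sup>2 * uxy - C * u0 + x * ((A - D) * uy + C * vy + E * vx) = 0"
    "x\<^sup>2 * vxy - D * u0 + x * ((F - C) * vx + B * uy + D * ux) = 0"
    "x\<^sup>2 * uyy - E * u0 + x * ((2 * C - F) * uy - E * ux + 2 * E * vy) = 0"
    "x\<^sup>2 * vyy - F * u0 + x * (2 * D * uy - E * vx + F * vy) = 0"
    using k by blast+
  show "- 2 * u x y * r11 + x * (2 * r11 * Dx u x y + (r12 + r21) * Dx v x y) = 0"
    unfolding r11_def r12_def r21_def r22_def u_defs[symmetric]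
    using y2 x4 k by algebra
  show "- 2 * u x y * r12 + x * (r12 * Dx u x y + r22 * Dx v x y + r11 * Dy u x y + r12 * Dy v x y) = 0"
    unfolding r11_def r12_def r21_def r22_def u_defs[symmetric]
    using y4 x6 k by algebra
  show "- 2 * u x y * r21 + x * (r21 * Dx u x y + r22 * Dx v x y + r11 * Dy u x y + r21 * Dy v x y) = 0"
    unfolding r11_def r12_def r21_def r22_def u_defs[symmetric]
    using y1 x3 k by algebra
  show "- 2 * u x y * r22 + x * ((r12 + r21) * Dy u x y + 2 * r22 * Dy v x y) = 0"
    unfolding r11_def r12_def r21_def r22_def u_defs[symmetric]
    using y3 x5 k by algebra
qed

section \<open>Killing algebras of the listed models\<close>

lemma models_as_model:
  "N6_0 T1 T2 = model 0 0 0 0 0 0 T1 T2"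
  "N6_1 s T1 T2 = model 1 0 0 0 s 0 T1 T2"
  "N6_2 c T1 T2 = model (c - 1) 0 0 c 0 0 T1 T2"
  "N6_3 T1 T2 = model (- 2) 1 0 (- 1) 0 0 T1 T2"
  "N6_4 T1 T2 = model 0 1 0 0 0 0 T1 T2"
  "N6_5 T1 T2 = model (- 1) 0 0 0 0 0 T1 T2"
  "N6_6 c T1 T2 = model c 0 0 0 0 0 T1 T2"
  "N4_1 \<kappa> T1 T2 = model (2 * \<kappa>) 1 0 \<kappa> 0 0 T1 T2"
  "N4_2 \<kappa> \<theta> T1 T2 = model (\<theta> - 1 + 2 * \<kappa>) 0 0 \<kappa> 0 0 T1 T2"
  "N4_3 c T1 T2 = model (2 * c - 1) 0 0 c 0 0 T1 T2"
  "N3_1 s T1 T2 = model (- 3/2) 0 0 (- 1/2) (s / 2) 0 T1 T2"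
  "N3_2 c T1 T2 = model (- 3/2) 0 1 (- 1/2) c 2 T1 T2"
  "N3_3 T1 T2 = model (- 1) 0 0 (- 1) (- 1) 0 T1 T2"
  "N3_4 T1 T2 = model (- 1) 0 0 (- 1) 1 0 T1 T2"
  by (simp_all add: model_def N6_0_def N6_1_def N6_2_def N6_3_def N6_4_def N6_5_def N6_6_def N4_1_def N4_2_def
    N4_3_def N3_1_def N3_2_def N3_3_def N3_4_def algebra_simps)

text \<open>When \<open>C = E = F = S = 0\<close>, the only Ricci coefficient that can be nonzero is
  \<open>D * (1 + A - D)\<close>, and its invariance gives the same two conditions as a nonzero
  \<open>T\<close>. Either cuts the six jet entries down to four.\<close>

lemma rank_one_constraints:
  assumes k: "kfield A B 0 D 0 0 0 T u v" and n: "T \<noteq> 0 \<or> D * (1 + A - D) \<noteq> 0"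
  shows "Dy u 1 0 = 0" "Dx u 1 0 = u 1 0"
proof -
  have "T * Dy u 1 0 = 0" "T * u 1 0 = T * Dx u 1 0"
    using killing_eqsD[OF k zero_less_one, of 0] by (simp_all add: killing_eqs_def)
  moreover have "D * (1 + A - D) * Dy u 1 0 = 0" "D * (1 + A - D) * (u 1 0 - Dx u 1 0) = 0"
    using kfield_ricci[OF k zero_less_one, of 0] by (simp_all add: algebra_simps)
  ultimately show "Dy u 1 0 = 0" "Dx u 1 0 = u 1 0" using n by auto
qed

text \<open>For a field \<open>v(x) d/dy\<close> the system is the Euler equation
  \<open>x^2 v'' + (2 D - A) x v' = 0\<close>, with exponents 0 and
  \<open>\<theta> = 1 + A - 2 D\<close>.\<close>

lemma killing_powr:
  assumes "A = \<theta> - 1 + 2 * D" "\<theta> \<noteq> 0" "T \<noteq> 0 \<or> D * (1 + A - D) \<noteq> 0"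
  shows "killing (model A 0 0 D 0 0 0 T) = span {XX, D2, vf (\<lambda>x y. (0, y)), vf (\<lambda>x y. (0, x powr \<theta>))}"
proof -
  have "killing (model A 0 0 D 0 0 0 T) = span (vf2 ` set
      [(\<lambda>x y. x, \<lambda>x y. y), (\<lambda>x y. 0, \<lambda>x y. 1), (\<lambda>x y. 0, \<lambda>x y. y), (\<lambda>x y. 0, \<lambda>x y. x powr \<theta>)])"
  proof (rule killing_eq_span[where js = "[vector [1, 1, 0, 0, 0, 1], vector [0, 0, 0, 1, 0, 0], vector [0, 0, 0, 0, 0, 1], vector [0, 0, 0, 1, \<theta>, 0]]"], goal_cases)
    case 1
    show ?case
      unfolding assms(1) by (intro list.rel_intros; (rule kfield_jetI, (rule partials_intros)+,
          simp_all add: killing_eqs_simps))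
  next
    case (2 u v j1 j2 j3 j4 j5 j6)
    have con: "j3 = 0" "j2 = j1"
      using rank_one_constraints[OF 2(1)] 2(2) assms by (simp_all add: jet_def vec6_simps)
    show ?case
      by (rule exI[of _ "[j1, j4 - j5 / \<theta>, j6 - j1, j5 / \<theta>]"])
         (simp only: span_coefficient_simps, insert assms(2), simp add: con vec6_simps field_simps)
  qed
  then show ?thesis by (simp add: vf2_def XX_def D1_def D2_def)
qed

text \<open>The Euler equation with double exponent 0, where \<open>ln x\<close> replaces the power;
  here the Ricci coefficient is \<open>D^2\<close>.\<close>

lemma killing_ln:
  assumes "A = 2 * D - 1" "T \<noteq> 0 \<or> D \<noteq> 0"
  shows "killing (model A 0 0 D 0 0 0 T) = span {XX, D2, vf (\<lambda>x y. (0, y)), vf (\<lambda>x y. (0, ln x))}"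
proof -
  have "killing (model A 0 0 D 0 0 0 T) = span (vf2 ` set
      [(\<lambda>x y. x, \<lambda>x y. y), (\<lambda>x y. 0, \<lambda>x y. 1), (\<lambda>x y. 0, \<lambda>x y. y), (\<lambda>x y. 0, \<lambda>x y. ln x)])"
  proof (rule killing_eq_span[where js = "[vector [1, 1, 0, 0, 0, 1], vector [0, 0, 0, 1, 0, 0], vector [0, 0, 0, 0, 0, 1], vector [0, 0, 0, 0, 1, 0]]"], goal_cases)
    case 1
    show ?case
      unfolding assms(1) by (intro list.rel_intros; (rule kfield_jetI, (rule partials_intros)+,
          simp_all add: killing_eqs_simps))
  next
    case (2 u v j1 j2 j3 j4 j5 j6)
    have con: "j3 = 0" "j2 = j1"
      using rank_one_constraints[OF 2(1)] 2(2) assms by (simp_all add: jet_def vec6_simps)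
    show ?case
      by (rule exI[of _ "[j1, j4, j6 - j1, j5]"])
         (simp only: span_coefficient_simps, simp add: con vec6_simps field_simps)
  qed
  then show ?thesis by (simp add: vf2_def XX_def D1_def D2_def)
qed

text \<open>With \<open>A = 2 D\<close> the exponents are 0 and 1, and the term with
  \<open>B = 1\<close> is resonant: \<open>x^2 v'' = x\<close> for \<open>v(x) + y\<close>, whence
  \<open>x * ln x\<close>.\<close>

lemma killing_xlnx:
  assumes "A = 2 * D" "T \<noteq> 0 \<or> D * (1 + A - D) \<noteq> 0"
  shows "killing (model A 1 0 D 0 0 0 T) = span {XX, D2, vf (\<lambda>x y. (0, x)), vf (\<lambda>x y. (0, y + x * ln x))}"
proof -
  have "killing (model A 1 0 D 0 0 0 T) = span (vf2 ` set
      [(\<lambda>x y. x, \<lambda>x y. y), (\<lambda>x y. 0, \<lambda>x y. 1), (\<lambda>x y. 0, \<lambda>x y. x), (\<lambda>x y. 0, \<lambda>x y. y + x * ln x)])"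
  proof (rule killing_eq_span[where js = "[vector [1, 1, 0, 0, 0, 1], vector [0, 0, 0, 1, 0, 0], vector [0, 0, 0, 1, 1, 0], vector [0, 0, 0, 0, 1, 1]]"], goal_cases)
    case 1
    show ?case
      unfolding assms(1) by (intro list.rel_intros; (rule kfield_jetI, (rule partials_intros)+,
          simp_all add: killing_eqs_simps))
  next
    case (2 u v j1 j2 j3 j4 j5 j6)
    have con: "j3 = 0" "j2 = j1"
      using rank_one_constraints[OF 2(1) assms(2)] 2(2) by (simp_all add: jet_def vec6_simps)
    show ?case
      by (rule exI[of _ "[j1, j4 - (j5 - (j6 - j1)), j5 - (j6 - j1), j6 - j1]"])
         (simp only: span_coefficient_simps, simp add: con vec6_simps field_simps)
  qed
  then show ?thesis by (simp add: vf2_def XX_def D1_def D2_def)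
qed

text \<open>The algebra of \<open>killing_xlnx\<close> with \<open>X\<close> minus its last
  generator in place of that generator: the basis in which \<open>N4_1\<close> is described.\<close>

lemma killing_xlnx_alt:
  assumes "A = 2 * D" "T \<noteq> 0 \<or> D * (1 + A - D) \<noteq> 0"
  shows "killing (model A 1 0 D 0 0 0 T) = span {XX, D2, vf (\<lambda>x y. (0, x)), vf (\<lambda>x y. (x, x * (- ln x)))}"
proof -
  have "killing (model A 1 0 D 0 0 0 T) = span (vf2 ` set
      [(\<lambda>x y. x, \<lambda>x y. y), (\<lambda>x y. 0, \<lambda>x y. 1), (\<lambda>x y. 0, \<lambda>x y. x), (\<lambda>x y. x, \<lambda>x y. x * (- ln x))])"
  proof (rule killing_eq_span[where js = "[vector [1, 1, 0, 0, 0, 1], vector [0, 0, 0, 1, 0, 0], vector [0, 0, 0, 1, 1, 0], vector [1, 1, 0, 0, - 1, 0]]"], goal_cases)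
    case 1
    show ?case
      unfolding assms(1) by (intro list.rel_intros; (rule kfield_jetI, (rule partials_intros)+,
          simp_all add: killing_eqs_simps))
  next
    case (2 u v j1 j2 j3 j4 j5 j6)
    have con: "j3 = 0" "j2 = j1"
      using rank_one_constraints[OF 2(1) assms(2)] 2(2) by (simp_all add: jet_def vec6_simps)
    show ?case
      by (rule exI[of _ "[j6, j4 - (j5 + (j1 - j6)), j5 + (j1 - j6), j1 - j6]"])
         (simp only: span_coefficient_simps, simp add: con vec6_simps field_simps)
  qed
  then show ?thesis by (simp add: vf2_def XX_def D1_def D2_def)
qed

text \<open>For \<open>T = 0\<close> all models \<open>N6_i\<close> are flat and torsion free, so
  every 1-jet belongs to a Killing field. Here and in the next six lemmas the six jets form a basis
  of the jet space, and the coefficient list inverts it.\<close>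

lemma killing_N6_0:
  shows "killing (N6_0 0 0) = span {D1, D2, vf (\<lambda>x y. (x, 0)), vf (\<lambda>x y. (0, x)), vf (\<lambda>x y. (y, 0)), vf (\<lambda>x y. (0, y))}"
proof -
  have "killing (model 0 0 0 0 0 0 0 0) = span (vf2 ` set
      [(\<lambda>x y. 1, \<lambda>x y. 0), (\<lambda>x y. 0, \<lambda>x y. 1), (\<lambda>x y. x, \<lambda>x y. 0), (\<lambda>x y. 0, \<lambda>x y. x), (\<lambda>x y. y, \<lambda>x y. 0), (\<lambda>x y. 0, \<lambda>x y. y)])"
  proof (rule killing_eq_span[where js = "[vector [1, 0, 0, 0, 0, 0], vector [0, 0, 0, 1, 0, 0], vector [1, 1, 0, 0, 0, 0], vector [0, 0, 0, 1, 1, 0], vector [0, 0, 1, 0, 0, 0], vector [0, 0, 0, 0, 0, 1]]"], goal_cases)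
    case 1
    show ?case
      by (intro list.rel_intros; (rule kfield_jetI, (rule partials_intros)+,
          simp_all add: killing_eqs_simps))
  next
    case (2 u v j1 j2 j3 j4 j5 j6)
    show ?case
      by (rule exI[of _ "[j1 - j2, j4 - j5, j2, j5, j3, j6]"])
         (simp only: span_coefficient_simps, simp add: vec6_simps field_simps)
  qed
  then show ?thesis by (simp add: models_as_model vf2_def XX_def D1_def D2_def)
qed

lemma killing_N6_1:
  assumes "s = 1 \<or> s = - 1"
  shows "killing (N6_1 s 0 0) = span {XX, D2, vf (\<lambda>x y. (1 / x, 0)), vf (\<lambda>x y. (y / x, 0)), vf (\<lambda>x y. ((x^2 + s * y^2) / x, 0)), vf (\<lambda>x y. (- y * (y^2 + s * x^2) / x, x^2 + s * y^2))}"
proof -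
  have "killing (model 1 0 0 0 s 0 0 0) = span (vf2 ` set
      [(\<lambda>x y. x, \<lambda>x y. y), (\<lambda>x y. 0, \<lambda>x y. 1), (\<lambda>x y. 1 / x, \<lambda>x y. 0), (\<lambda>x y. y / x, \<lambda>x y. 0), (\<lambda>x y. (x^2 + s * y^2) / x, \<lambda>x y. 0), (\<lambda>x y. - y * (y^2 + s * x^2) / x, \<lambda>x y. x^2 + s * y^2)])"
  proof (rule killing_eq_span[where js = "[vector [1, 1, 0, 0, 0, 1], vector [0, 0, 0, 1, 0, 0], vector [1, - 1, 0, 0, 0, 0], vector [0, 0, 1, 0, 0, 0], vector [1, 1, 0, 0, 0, 0], vector [0, 0, - s, 1, 2, 0]]"], goal_cases)
    case 1
    show ?case
      by (intro list.rel_intros; (rule kfield_jetI, (rule partials_intros)+,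
          (use assms in \<open>auto simp: killing_eqs_simps\<close>)+))
  next
    case (2 u v j1 j2 j3 j4 j5 j6)
    show ?case
      by (rule exI[of _ "[j6, j4 - j5 / 2, (j1 - j2) / 2, j3 + s * j5 / 2, (j1 + j2) / 2 - j6, j5 / 2]"])
         (simp only: span_coefficient_simps, insert assms, elim disjE; simp add: vec6_simps field_simps)
  qed
  then show ?thesis by (simp add: models_as_model vf2_def XX_def D1_def D2_def)
qed

lemma killing_N6_2:
  assumes "c \<noteq> 0"
  shows "killing (N6_2 c 0 0) = span {vf (\<lambda>x y. (x, 0)), vf (\<lambda>x y. (0, y)), D2, vf (\<lambda>x y. (0, x powr (- c))), vf (\<lambda>x y. (x powr (- c) * x, x powr (- c) * (- c * y))), vf (\<lambda>x y. (y * x, y * (- c * y)))}"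
proof -
  have "killing (model (c - 1) 0 0 c 0 0 0 0) = span (vf2 ` set
      [(\<lambda>x y. x, \<lambda>x y. 0), (\<lambda>x y. 0, \<lambda>x y. y), (\<lambda>x y. 0, \<lambda>x y. 1), (\<lambda>x y. 0, \<lambda>x y. x powr (- c)), (\<lambda>x y. x powr (- c) * x, \<lambda>x y. x powr (- c) * (- c * y)), (\<lambda>x y. y * x, \<lambda>x y. y * (- c * y))])"
  proof (rule killing_eq_span[where js = "[vector [1, 1, 0, 0, 0, 0], vector [0, 0, 0, 0, 0, 1], vector [0, 0, 0, 1, 0, 0], vector [0, 0, 0, 1, - c, 0], vector [1, 1 - c, 0, 0, 0, - c], vector [0, 0, 1, 0, 0, 0]]"], goal_cases)
    case 1
    show ?case
      by (intro list.rel_intros; (rule kfield_jetI, (rule partials_intros)+,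
          simp_all add: killing_eqs_simps))
  next
    case (2 u v j1 j2 j3 j4 j5 j6)
    show ?case
      by (rule exI[of _ "[j1 - (j1 - j2) / c, j6 + (j1 - j2), j4 + j5 / c, - j5 / c, (j1 - j2) / c, j3]"])
         (simp only: span_coefficient_simps, insert assms, simp add: vec6_simps field_simps)
  qed
  then show ?thesis by (simp add: models_as_model vf2_def XX_def D1_def D2_def)
qed

lemma killing_N6_3:
  shows "killing (N6_3 0 0) = span {XX, D2, vf (\<lambda>x y. (0, x)), vf (\<lambda>x y. (0, y + x * ln x)), vf (\<lambda>x y. (- (x^2), x * (x - y))), vf (\<lambda>x y. ((y + x * ln x) * (- x), (y + x * ln x) * (x - y)))}"
proof -
  have "killing (model (- 2) 1 0 (- 1) 0 0 0 0) = span (vf2 ` set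
      [(\<lambda>x y. x, \<lambda>x y. y), (\<lambda>x y. 0, \<lambda>x y. 1), (\<lambda>x y. 0, \<lambda>x y. x), (\<lambda>x y. 0, \<lambda>x y. y + x * ln x), (\<lambda>x y. - (x^2), \<lambda>x y. x * (x - y)), (\<lambda>x y. (y + x * ln x) * (- x), \<lambda>x y. (y + x * ln x) * (x - y))])"
  proof (rule killing_eq_span[where js = "[vector [1, 1, 0, 0, 0, 1], vector [0, 0, 0, 1, 0, 0], vector [0, 0, 0, 1, 1, 0], vector [0, 0, 0, 0, 1, 1], vector [- 1, - 2, 0, 1, 2, - 1], vector [0, - 1, - 1, 0, 1, 1]]"], goal_cases)
    case 1
    show ?case
      by (intro list.rel_intros; (rule kfield_jetI, (rule partials_intros)+,
          simp_all add: killing_eqs_simps))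
  next
    case (2 u v j1 j2 j3 j4 j5 j6)
    show ?case
      by (rule exI[of _ "[2 * j1 - j2 + j3, j4 - j5 + j6 - j2 + j3, j5 - j6 - j1 + 2 * j2 - 2 * j3, j6 - j1 + j3, j1 - j2 + j3, - j3]"])
         (simp only: span_coefficient_simps, simp add: vec6_simps field_simps)
  qed
  then show ?thesis by (simp add: models_as_model vf2_def XX_def D1_def D2_def)
qed

lemma killing_N6_4:
  shows "killing (N6_4 0 0) = span {XX, D2, vf (\<lambda>x y. (0, x)), vf (\<lambda>x y. (0, y + x * ln x)), vf (\<lambda>x y. (1, - (1 + ln x))), vf (\<lambda>x y. (y + x * ln x, (y + x * ln x) * (- (1 + ln x))))}"
proof -
  have "killing (model 0 1 0 0 0 0 0 0) = span (vf2 ` set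
      [(\<lambda>x y. x, \<lambda>x y. y), (\<lambda>x y. 0, \<lambda>x y. 1), (\<lambda>x y. 0, \<lambda>x y. x), (\<lambda>x y. 0, \<lambda>x y. y + x * ln x), (\<lambda>x y. 1, \<lambda>x y. - (1 + ln x)), (\<lambda>x y. y + x * ln x, \<lambda>x y. (y + x * ln x) * (- (1 + ln x)))])"
  proof (rule killing_eq_span[where js = "[vector [1, 1, 0, 0, 0, 1], vector [0, 0, 0, 1, 0, 0], vector [0, 0, 0, 1, 1, 0], vector [0, 0, 0, 0, 1, 1], vector [1, 0, 0, - 1, - 1, 0], vector [0, 1, 1, 0, - 1, - 1]]"], goal_cases)
    case 1
    show ?case
      by (intro list.rel_intros; (rule kfield_jetI, (rule partials_intros)+,
          simp_all add: killing_eqs_simps))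
  next
    case (2 u v j1 j2 j3 j4 j5 j6)
    show ?case
      by (rule exI[of _ "[j2 - j3, j4 - j5 + j6 - j2 + j3, j5 - j6 + j1, j6 - j2 + 2 * j3, j1 - j2 + j3, j3]"])
         (simp only: span_coefficient_simps, simp add: vec6_simps field_simps)
  qed
  then show ?thesis by (simp add: models_as_model vf2_def XX_def D1_def D2_def)
qed

lemma killing_N6_5:
  shows "killing (N6_5 0 0) = span {XX, D2, vf (\<lambda>x y. (0, y)), vf (\<lambda>x y. (x * y, 0)), vf (\<lambda>x y. (0, ln x)), vf (\<lambda>x y. (x * ln x, 0))}"
proof -
  have "killing (model (- 1) 0 0 0 0 0 0 0) = span (vf2 ` set
      [(\<lambda>x y. x, \<lambda>x y. y), (\<lambda>x y. 0, \<lambda>x y. 1), (\<lambda>x y. 0, \<lambda>x y. y), (\<lambda>x y. x * y, \<lambda>x y. 0), (\<lambda>x y. 0, \<lambda>x y. ln x), (\<lambda>x y. x * ln x, \<lambda>x y. 0)])"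
  proof (rule killing_eq_span[where js = "[vector [1, 1, 0, 0, 0, 1], vector [0, 0, 0, 1, 0, 0], vector [0, 0, 0, 0, 0, 1], vector [0, 0, 1, 0, 0, 0], vector [0, 0, 0, 0, 1, 0], vector [0, 1, 0, 0, 0, 0]]"], goal_cases)
    case 1
    show ?case
      by (intro list.rel_intros; (rule kfield_jetI, (rule partials_intros)+,
          simp_all add: killing_eqs_simps))
  next
    case (2 u v j1 j2 j3 j4 j5 j6)
    show ?case
      by (rule exI[of _ "[j1, j4, j6 - j1, j3, j5, j2 - j1]"])
         (simp only: span_coefficient_simps, simp add: vec6_simps field_simps)
  qed
  then show ?thesis by (simp add: models_as_model vf2_def XX_def D1_def D2_def)
qed

lemma killing_N6_6:
  assumes "c + 1 \<noteq> 0"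
  shows "killing (N6_6 c 0 0) = span {XX, D2, vf (\<lambda>x y. (0, y)), vf (\<lambda>x y. (x powr (- c), 0)), vf (\<lambda>x y. (x powr (- c) * y, 0)), vf (\<lambda>x y. (0, x powr (c + 1)))}"
proof -
  have "killing (model c 0 0 0 0 0 0 0) = span (vf2 ` set
      [(\<lambda>x y. x, \<lambda>x y. y), (\<lambda>x y. 0, \<lambda>x y. 1), (\<lambda>x y. 0, \<lambda>x y. y), (\<lambda>x y. x powr (- c), \<lambda>x y. 0), (\<lambda>x y. x powr (- c) * y, \<lambda>x y. 0), (\<lambda>x y. 0, \<lambda>x y. x powr (c + 1))])"
  proof (rule killing_eq_span[where js = "[vector [1, 1, 0, 0, 0, 1], vector [0, 0, 0, 1, 0, 0], vector [0, 0, 0, 0, 0, 1], vector [1, - c, 0, 0, 0, 0], vector [0, 0, 1, 0, 0, 0], vector [0, 0, 0, 1, c + 1, 0]]"], goal_cases)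
    case 1
    show ?case
      by (intro list.rel_intros; (rule kfield_jetI, (rule partials_intros)+,
          simp_all add: killing_eqs_simps))
  next
    case (2 u v j1 j2 j3 j4 j5 j6)
    \<comment> \<open>The coefficients of the fourth and sixth generators; expressing
      \<open>j2\<close> and \<open>j5\<close> through them keeps the final check polynomial.\<close>
    define p q where "p = (j1 - j2) / (c + 1)" and "q = j5 / (c + 1)"
    have con: "j2 = j1 - p * (c + 1)" "j5 = q * (c + 1)" using assms by (simp_all add: p_def q_def)
    show ?case
      by (rule exI[of _ "[j1 - p, j4 - q, j6 - (j1 - p), p, j3, q]"])
         (simp only: span_coefficient_simps, simp add: con vec6_simps field_simps)
  qed
  then show ?thesis by (simp add: models_as_model vf2_def XX_def D1_def D2_def)
qed

text \<open>From \<open>vx = 0\<close> follows \<open>vxy = 0\<close>, and then differentiating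
  \<open>u = x vy\<close> in x gives \<open>ux = vy\<close>. The jet depends on \<open>uy\<close>,
  \<open>v\<close> and \<open>vy\<close> alone, so the dimension is at most three.\<close>

lemma quadratic_constraints:
  assumes k: "kfield A B C D E F S T u v"
    and c: "\<And>x y. 0 < x \<Longrightarrow> u x y = x * Dy v x y" "\<And>x y. 0 < x \<Longrightarrow> Dx v x y = 0"
  shows "u 1 0 = Dy v 1 0" "Dx u 1 0 = Dy v 1 0" "Dx v 1 0 = 0"
proof -
  have S: "smooth2 u" "smooth2 v" using kfield_smooth2[OF k] by auto
  have "Dx (Dy v) 1 0 = Dy (Dx v) 1 0" by (rule Dx_Dy_commute[OF S(2)]) simp
  also have "\<dots> = Dy (\<lambda>x y. 0) 1 0" by (rule Dy_cong[OF partials_smooth2[OF partials_const]]) (simp_all add: c)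
  also have "\<dots> = 0" by (simp add: partials_Dx_Dy[OF partials_const])
  finally have vxy: "Dx (Dy v) 1 0 = 0" .
  have "((\<lambda>x. x * Dy v x 0) has_real_derivative Dy v 1 0) (at 1)"
    using smooth2_dx[OF smooth2_Dy[OF S(2)], of 1 0] vxy by (auto intro!: derivative_eq_intros)
  from DERIV_unique_pos[OF smooth2_dx[OF S(1) zero_less_one] this] c(1) show "Dx u 1 0 = Dy v 1 0" by simp
qed (use c[of 1 0] in simp_all)

lemma killing_N6_2_half:
  assumes "S \<noteq> 0"
  shows "killing (N6_2 (- 1/2) S 0) = span {XX, D2, vf (\<lambda>x y. (y * x, y * (1/2 * y)))}"
proof -
  have "killing (model (- 3/2) 0 0 (- 1/2) 0 0 S 0) = span (vf2 ` set
      [(\<lambda>x y. x, \<lambda>x y. y), (\<lambda>x y. 0, \<lambda>x y. 1), (\<lambda>x y. y * x, \<lambda>x y. y * (1/2 * y))])"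
  proof (rule killing_eq_span[where js = "[vector [1, 1, 0, 0, 0, 1], vector [0, 0, 0, 1, 0, 0], vector [0, 0, 1, 0, 0, 0]]"], goal_cases)
    case 1
    show ?case
      by (intro list.rel_intros; (rule kfield_jetI, (rule partials_intros)+,
          simp_all add: killing_eqs_simps))
  next
    case (2 u v j1 j2 j3 j4 j5 j6)
    \<comment> \<open>For torsion \<open>(S, 0)\<close> with \<open>S \<noteq> 0\<close> the two
      torsion equations are exactly these conditions.\<close>
    have "u x y = x * Dy v x y \<and> Dx v x y = 0" if "0 < x" for x y
      using killing_eqsD[OF 2(1) that, of y] assms that by (simp add: killing_eqs_def)
    then have con: "j1 = j6" "j2 = j6" "j5 = 0"
      using quadratic_constraints[OF 2(1)] 2(2) by (simp_all add: jet_def vec6_simps)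
    show ?case
      by (rule exI[of _ "[j6, j4, j3]"])
         (simp only: span_coefficient_simps, simp add: con vec6_simps field_simps)
  qed
  then show ?thesis by (simp add: models_as_model vf2_def XX_def D1_def D2_def)
qed

lemma killing_N3_1:
  assumes "s \<noteq> 0"
  shows "killing (N3_1 s S 0) = span {XX, D2, vf (\<lambda>x y. (y * (2 * x), y * y))}"
proof -
  have "killing (model (- 3/2) 0 0 (- 1/2) (s / 2) 0 S 0) = span (vf2 ` set
      [(\<lambda>x y. x, \<lambda>x y. y), (\<lambda>x y. 0, \<lambda>x y. 1), (\<lambda>x y. y * (2 * x), \<lambda>x y. y * y)])"
  proof (rule killing_eq_span[where js = "[vector [1, 1, 0, 0, 0, 1], vector [0, 0, 0, 1, 0, 0], vector [0, 0, 2, 0, 0, 0]]"], goal_cases)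
    case 1
    show ?case
      by (intro list.rel_intros; (rule kfield_jetI, (rule partials_intros)+,
          simp_all add: killing_eqs_simps))
  next
    case (2 u v j1 j2 j3 j4 j5 j6)
    \<comment> \<open>The only nonzero Ricci coefficient is \<open>r22 = - s\<close>, and its
      invariance gives both conditions.\<close>
    have "u x y = x * Dy v x y \<and> Dx v x y = 0" if "0 < x" for x y
      using kfield_ricci(2,4)[OF 2(1) that, of y] that assms by (simp add: field_simps)
    then have con: "j1 = j6" "j2 = j6" "j5 = 0"
      using quadratic_constraints[OF 2(1)] 2(2) by (simp_all add: jet_def vec6_simps)
    show ?case
      by (rule exI[of _ "[j6, j4, j3 / 2]"])
         (simp only: span_coefficient_simps, simp add: con vec6_simps field_simps)
  qed
  then show ?thesis by (simp add: models_as_model vf2_def XX_def D1_def D2_def)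
qed

text \<open>The symmetric part of the Ricci tensor has the single coefficient
  \<open>1 - 2 E\<close>, which may vanish; the antisymmetric part has coefficient 3/2 for every
  \<open>E\<close>. Its invariance says that the flow preserves the area form
  \<open>dx dy / x^2\<close>. Differentiating this and inserting the second-order system yields the
  two conditions.\<close>

lemma divergence_constraints:
  assumes k: "kfield (- 3/2) 0 1 (- 1/2) E 2 S 0 u v" and x: "0 < x"
  shows "u x y = x * Dy v x y" "Dx v x y = 0"
proof -
  have S: "smooth2 u" "smooth2 v" using kfield_smooth2[OF k] by auto
  have g: "- 2 * u x y + x * (Dx u x y + Dy v x y) = 0" if "0 < x" for x y
    using kfield_ricci(2,3)[OF k that, of y] by (simp add: field_simps)
  have "((\<lambda>t. - 2 * u t y + t * (Dx u t y + Dy v t y)) has_real_derivative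
      - 2 * Dx u x y + (Dx u x y + Dy v x y) + x * (Dx (Dx u) x y + Dx (Dy v) x y)) (at x)"
    by (auto intro!: derivative_eq_intros smooth2_dx S smooth2_Dx smooth2_Dy x)
  from DERIV_unique_pos[OF this DERIV_const g x]
  have 1: "- 2 * Dx u x y + (Dx u x y + Dy v x y) + x * (Dx (Dx u) x y + Dy (Dx v) x y) = 0"
    using Dx_Dy_commute[OF S(2) x] by simp
  have "((\<lambda>t. - 2 * u x t + x * (Dx u x t + Dy v x t)) has_real_derivative
      - 2 * Dy u x y + x * (Dy (Dx u) x y + Dy (Dy v) x y)) (at y)"
    by (auto intro!: derivative_eq_intros smooth2_dy S smooth2_Dx smooth2_Dy x)
  from zero_has_derivative[OF this g[OF x]]
  have 2: "- 2 * Dy u x y + x * (Dy (Dx u) x y + Dy (Dy v) x y) = 0" .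
  have e: "x\<^sup>2 * Dx (Dx u) x y = - 3/2 * u x y + x * (3/2 * Dx u x y - 2 * Dx v x y)"
    "x\<^sup>2 * Dy (Dx u) x y = u x y - x * (- Dy u x y + Dy v x y + E * Dx v x y)"
    "x\<^sup>2 * Dy (Dx v) x y = - 1/2 * u x y - x * (Dx v x y - 1/2 * Dx u x y)"
    "x\<^sup>2 * Dy (Dy v) x y = 2 * u x y - x * (- Dy u x y - E * Dx v x y + 2 * Dy v x y)"
    using killing_eqsD[OF k x, of y] unfolding killing_eqs_def by (simp_all add: algebra_simps)
  have "x * Dx v x y = 0" using 1 e(1,3) g[OF x, of y] by algebra
  then show v: "Dx v x y = 0" using x by simp
  show "u x y = x * Dy v x y" using 2 e(2,4) v by algebra
qed

lemma killing_N3_2: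
  shows "killing (N3_2 c S 0) = span {XX, D2, vf (\<lambda>x y. (y * (2 * x), y * y))}"
proof -
  have "killing (model (- 3/2) 0 1 (- 1/2) c 2 S 0) = span (vf2 ` set
      [(\<lambda>x y. x, \<lambda>x y. y), (\<lambda>x y. 0, \<lambda>x y. 1), (\<lambda>x y. y * (2 * x), \<lambda>x y. y * y)])"
  proof (rule killing_eq_span[where js = "[vector [1, 1, 0, 0, 0, 1], vector [0, 0, 0, 1, 0, 0], vector [0, 0, 2, 0, 0, 0]]"], goal_cases)
    case 1
    show ?case
      by (intro list.rel_intros; (rule kfield_jetI, (rule partials_intros)+,
          simp_all add: killing_eqs_simps))
  next
    case (2 u v j1 j2 j3 j4 j5 j6)
    have "u x y = x * Dy v x y \<and> Dx v x y = 0" if "0 < x" for x y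
      using divergence_constraints[OF 2(1) that] by simp
    then have con: "j1 = j6" "j2 = j6" "j5 = 0"
      using quadratic_constraints[OF 2(1)] 2(2) by (simp_all add: jet_def vec6_simps)
    show ?case
      by (rule exI[of _ "[j6, j4, j3 / 2]"])
         (simp only: span_coefficient_simps, simp add: con vec6_simps field_simps)
  qed
  then show ?thesis by (simp add: models_as_model vf2_def XX_def D1_def D2_def)
qed

text \<open>The Levi-Civita connection of the Lorentzian metric
  \<open>(- dx^2 + dy^2) / x^2\<close>, which is proportional to its Ricci tensor; the constraints
  are the metric Killing equations at the base point.\<close>

lemma killing_N3_3:
  shows "killing (N3_3 0 0) = span {XX, D2, vf (\<lambda>x y. (2 * x * y, y^2 + x^2))}"
proof -
  have "killing (model (- 1) 0 0 (- 1) (- 1) 0 0 0) = span (vf2 ` set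
      [(\<lambda>x y. x, \<lambda>x y. y), (\<lambda>x y. 0, \<lambda>x y. 1), (\<lambda>x y. 2 * x * y, \<lambda>x y. y^2 + x^2)])"
  proof (rule killing_eq_span[where js = "[vector [1, 1, 0, 0, 0, 1], vector [0, 0, 0, 1, 0, 0], vector [0, 0, 2, 1, 2, 0]]"], goal_cases)
    case 1
    show ?case
      by (intro list.rel_intros; (rule kfield_jetI, (rule partials_intros)+,
          simp_all add: killing_eqs_simps))
  next
    case (2 u v j1 j2 j3 j4 j5 j6)
    have con: "j1 = j6" "j2 = j6" "j5 = j3"
      using kfield_ricci[OF 2(1) zero_less_one, of 0] 2(2) by (simp_all add: jet_def vec6_simps)
    show ?case
      by (rule exI[of _ "[j6, j4 - j3 / 2, j3 / 2]"])
         (simp only: span_coefficient_simps, simp add: con vec6_simps field_simps)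
  qed
  then show ?thesis by (simp add: models_as_model vf2_def XX_def D1_def D2_def)
qed

text \<open>As for \<open>N3_3\<close>, with the hyperbolic metric
  \<open>(dx^2 + dy^2) / x^2\<close>.\<close>

lemma killing_N3_4:
  shows "killing (N3_4 0 0) = span {XX, D2, vf (\<lambda>x y. (2 * x * y, y^2 - x^2))}"
proof -
  have "killing (model (- 1) 0 0 (- 1) 1 0 0 0) = span (vf2 ` set
      [(\<lambda>x y. x, \<lambda>x y. y), (\<lambda>x y. 0, \<lambda>x y. 1), (\<lambda>x y. 2 * x * y, \<lambda>x y. y^2 - x^2)])"
  proof (rule killing_eq_span[where js = "[vector [1, 1, 0, 0, 0, 1], vector [0, 0, 0, 1, 0, 0], vector [0, 0, 2, - 1, - 2, 0]]"], goal_cases)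
    case 1
    show ?case
      by (intro list.rel_intros; (rule kfield_jetI, (rule partials_intros)+,
          simp_all add: killing_eqs_simps))
  next
    case (2 u v j1 j2 j3 j4 j5 j6)
    have con: "j1 = j6" "j2 = j6" "j5 = - j3"
      using kfield_ricci[OF 2(1) zero_less_one, of 0] 2(2) by (simp_all add: jet_def vec6_simps)
    show ?case
      by (rule exI[of _ "[j6, j4 + j3 / 2, j3 / 2]"])
         (simp only: span_coefficient_simps, simp add: con vec6_simps field_simps)
  qed
  then show ?thesis by (simp add: models_as_model vf2_def XX_def D1_def D2_def)
qed

section \<open>Linear equivalence\<close>

lemma pd_linear:
  "pd i (\<lambda>q. c * q$1 + d * q$2) = (\<lambda>p. if i = 1 then c else d)"
  "pd i (\<lambda>q. q$1) = (\<lambda>p. if i = 1 then 1 else 0)"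
  "pd i (\<lambda>q. c) = (\<lambda>p. 0)"
proof -
  have D: "((\<lambda>q::real^2. q$k) has_derivative (\<lambda>h. h$k)) (at p)" for k p
    by (rule bounded_linear_imp_has_derivative[OF bounded_linear_vec_nth])
  have "((\<lambda>q::real^2. c * q$1 + d * q$2) has_derivative (\<lambda>h. c * h$1 + d * h$2)) (at p)" for p
    by (auto intro!: derivative_eq_intros D)
  from frechet_derivative_at[OF this, symmetric] have 1: "pd i (\<lambda>q. c * q$1 + d * q$2) p = c * (axis i 1 :: real^2)$1 + d * (axis i 1 :: real^2)$2" for p
    by (simp add: pd_def)
  show "pd i (\<lambda>q. c * q$1 + d * q$2) = (\<lambda>p. if i = 1 then c else d)"
    unfolding fun_eq_iff 1 using exhaust_2[of i] by (auto simp: axis_def)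
  show "pd i (\<lambda>q. q$1) = (\<lambda>p. if i = 1 then 1 else 0)"
    unfolding fun_eq_iff using frechet_derivative_at[OF D, symmetric] by (simp add: pd_def axis_def)
  show "pd i (\<lambda>q. c) = (\<lambda>p. 0)"
    unfolding fun_eq_iff by (simp add: pd_def)
qed

text \<open>The coordinate change is linear and fixes x, so the Hessian term vanishes and the common
  factor \<open>1 / x\<close> drops out; the transformation law splits into equations for the
  symmetric part and for the torsion.\<close>

lemma linearly_equivalent_modelI:
  assumes "a \<noteq> 0" "A = A' + 2 * b * C' + b\<^sup>2 * E'" "b * A + a * B = B' + 2 * b * D' + b\<^sup>2 * F'"
    "C = a * (C' + b * E')" "b * C + a * D = a * (D' + b * F')" "S = a * S'" "b * S + a * T = a * T'"
    "E = a\<^sup>2 * E'" "b * E + a * F = a\<^sup>2 * F'"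
  shows "linearly_equivalent (model A B C D E F S T) (model A' B' C' D' E' F' S' T')"
  unfolding linearly_equivalent_def transforms_connection_def
proof (rule exI[of _ a], rule exI[of _ b], intro conjI ballI)
  fix p :: "real^2" assume "p \<in> half_plane"
  define r where "r = inverse (p$1)"
  have e: "A * r = A' * r + 2 * b * (C' * r) + b\<^sup>2 * (E' * r)" "b * (A * r) + a * (B * r) = B' * r + 2 * b * (D' * r) + b\<^sup>2 * (F' * r)"
    "C * r = a * (C' * r + b * (E' * r))" "b * (C * r) + a * (D * r) = a * (D' * r + b * (F' * r))"
    "S * r = a * (S' * r)" "b * (S * r) + a * (T * r) = a * (T' * r)"
    "E * r = a\<^sup>2 * (E' * r)" "b * (E * r) + a * (F * r) = a\<^sup>2 * (F' * r)"
    using assms(2-9) by algebra+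
  show "\<forall>i j l. pd i (pd j (\<lambda>q. vector [q$1, b * q$1 + a * q$2] $ l)) p
      + (\<Sum>m\<in>UNIV. \<Sum>n\<in>UNIV. pd i (\<lambda>q. vector [q$1, b * q$1 + a * q$2] $ m) p
          * pd j (\<lambda>q. vector [q$1, b * q$1 + a * q$2] $ n) p
          * christoffel (model A' B' C' D' E' F' S' T') (vector [p$1, b * p$1 + a * p$2]) m n l)
      = (\<Sum>k\<in>UNIV. christoffel (model A B C D E F S T) p i j k * pd k (\<lambda>q. vector [q$1, b * q$1 + a * q$2] $ l) p)"
    using e by (simp add: forall_2 sum_2 pd_linear christoffel_def model_def vector_8 divide_inverse
      r_def[symmetric] algebra_simps power2_eq_square) auto
qed (rule assms(1))

section \<open>Normal forms under shears and scalings of y\<close>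

definition listed :: "real^8 \<Rightarrow> bool" where
  "listed \<xi> \<longleftrightarrow>
         (\<exists>t2. linearly_equivalent \<xi> (N6_0 0 t2))
    \<or> (\<exists>s\<in>{1, - 1}. linearly_equivalent \<xi> (N6_1 s 0 0))
    \<or> (\<exists>c t1 t2. c \<noteq> 0 \<and> (t1 = 0 \<or> c = - 1/2 \<and> t2 = 0) \<and> linearly_equivalent \<xi> (N6_2 c t1 t2))
    \<or> (\<exists>t2. linearly_equivalent \<xi> (N6_3 0 t2))
    \<or> (\<exists>t2. linearly_equivalent \<xi> (N6_4 0 t2))
    \<or> (\<exists>t2. linearly_equivalent \<xi> (N6_5 0 t2))
    \<or> (\<exists>c t2. c \<noteq> 0 \<and> c \<noteq> - 1 \<and> linearly_equivalent \<xi> (N6_6 c 0 t2))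
    \<or> (\<exists>\<kappa> t2. \<kappa> \<noteq> 0 \<and> \<kappa> \<noteq> - 1 \<and> linearly_equivalent \<xi> (N4_1 \<kappa> 0 t2))
    \<or> (\<exists>\<kappa> \<theta> t2. \<theta> \<noteq> 0 \<and> \<kappa> * (\<kappa> + \<theta>) \<noteq> 0 \<and> linearly_equivalent \<xi> (N4_2 \<kappa> \<theta> 0 t2))
    \<or> (\<exists>c t2. c \<noteq> 0 \<and> linearly_equivalent \<xi> (N4_3 c 0 t2))
    \<or> (\<exists>s\<in>{1, - 1}. \<exists>t1. linearly_equivalent \<xi> (N3_1 s t1 0))
    \<or> (\<exists>c t1. linearly_equivalent \<xi> (N3_2 c t1 0))
    \<or> linearly_equivalent \<xi> (N3_3 0 0)
    \<or> linearly_equivalent \<xi> (N3_4 0 0)"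

lemma disjI_third: "R \<Longrightarrow> P \<or> Q \<or> R"
  by blast

text \<open>The disjuncts on the parameters of \<open>model\<close>. The last rule joins
  \<open>N3_3\<close> and \<open>N3_4\<close>, the signs \<open>s = - 1\<close> and
  \<open>s = 1\<close> of one formula.\<close>

lemma listedI:
  "linearly_equivalent \<xi> (model 0 0 0 0 0 0 0 t2) \<Longrightarrow> listed \<xi>"
  "s \<in> {1, - 1} \<Longrightarrow> linearly_equivalent \<xi> (model 1 0 0 0 s 0 0 0) \<Longrightarrow> listed \<xi>"
  "c \<noteq> 0 \<Longrightarrow> t1 = 0 \<or> c = - 1/2 \<and> t2 = 0 \<Longrightarrow> linearly_equivalent \<xi> (model (c - 1) 0 0 c 0 0 t1 t2) \<Longrightarrow> listed \<xi>"
  "linearly_equivalent \<xi> (model (- 2) 1 0 (- 1) 0 0 0 t2) \<Longrightarrow> listed \<xi>"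
  "linearly_equivalent \<xi> (model 0 1 0 0 0 0 0 t2) \<Longrightarrow> listed \<xi>"
  "linearly_equivalent \<xi> (model (- 1) 0 0 0 0 0 0 t2) \<Longrightarrow> listed \<xi>"
  "c \<noteq> 0 \<Longrightarrow> c \<noteq> - 1 \<Longrightarrow> linearly_equivalent \<xi> (model c 0 0 0 0 0 0 t2) \<Longrightarrow> listed \<xi>"
  "\<kappa> \<noteq> 0 \<Longrightarrow> \<kappa> \<noteq> - 1 \<Longrightarrow> linearly_equivalent \<xi> (model (2 * \<kappa>) 1 0 \<kappa> 0 0 0 t2) \<Longrightarrow> listed \<xi>"
  "\<theta> \<noteq> 0 \<Longrightarrow> \<kappa> * (\<kappa> + \<theta>) \<noteq> 0 \<Longrightarrow> linearly_equivalent \<xi> (model (\<theta> - 1 + 2 * \<kappa>) 0 0 \<kappa> 0 0 0 t2) \<Longrightarrow> listed \<xi>"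
  "c \<noteq> 0 \<Longrightarrow> linearly_equivalent \<xi> (model (2 * c - 1) 0 0 c 0 0 0 t2) \<Longrightarrow> listed \<xi>"
  "s \<in> {1, - 1} \<Longrightarrow> linearly_equivalent \<xi> (model (- 3/2) 0 0 (- 1/2) (s / 2) 0 t1 0) \<Longrightarrow> listed \<xi>"
  "linearly_equivalent \<xi> (model (- 3/2) 0 1 (- 1/2) c 2 t1 0) \<Longrightarrow> listed \<xi>"
  "s \<in> {1, - 1} \<Longrightarrow> linearly_equivalent \<xi> (model (- 1) 0 0 (- 1) s 0 0 0) \<Longrightarrow> listed \<xi>"
proof -
  show "linearly_equivalent \<xi> (model 0 0 0 0 0 0 0 t2) \<Longrightarrow> listed \<xi>"
    by (unfold listed_def models_as_model, rule disjI1, rule exI[of _ t2], assumption)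
  show "s \<in> {1, - 1} \<Longrightarrow> linearly_equivalent \<xi> (model 1 0 0 0 s 0 0 0) \<Longrightarrow> listed \<xi>"
    by (unfold listed_def models_as_model, rule disjI2, rule disjI1, rule bexI[of _ s], assumption+)
  show "c \<noteq> 0 \<Longrightarrow> t1 = 0 \<or> c = - 1/2 \<and> t2 = 0 \<Longrightarrow> linearly_equivalent \<xi> (model (c - 1) 0 0 c 0 0 t1 t2) \<Longrightarrow> listed \<xi>"
    by (unfold listed_def models_as_model, rule disjI_third, rule disjI1, rule exI[of _ c], rule exI[of _ t1], rule exI[of _ t2], intro conjI; assumption)
  show "linearly_equivalent \<xi> (model (- 2) 1 0 (- 1) 0 0 0 t2) \<Longrightarrow> listed \<xi>"
    by (unfold listed_def models_as_model, rule disjI_third, rule disjI2, rule disjI1, rule exI[of _ t2], assumption)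
  show "linearly_equivalent \<xi> (model 0 1 0 0 0 0 0 t2) \<Longrightarrow> listed \<xi>"
    by (unfold listed_def models_as_model, rule disjI_third, rule disjI_third, rule disjI1, rule exI[of _ t2], assumption)
  show "linearly_equivalent \<xi> (model (- 1) 0 0 0 0 0 0 t2) \<Longrightarrow> listed \<xi>"
    by (unfold listed_def models_as_model, rule disjI_third, rule disjI_third, rule disjI2, rule disjI1, rule exI[of _ t2], assumption)
  show "c \<noteq> 0 \<Longrightarrow> c \<noteq> - 1 \<Longrightarrow> linearly_equivalent \<xi> (model c 0 0 0 0 0 0 t2) \<Longrightarrow> listed \<xi>"
    by (unfold listed_def models_as_model, rule disjI_third, rule disjI_third, rule disjI_third, rule disjI1, rule exI[of _ c], rule exI[of _ t2], intro conjI; assumption)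
  show "\<kappa> \<noteq> 0 \<Longrightarrow> \<kappa> \<noteq> - 1 \<Longrightarrow> linearly_equivalent \<xi> (model (2 * \<kappa>) 1 0 \<kappa> 0 0 0 t2) \<Longrightarrow> listed \<xi>"
    by (unfold listed_def models_as_model, rule disjI_third, rule disjI_third, rule disjI_third, rule disjI2, rule disjI1, rule exI[of _ \<kappa>], rule exI[of _ t2], intro conjI; assumption)
  show "\<theta> \<noteq> 0 \<Longrightarrow> \<kappa> * (\<kappa> + \<theta>) \<noteq> 0 \<Longrightarrow> linearly_equivalent \<xi> (model (\<theta> - 1 + 2 * \<kappa>) 0 0 \<kappa> 0 0 0 t2) \<Longrightarrow> listed \<xi>"
    by (unfold listed_def models_as_model, rule disjI_third, rule disjI_third, rule disjI_third, rule disjI_third, rule disjI1, rule exI[of _ \<kappa>], rule exI[of _ \<theta>], rule exI[of _ t2], intro conjI; assumption)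
  show "c \<noteq> 0 \<Longrightarrow> linearly_equivalent \<xi> (model (2 * c - 1) 0 0 c 0 0 0 t2) \<Longrightarrow> listed \<xi>"
    by (unfold listed_def models_as_model, rule disjI_third, rule disjI_third, rule disjI_third, rule disjI_third, rule disjI2, rule disjI1, rule exI[of _ c], rule exI[of _ t2], intro conjI; assumption)
  show "s \<in> {1, - 1} \<Longrightarrow> linearly_equivalent \<xi> (model (- 3/2) 0 0 (- 1/2) (s / 2) 0 t1 0) \<Longrightarrow> listed \<xi>"
    by (unfold listed_def models_as_model, rule disjI_third, rule disjI_third, rule disjI_third, rule disjI_third, rule disjI_third, rule disjI1, rule bexI[of _ s], rule exI[of _ t1], assumption+)
  show "linearly_equivalent \<xi> (model (- 3/2) 0 1 (- 1/2) c 2 t1 0) \<Longrightarrow> listed \<xi>"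
    by (unfold listed_def models_as_model, rule disjI_third, rule disjI_third, rule disjI_third, rule disjI_third, rule disjI_third, rule disjI2, rule disjI1, rule exI[of _ c], rule exI[of _ t1], assumption)
  assume s: "s \<in> {1, - 1}" and l: "linearly_equivalent \<xi> (model (- 1) 0 0 (- 1) s 0 0 0)"
  from s consider "s = 1" | "s = - 1" by blast
  then show "listed \<xi>"
  proof cases
    case 1
    show ?thesis by (insert l[unfolded 1], unfold listed_def models_as_model, (rule disjI2)+, assumption)
  next
    case 2
    show ?thesis by (insert l[unfolded 2], unfold listed_def models_as_model, rule disjI_third, rule disjI_third, rule disjI_third, rule disjI_third, rule disjI_third, rule disjI_third, rule disjI1, assumption)
  qed
qed

text \<open>A shear by \<open>b\<close> changes \<open>B\<close> by a multiple of
  \<open>2 D - A\<close>, so \<open>B\<close> can be removed unless \<open>A = 2 D\<close>, where a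
  scaling makes a nonzero \<open>B\<close> equal to 1. The Ricci coefficient
  \<open>D * (1 + A - D)\<close> and the exponent \<open>\<theta>\<close> separate the remaining
  cases.\<close>

lemma listed_degenerate: "listed (model A B 0 D 0 0 0 T)"
proof (cases "A = 2 * D \<and> B \<noteq> 0")
  case False
  \<comment> \<open>If \<open>A = 2 * D\<close>, then \<open>B = 0\<close> here and division by zero
    gives \<open>b = 0\<close>, as it should.\<close>
  define b where "b = B / (2 * D - A)"
  have l: "linearly_equivalent (model A B 0 D 0 0 0 T) (model A 0 0 D 0 0 0 T)"
    by (rule linearly_equivalent_modelI[of 1 _ _ b]) (use False in \<open>auto simp: b_def field_simps\<close>)
  show ?thesis
  proof (cases "D = 0")
    case True
    consider "A = 0" | "A = - 1" | "A \<noteq> 0" "A \<noteq> - 1" by blast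
    then show ?thesis
      by cases (use l True in \<open>simp_all add: listedI(1,6,7)\<close>)
  next
    case D: False
    \<comment> \<open>\<open>D * (D + \<theta>)\<close> is the Ricci coefficient:
      \<open>D + \<theta> = 0\<close> is the family \<open>N6_2\<close>, whose symmetric part is
      flat, and \<open>\<theta> = 0\<close> is the logarithmic case.\<close>
    define \<theta> where "\<theta> = A + 1 - 2 * D"
    have A: "A = \<theta> - 1 + 2 * D" by (simp add: \<theta>_def)
    consider "\<theta> = 0" | "D + \<theta> = 0" | "\<theta> \<noteq> 0" "D * (D + \<theta>) \<noteq> 0" using D by auto
    then show ?thesis
    proof cases
      case 1
      then have "A = 2 * D - 1" using A by simp
      with l show ?thesis using listedI(10)[OF D] by simp
    next
      case 2
      then have "A = D - 1" using A by simp
      with l show ?thesis using listedI(3)[OF D, of 0] by simp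
    next
      case 3
      from listedI(9)[OF this, of _ T] l show ?thesis unfolding A by blast
    qed
  qed
next
  case True
  then have A: "A = 2 * D" and B: "B \<noteq> 0" by auto
  have l: "linearly_equivalent (model A B 0 D 0 0 0 T) (model A 1 0 D 0 0 0 T)"
    by (rule linearly_equivalent_modelI[of "1 / B" _ _ 0]) (use B in simp_all)
  \<comment> \<open>For \<open>A = 2 * D\<close> the Ricci coefficient is
    \<open>D * (D + 1)\<close>; its zeros give \<open>N6_4\<close> and \<open>N6_3\<close>.\<close>
  consider "D = 0" | "D = - 1" | "D \<noteq> 0" "D \<noteq> - 1" by blast
  then show ?thesis
    by cases (use l in \<open>simp_all add: A listedI(4,5,8)\<close>)
qed

text \<open>Scaling y changes \<open>E\<close> by the factor of a square, so over the reals only its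
  sign is invariant: the origin of the sign \<open>s\<close>. The factor \<open>k\<close> fits the
  normalisation of the target.\<close>

lemma signed_square:
  assumes "E \<noteq> 0" "0 < k"
  obtains s a :: real where "s \<in> {1, - 1}" "a \<noteq> 0" "E = a\<^sup>2 * (s * k)"
proof (rule that[of "sgn E" "sqrt (\<bar>E\<bar> / k)"])
  show "sgn E \<in> {1, - 1}" using assms by (auto simp: sgn_if)
  show "sqrt (\<bar>E\<bar> / k) \<noteq> 0" using assms by simp
  show "E = (sqrt (\<bar>E\<bar> / k))\<^sup>2 * (sgn E * k)" using assms by (simp add: sgn_if)
qed

lemma listed_projective:
  assumes "E \<noteq> 0" "C = - F" "E * D = - (F\<^sup>2)" "A = 1 - D" "E * B = F * (1 - D)"
  shows "listed (model A B C D E F 0 0)"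
proof -
  obtain s a where s: "s \<in> {1, - 1}" "a \<noteq> 0" "E = a\<^sup>2 * (s * 1)"
    by (rule signed_square[OF assms(1) zero_less_one])
  \<comment> \<open>The slope of the shear that makes the new \<open>F\<close> vanish.\<close>
  define r where "r = F / E"
  have F: "F = r * E" using assms(1) by (simp add: r_def)
  have D: "D = - (r\<^sup>2 * E)" using assms(1,3) F by algebra
  have B: "B = r * (1 - D)" using assms(1,5) F by algebra
  have "linearly_equivalent (model A B C D E F 0 0) (model 1 0 0 0 s 0 0 0)"
    by (rule linearly_equivalent_modelI[of a _ _ "- (a * r)"])
       (use s(2) in \<open>simp_all add: assms(2,4) B D F, simp_all add: s(3) algebra_simps power2_eq_square\<close>)
  then show ?thesis by (rule listedI(2)[OF s(1)])
qed

text \<open>The Killing field has d/dx component \<open>x (y + p x)\<close>. With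
  \<open>y + p x\<close> as new coordinate y it becomes
  \<open>x y d/dx + (y^2 + (q + p^2) x^2) / 2 d/dy\<close>; this is the origin of the shear
  \<open>a * p\<close> and of the quantity \<open>q + p^2\<close>.\<close>

lemma listed_quadratic:
  assumes "quadratic_killing A B C D E F S T"
  shows "listed (model A B C D E F S T)"
proof -
  obtain p q where e: "p * (2 + A) - B + 2 * C * q = 0" "q * (1 - A + 2 * D) + 3 * p * B = 0"
    "1 + A - D + E * q = C * p" "D * p + (F - C) * q + B = 0"
    "3 * E * p = 2 * C - F" "1 + 2 * D = F * p + E * q" "S * p = - T" "T * p = S * q"
    using assms unfolding quadratic_killing_def by blast
  have T: "T = - (S * p)" using e(7) by simp
  show ?thesis
  proof (cases "C + F = 0")
    case False
    \<comment> \<open>\<open>C + F\<close> is unchanged by shears and scales with \<open>a\<close>;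
      in the target it is 3.\<close>
    define a where "a = (C + F) / 3"
    define c where "c = E / a\<^sup>2"
    have a: "a \<noteq> 0" "C + F = 3 * a" using False by (auto simp: a_def)
    have E: "E = a\<^sup>2 * c" using a by (simp add: c_def)
    have C: "C = a + E * p" and F: "F = 2 * a - E * p" using e(5) a(2) by linarith+
    have "(C + F) * (p\<^sup>2 + q) = 0" using e(1,3,4,6) by algebra
    then have q: "q = - (p\<^sup>2)" using False by simp
    have D: "D = a * p - E * p\<^sup>2 - 1/2" using e(6) F q by (simp add: algebra_simps power2_eq_square)
    have A: "A = 2 * a * p + E * p\<^sup>2 - 3/2" using e(3) C D q by (simp add: algebra_simps power2_eq_square)
    have B: "B = p / 2 - E * p\<^sup>2 * p" using e(1) A C q by (simp add: algebra_simps power2_eq_square)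
    have "linearly_equivalent (model A B C D E F S T) (model (- 3/2) 0 1 (- 1/2) c 2 (S / a) 0)"
      by (rule linearly_equivalent_modelI[of a _ _ "a * p"])
         (use a(1) in \<open>simp_all add: A B C D F T, simp_all add: E algebra_simps power2_eq_square\<close>)
    then show ?thesis by (rule listedI(12))
  next
    case True
    have C: "C = E * p" and F: "F = - (E * p)" using e(5) True by linarith+
    show ?thesis
    proof (cases "E = 0")
      case False
      \<comment> \<open>\<open>d\<close> is the parameter \<open>D\<close> after the shear, and
        \<open>r\<close> the remaining coefficient of the sheared field.\<close>
      define d where "d = D + E * p\<^sup>2"
      define r where "r = q + p\<^sup>2"
      have q: "q = r - p\<^sup>2" by (simp add: r_def)
      have D: "D = d - E * p\<^sup>2" by (simp add: d_def)
      have Er: "E * r = 1 + 2 * d" using e(6) unfolding F D q by (simp add: algebra_simps power2_eq_square)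
      have A: "A = - 2 - d + E * p\<^sup>2" using e(3) Er unfolding C D q by (simp add: algebra_simps power2_eq_square)
      have B: "B = p * (2 + 3 * d) - E * p\<^sup>2 * p" using e(4) Er unfolding C D F q by algebra
      have rd: "r * (1 + d) = 0" using e(2) Er unfolding A B D q by algebra
      have Sr: "S * r = 0" using e(8) T unfolding q by algebra
      \<comment> \<open>By \<open>E * r = 1 + 2 * d\<close>, the case \<open>r = 0\<close> gives
        \<open>d = - 1/2\<close>; otherwise \<open>d = - 1\<close>.\<close>
      consider "d = - 1/2" | "d = - 1"
        using rd Er by (cases "r = 0") auto
      then show ?thesis
      proof cases
        case 1
        obtain s a where s: "s \<in> {1, - 1}" "a \<noteq> 0" "E = a\<^sup>2 * (s * (1/2))"
          by (rule signed_square[OF False, of "1/2"]) auto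
        have "linearly_equivalent (model A B C D E F S T) (model (- 3/2) 0 0 (- 1/2) (s / 2) 0 (S / a) 0)"
          by (rule linearly_equivalent_modelI[of a _ _ "a * p"])
             (use s(2) in \<open>simp_all add: A B C D F T 1, simp_all add: s(3) algebra_simps power2_eq_square\<close>)
        then show ?thesis by (rule listedI(11)[OF s(1)])
      next
        case 2
        obtain s a where s: "s \<in> {1, - 1}" "a \<noteq> 0" "E = a\<^sup>2 * (s * 1)"
          by (rule signed_square[OF False zero_less_one])
        \<comment> \<open>Here \<open>E * r = - 1\<close>, so \<open>r\<close> is nonzero and
          \<open>S * r = 0\<close> excludes torsion.\<close>
        have S: "S = 0" using Sr Er 2 by auto
        have "linearly_equivalent (model A B C D E F S T) (model (- 1) 0 0 (- 1) s 0 0 0)"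
          by (rule linearly_equivalent_modelI[of a _ _ "a * p"])
             (use s(2) in \<open>simp_all add: A B C D F T S 2, simp_all add: s(3) algebra_simps power2_eq_square\<close>)
        then show ?thesis by (rule listedI(13)[OF s(1)])
      qed
    next
      case E: True
      have D: "D = - 1/2" using e(6) unfolding F E by simp
      have A: "A = - 3/2" using e(3) unfolding C E D by simp
      have B: "B = p / 2" using e(4) unfolding C F E D by simp
      have "linearly_equivalent (model A B C D E F S T) (model (- 1/2 - 1) 0 0 (- 1/2) 0 0 S 0)"
        by (rule linearly_equivalent_modelI[of 1 _ _ p]) (simp_all add: A B C D F T E)
      from listedI(3)[OF _ _ this] show ?thesis by simp
    qed
  qed
qed

lemma dim_killing_gt_2: "2 < dim (killing \<xi>) \<Longrightarrow> killing \<xi> \<noteq> span {XX, D2}"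
  using dim_span_XX_D2 by auto

lemma listed_if_dim_gt_2:
  assumes "2 < dim (killing \<xi>)"
  shows "listed \<xi>"
proof -
  obtain A B C D E F S T where x: "\<xi> = model A B C D E F S T" using ex_model by blast
  have "killing (model A B C D E F S T) \<noteq> span {XX, D2}" using dim_killing_gt_2[OF assms] x by simp
  then consider "C = 0 \<and> E = 0 \<and> F = 0 \<and> S = 0"
    | "E \<noteq> 0 \<and> C = - F \<and> E * D = - (F\<^sup>2) \<and> A = 1 - D \<and> E * B = F * (1 - D) \<and> S = 0 \<and> T = 0"
    | "quadratic_killing A B C D E F S T"
    using killing_eq_span_XX_D2[of C E F S D A B T] by blast
  then show ?thesis unfolding x
  proof cases
    case 1 then show "listed (model A B C D E F S T)" using listed_degenerate by simp
  next
    case 2 then show "listed (model A B C D E F S T)" using listed_projective by blast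
  next
    case 3 then show "listed (model A B C D E F S T)" by (rule listed_quadratic)
  qed
qed

section \<open>The listed models for all torsion values\<close>

lemma killing_N6_0_models:
  shows "killing (N6_0 0 0) = span {D1, D2, vf (\<lambda>x y. (x, 0)), vf (\<lambda>x y. (0, x)),
    vf (\<lambda>x y. (y, 0)), vf (\<lambda>x y. (0, y))}
    \<and> (\<forall>T2. T2 \<noteq> 0 \<longrightarrow>
    killing (N6_0 0 T2) = span {XX, D2, vf (\<lambda>x y. (0, x)), vf (\<lambda>x y. (0, y))})
    \<and> (\<forall>T1 T2. T1 \<noteq> 0 \<longrightarrow> killing (N6_0 T1 T2) = span {XX, D2})"
proof -
  have z: "killing (N6_0 T1 T2) = span {XX, D2}" if "T1 \<noteq> 0" for T1 T2
    unfolding models_as_model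
    by (rule killing_eq_span_XX_D2) (use that in \<open>auto simp: quadratic_killing_def\<close>)
  \<comment> \<open>\<open>N6_0\<close> is the case \<open>\<theta> = 1\<close> of
    \<open>killing_powr\<close>, where the power is \<open>x\<close> itself.\<close>
  have e: "vf (\<lambda>x y. (0, x powr 1)) = vf (\<lambda>x y. (0, x))"
    by (rule vf_cong) simp
  have b: "killing (N6_0 0 T2) = span {XX, D2, vf (\<lambda>x y. (0, x)), vf (\<lambda>x y. (0, y))}" if "T2 \<noteq> 0" for T2
    unfolding models_as_model using killing_powr[of 0 1 0 T2] that e by (simp add: insert_commute)
  show ?thesis using b z dim_killing_gt_2 killing_N6_0 by blast
qed

lemma killing_N6_1_models:
  assumes asm: "s \<in> {1, - 1}"
  shows "(\<forall>T1 T2. dim (killing (N6_1 s T1 T2)) > 2 \<longrightarrow> T1 = 0 \<and> T2 = 0)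
    \<and> killing (N6_1 s 0 0) =
    span {XX, D2, vf (\<lambda>x y. (1 / x, 0)), vf (\<lambda>x y. (y / x, 0)),
    vf (\<lambda>x y. ((x^2 + s * y^2) / x, 0)),
    vf (\<lambda>x y. (- y * (y^2 + s * x^2) / x, x^2 + s * y^2))}
    \<and> (\<forall>T1 T2. \<not> (T1 = 0 \<and> T2 = 0) \<longrightarrow> killing (N6_1 s T1 T2) = span {XX, D2})"
proof -
  have z: "killing (N6_1 s T1 T2) = span {XX, D2}" if "\<not> (T1 = 0 \<and> T2 = 0)" for T1 T2
    unfolding models_as_model
    by (rule killing_eq_span_XX_D2) (use that asm in \<open>auto simp: quadratic_killing_def\<close>)
  show ?thesis using z dim_killing_gt_2 killing_N6_1[of s] asm by blast
qed

lemma killing_N6_2_models: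
  assumes asm: "c \<noteq> 0"
  shows "(\<forall>T1 T2. dim (killing (N6_2 c T1 T2)) > 2 \<longrightarrow> T1 * T2 = 0)
    \<and> killing (N6_2 c 0 0) =
    span {vf (\<lambda>x y. (x, 0)), vf (\<lambda>x y. (0, y)), D2,
    vf (\<lambda>x y. (0, x powr (- c))),
    vf (\<lambda>x y. (x powr (- c) * x, x powr (- c) * (- c * y))),
    vf (\<lambda>x y. (y * x, y * (- c * y)))}
    \<and> (\<forall>T2. T2 \<noteq> 0 \<longrightarrow>
    killing (N6_2 c 0 T2) =
    span {XX, D2, vf (\<lambda>x y. (0, y)), vf (\<lambda>x y. (0, x powr (- c)))})
    \<and> (\<forall>T1. c = - 1/2 \<and> T1 \<noteq> 0 \<longrightarrow>
    killing (N6_2 c T1 0) = span {XX, D2, vf (\<lambda>x y. (y * x, y * (1/2 * y)))})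
    \<and> (\<forall>T1 T2. \<not> (T1 = 0 \<or> c = - 1/2 \<and> T2 = 0) \<longrightarrow>
    killing (N6_2 c T1 T2) = span {XX, D2})"
proof -
  have z: "killing (N6_2 c T1 T2) = span {XX, D2}" if "\<not> (T1 = 0 \<or> c = - 1/2 \<and> T2 = 0)" for T1 T2
    unfolding models_as_model
    by (rule killing_eq_span_XX_D2) (use that asm in \<open>auto simp: quadratic_killing_def\<close>)
  have b: "killing (N6_2 c 0 T2) = span {XX, D2, vf (\<lambda>x y. (0, y)), vf (\<lambda>x y. (0, x powr (- c)))}" if "T2 \<noteq> 0" for T2
    unfolding models_as_model by (rule killing_powr) (use asm that in auto)
  \<comment> \<open>The classification gives the stronger alternative \<open>T1 = 0\<close>, or
    \<open>c = - 1/2\<close> and \<open>T2 = 0\<close>; the product condition follows from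
    it.\<close>
  have dm: "T1 * T2 = 0" if "2 < dim (killing (N6_2 c T1 T2))" for T1 T2
    using z[of T1 T2] dim_killing_gt_2[OF that] by auto
  show ?thesis using b dm z dim_killing_gt_2 killing_N6_2[OF asm] killing_N6_2_half by blast
qed

lemma killing_N6_3_models:
  shows "(\<forall>T1 T2. dim (killing (N6_3 T1 T2)) > 2 \<longrightarrow> T1 = 0)
    \<and> killing (N6_3 0 0) =
    span {XX, D2, vf (\<lambda>x y. (0, x)), vf (\<lambda>x y. (0, y + x * ln x)),
    vf (\<lambda>x y. (- (x^2), x * (x - y))),
    vf (\<lambda>x y. ((y + x * ln x) * (- x), (y + x * ln x) * (x - y)))}
    \<and> (\<forall>T2. T2 \<noteq> 0 \<longrightarrow>
    killing (N6_3 0 T2) =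
    span {XX, D2, vf (\<lambda>x y. (0, x)), vf (\<lambda>x y. (0, y + x * ln x))})
    \<and> (\<forall>T1 T2. T1 \<noteq> 0 \<longrightarrow> killing (N6_3 T1 T2) = span {XX, D2})"
proof -
  have z: "killing (N6_3 T1 T2) = span {XX, D2}" if "T1 \<noteq> 0" for T1 T2
    unfolding models_as_model
    by (rule killing_eq_span_XX_D2) (use that in \<open>auto simp: quadratic_killing_def\<close>)
  have b: "killing (N6_3 0 T2) = span {XX, D2, vf (\<lambda>x y. (0, x)), vf (\<lambda>x y. (0, y + x * ln x))}" if "T2 \<noteq> 0" for T2
    unfolding models_as_model by (rule killing_xlnx) (use that in auto)
  show ?thesis using b z dim_killing_gt_2 killing_N6_3 by blast
qed

lemma killing_N6_4_models:
  shows "(\<forall>T1 T2. dim (killing (N6_4 T1 T2)) > 2 \<longrightarrow> T1 = 0)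
    \<and> killing (N6_4 0 0) =
    span {XX, D2, vf (\<lambda>x y. (0, x)), vf (\<lambda>x y. (0, y + x * ln x)),
    vf (\<lambda>x y. (1, - (1 + ln x))),
    vf (\<lambda>x y. (y + x * ln x, (y + x * ln x) * (- (1 + ln x))))}
    \<and> (\<forall>T2. T2 \<noteq> 0 \<longrightarrow>
    killing (N6_4 0 T2) =
    span {XX, D2, vf (\<lambda>x y. (0, x)), vf (\<lambda>x y. (0, y + x * ln x))})
    \<and> (\<forall>T1 T2. T1 \<noteq> 0 \<longrightarrow> killing (N6_4 T1 T2) = span {XX, D2})"
proof -
  have z: "killing (N6_4 T1 T2) = span {XX, D2}" if "T1 \<noteq> 0" for T1 T2
    unfolding models_as_model
    by (rule killing_eq_span_XX_D2) (use that in \<open>auto simp: quadratic_killing_def\<close>)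
  have b: "killing (N6_4 0 T2) = span {XX, D2, vf (\<lambda>x y. (0, x)), vf (\<lambda>x y. (0, y + x * ln x))}" if "T2 \<noteq> 0" for T2
    unfolding models_as_model by (rule killing_xlnx) (use that in auto)
  show ?thesis using b z dim_killing_gt_2 killing_N6_4 by blast
qed

lemma killing_N6_5_models:
  shows "(\<forall>T1 T2. dim (killing (N6_5 T1 T2)) > 2 \<longrightarrow> T1 = 0)
    \<and> killing (N6_5 0 0) =
    span {XX, D2, vf (\<lambda>x y. (0, y)), vf (\<lambda>x y. (x * y, 0)),
    vf (\<lambda>x y. (0, ln x)), vf (\<lambda>x y. (x * ln x, 0))}
    \<and> (\<forall>T2. T2 \<noteq> 0 \<longrightarrow>
    killing (N6_5 0 T2) =
    span {XX, D2, vf (\<lambda>x y. (0, y)), vf (\<lambda>x y. (0, ln x))})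
    \<and> (\<forall>T1 T2. T1 \<noteq> 0 \<longrightarrow> killing (N6_5 T1 T2) = span {XX, D2})"
proof -
  have z: "killing (N6_5 T1 T2) = span {XX, D2}" if "T1 \<noteq> 0" for T1 T2
    unfolding models_as_model
    by (rule killing_eq_span_XX_D2) (use that in \<open>auto simp: quadratic_killing_def\<close>)
  have b: "killing (N6_5 0 T2) = span {XX, D2, vf (\<lambda>x y. (0, y)), vf (\<lambda>x y. (0, ln x))}" if "T2 \<noteq> 0" for T2
    unfolding models_as_model by (rule killing_ln) (use that in auto)
  show ?thesis using b z dim_killing_gt_2 killing_N6_5 by blast
qed

lemma killing_N6_6_models:
  assumes asm: "c \<noteq> 0 \<and> c \<noteq> - 1"
  shows "(\<forall>T1 T2. dim (killing (N6_6 c T1 T2)) > 2 \<longrightarrow> T1 = 0)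
    \<and> killing (N6_6 c 0 0) =
    span {XX, D2, vf (\<lambda>x y. (0, y)), vf (\<lambda>x y. (x powr (- c), 0)),
    vf (\<lambda>x y. (x powr (- c) * y, 0)), vf (\<lambda>x y. (0, x powr (c + 1)))}
    \<and> (\<forall>T2. T2 \<noteq> 0 \<longrightarrow>
    killing (N6_6 c 0 T2) =
    span {XX, D2, vf (\<lambda>x y. (0, y)), vf (\<lambda>x y. (0, x powr (c + 1)))})
    \<and> (\<forall>T1 T2. T1 \<noteq> 0 \<longrightarrow> killing (N6_6 c T1 T2) = span {XX, D2})"
proof -
  have z: "killing (N6_6 c T1 T2) = span {XX, D2}" if "T1 \<noteq> 0" for T1 T2
    unfolding models_as_model
    by (rule killing_eq_span_XX_D2) (use that asm in \<open>auto simp: quadratic_killing_def\<close>)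
  have n: "c + 1 \<noteq> 0"
    using asm by auto
  have b: "killing (N6_6 c 0 T2) = span {XX, D2, vf (\<lambda>x y. (0, y)), vf (\<lambda>x y. (0, x powr (c + 1)))}" if "T2 \<noteq> 0" for T2
    unfolding models_as_model by (rule killing_powr) (use asm that in auto)
  show ?thesis using b z dim_killing_gt_2 killing_N6_6[OF n] by blast
qed

text \<open>The parameter conditions of the three \<open>N4\<close> families ensure that
  \<open>D * (1 + A - D)\<close> is nonzero. The Ricci bound thus holds for every \<open>T2\<close>,
  zero included, and one description covers all values.\<close>

lemma killing_N4_1_models:
  assumes asm: "\<kappa> \<noteq> 0 \<and> \<kappa> \<noteq> - 1"
  shows "(\<forall>T1 T2. dim (killing (N4_1 \<kappa> T1 T2)) > 2 \<longrightarrow> T1 = 0)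
    \<and> (\<forall>T2. killing (N4_1 \<kappa> 0 T2) =
    span {XX, D2, vf (\<lambda>x y. (0, x)), vf (\<lambda>x y. (x, x * (- ln x)))})
    \<and> (\<forall>T1 T2. T1 \<noteq> 0 \<longrightarrow> killing (N4_1 \<kappa> T1 T2) = span {XX, D2})"
proof -
  have z: "killing (N4_1 \<kappa> T1 T2) = span {XX, D2}" if "T1 \<noteq> 0" for T1 T2
    unfolding models_as_model
    by (rule killing_eq_span_XX_D2) (use that asm in \<open>auto simp: quadratic_killing_def\<close>)
  have a: "killing (N4_1 \<kappa> 0 T2) = span {XX, D2, vf (\<lambda>x y. (0, x)), vf (\<lambda>x y. (x, x * (- ln x)))}" for T2
    unfolding models_as_model by (rule killing_xlnx_alt) (use asm in auto)
  show ?thesis using a z dim_killing_gt_2  by blast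
qed

lemma killing_N4_2_models:
  assumes asm: "\<theta> \<noteq> 0 \<and> \<kappa> * (\<kappa> + \<theta>) \<noteq> 0"
  shows "(\<forall>T1 T2. dim (killing (N4_2 \<kappa> \<theta> T1 T2)) > 2 \<longrightarrow> T1 = 0)
    \<and> (\<forall>T2. killing (N4_2 \<kappa> \<theta> 0 T2) =
    span {XX, D2, vf (\<lambda>x y. (0, y)), vf (\<lambda>x y. (0, x powr \<theta>))})
    \<and> (\<forall>T1 T2. T1 \<noteq> 0 \<longrightarrow> killing (N4_2 \<kappa> \<theta> T1 T2) = span {XX, D2})"
proof -
  have z: "killing (N4_2 \<kappa> \<theta> T1 T2) = span {XX, D2}" if "T1 \<noteq> 0" for T1 T2
    unfolding models_as_model
    by (rule killing_eq_span_XX_D2) (use that asm in \<open>auto simp: quadratic_killing_def\<close>)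
  have a: "killing (N4_2 \<kappa> \<theta> 0 T2) = span {XX, D2, vf (\<lambda>x y. (0, y)), vf (\<lambda>x y. (0, x powr \<theta>))}" for T2
    unfolding models_as_model by (rule killing_powr) (use asm in auto)
  show ?thesis using a z dim_killing_gt_2  by blast
qed

lemma killing_N4_3_models:
  assumes asm: "c \<noteq> 0"
  shows "(\<forall>T1 T2. dim (killing (N4_3 c T1 T2)) > 2 \<longrightarrow> T1 = 0)
    \<and> (\<forall>T2. killing (N4_3 c 0 T2) =
    span {XX, D2, vf (\<lambda>x y. (0, y)), vf (\<lambda>x y. (0, ln x))})
    \<and> (\<forall>T1 T2. T1 \<noteq> 0 \<longrightarrow> killing (N4_3 c T1 T2) = span {XX, D2})"
proof -
  have z: "killing (N4_3 c T1 T2) = span {XX, D2}" if "T1 \<noteq> 0" for T1 T2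
    unfolding models_as_model
    by (rule killing_eq_span_XX_D2) (use that asm in \<open>auto simp: quadratic_killing_def\<close>)
  have a: "killing (N4_3 c 0 T2) = span {XX, D2, vf (\<lambda>x y. (0, y)), vf (\<lambda>x y. (0, ln x))}" for T2
    unfolding models_as_model by (rule killing_ln) (use asm in auto)
  show ?thesis using a z dim_killing_gt_2  by blast
qed

lemma killing_N3_1_models:
  assumes asm: "s \<in> {1, - 1}"
  shows "(\<forall>T1 T2. dim (killing (N3_1 s T1 T2)) > 2 \<longrightarrow> T2 = 0)
    \<and> (\<forall>T1. killing (N3_1 s T1 0) = span {XX, D2, vf (\<lambda>x y. (y * (2 * x), y * y))})
    \<and> (\<forall>T1 T2. T2 \<noteq> 0 \<longrightarrow> killing (N3_1 s T1 T2) = span {XX, D2})"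
proof -
  have z: "killing (N3_1 s T1 T2) = span {XX, D2}" if "T2 \<noteq> 0" for T1 T2
    unfolding models_as_model
    by (rule killing_eq_span_XX_D2) (use that asm in \<open>auto simp: quadratic_killing_def\<close>)
  have n: "s \<noteq> 0"
    using asm by auto
  show ?thesis using z dim_killing_gt_2 killing_N3_1[OF n] by blast
qed

lemma killing_N3_2_models:
  shows "(\<forall>T1 T2. dim (killing (N3_2 c T1 T2)) > 2 \<longrightarrow> T2 = 0)
    \<and> (\<forall>T1. killing (N3_2 c T1 0) = span {XX, D2, vf (\<lambda>x y. (y * (2 * x), y * y))})
    \<and> (\<forall>T1 T2. T2 \<noteq> 0 \<longrightarrow> killing (N3_2 c T1 T2) = span {XX, D2})"
proof -
  have z: "killing (N3_2 c T1 T2) = span {XX, D2}" if "T2 \<noteq> 0" for T1 T2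
    unfolding models_as_model
    by (rule killing_eq_span_XX_D2) (use that in \<open>auto simp: quadratic_killing_def\<close>)
  show ?thesis using z dim_killing_gt_2 killing_N3_2 by blast
qed

lemma killing_N3_3_models:
  shows "(\<forall>T1 T2. dim (killing (N3_3 T1 T2)) > 2 \<longrightarrow> T1 = 0 \<and> T2 = 0)
    \<and> killing (N3_3 0 0) = span {XX, D2, vf (\<lambda>x y. (2 * x * y, y^2 + x^2))}
    \<and> (\<forall>T1 T2. \<not> (T1 = 0 \<and> T2 = 0) \<longrightarrow> killing (N3_3 T1 T2) = span {XX, D2})"
proof -
  have z: "killing (N3_3 T1 T2) = span {XX, D2}" if "\<not> (T1 = 0 \<and> T2 = 0)" for T1 T2
    unfolding models_as_model
    by (rule killing_eq_span_XX_D2) (use that in \<open>auto simp: quadratic_killing_def\<close>)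
  show ?thesis using z dim_killing_gt_2 killing_N3_3 by blast
qed

lemma killing_N3_4_models:
  shows "(\<forall>T1 T2. dim (killing (N3_4 T1 T2)) > 2 \<longrightarrow> T1 = 0 \<and> T2 = 0)
    \<and> killing (N3_4 0 0) = span {XX, D2, vf (\<lambda>x y. (2 * x * y, y^2 - x^2))}
    \<and> (\<forall>T1 T2. \<not> (T1 = 0 \<and> T2 = 0) \<longrightarrow> killing (N3_4 T1 T2) = span {XX, D2})"
proof -
  have z: "killing (N3_4 T1 T2) = span {XX, D2}" if "\<not> (T1 = 0 \<and> T2 = 0)" for T1 T2
    unfolding models_as_model
    by (rule killing_eq_span_XX_D2) (use that in \<open>auto simp: quadratic_killing_def\<close>)
  show ?thesis using z dim_killing_gt_2 killing_N3_4 by blast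
qed

theorem mainTheorem5:
  shows
    "(\<forall>\<xi> T1 T2. torsion_params \<xi> T1 T2 \<and> dim (killing \<xi>) > 2 \<longrightarrow>
       (\<exists>t2. linearly_equivalent \<xi> (N6_0 0 t2))
     \<or> (\<exists>s\<in>{1, - 1}. linearly_equivalent \<xi> (N6_1 s 0 0))
     \<or> (\<exists>c t1 t2. c \<noteq> 0 \<and> (t1 = 0 \<or> c = - 1/2 \<and> t2 = 0) \<and> linearly_equivalent \<xi> (N6_2 c t1 t2))
     \<or> (\<exists>t2. linearly_equivalent \<xi> (N6_3 0 t2))
     \<or> (\<exists>t2. linearly_equivalent \<xi> (N6_4 0 t2))
     \<or> (\<exists>t2. linearly_equivalent \<xi> (N6_5 0 t2))
     \<or> (\<exists>c t2. c \<noteq> 0 \<and> c \<noteq> - 1 \<and> linearly_equivalent \<xi> (N6_6 c 0 t2))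
     \<or> (\<exists>\<kappa> t2. \<kappa> \<noteq> 0 \<and> \<kappa> \<noteq> - 1 \<and> linearly_equivalent \<xi> (N4_1 \<kappa> 0 t2))
     \<or> (\<exists>\<kappa> \<theta> t2. \<theta> \<noteq> 0 \<and> \<kappa> * (\<kappa> + \<theta>) \<noteq> 0 \<and> linearly_equivalent \<xi> (N4_2 \<kappa> \<theta> 0 t2))
     \<or> (\<exists>c t2. c \<noteq> 0 \<and> linearly_equivalent \<xi> (N4_3 c 0 t2))
     \<or> (\<exists>s\<in>{1, - 1}. \<exists>t1. linearly_equivalent \<xi> (N3_1 s t1 0))
     \<or> (\<exists>c t1. linearly_equivalent \<xi> (N3_2 c t1 0))
     \<or> linearly_equivalent \<xi> (N3_3 0 0)
     \<or> linearly_equivalent \<xi> (N3_4 0 0))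

   \<and>
     (killing (N6_0 0 0) = span {D1, D2, vf (\<lambda>x y. (x, 0)), vf (\<lambda>x y. (0, x)),
                                 vf (\<lambda>x y. (y, 0)), vf (\<lambda>x y. (0, y))}
      \<and> (\<forall>T2. T2 \<noteq> 0 \<longrightarrow>
           killing (N6_0 0 T2) = span {XX, D2, vf (\<lambda>x y. (0, x)), vf (\<lambda>x y. (0, y))})
      \<and> (\<forall>T1 T2. T1 \<noteq> 0 \<longrightarrow> killing (N6_0 T1 T2) = span {XX, D2}))

   \<and>
     (\<forall>s\<in>{1, - 1}.
        (\<forall>T1 T2. dim (killing (N6_1 s T1 T2)) > 2 \<longrightarrow> T1 = 0 \<and> T2 = 0)
      \<and> killing (N6_1 s 0 0) =
          span {XX, D2, vf (\<lambda>x y. (1 / x, 0)), vf (\<lambda>x y. (y / x, 0)),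
                vf (\<lambda>x y. ((x^2 + s * y^2) / x, 0)),
                vf (\<lambda>x y. (- y * (y^2 + s * x^2) / x, x^2 + s * y^2))}
      \<and> (\<forall>T1 T2. \<not> (T1 = 0 \<and> T2 = 0) \<longrightarrow> killing (N6_1 s T1 T2) = span {XX, D2}))

   \<and>
     (\<forall>c. c \<noteq> 0 \<longrightarrow>
        (\<forall>T1 T2. dim (killing (N6_2 c T1 T2)) > 2 \<longrightarrow> T1 * T2 = 0)
      \<and> killing (N6_2 c 0 0) =
          span {vf (\<lambda>x y. (x, 0)), vf (\<lambda>x y. (0, y)), D2,
                vf (\<lambda>x y. (0, x powr (- c))),
                vf (\<lambda>x y. (x powr (- c) * x, x powr (- c) * (- c * y))),
                vf (\<lambda>x y. (y * x, y * (- c * y)))}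
      \<and> (\<forall>T2. T2 \<noteq> 0 \<longrightarrow>
           killing (N6_2 c 0 T2) =
             span {XX, D2, vf (\<lambda>x y. (0, y)), vf (\<lambda>x y. (0, x powr (- c)))})
      \<and> (\<forall>T1. c = - 1/2 \<and> T1 \<noteq> 0 \<longrightarrow>
           killing (N6_2 c T1 0) = span {XX, D2, vf (\<lambda>x y. (y * x, y * (1/2 * y)))})
      \<and> (\<forall>T1 T2. \<not> (T1 = 0 \<or> c = - 1/2 \<and> T2 = 0) \<longrightarrow>
           killing (N6_2 c T1 T2) = span {XX, D2}))

   \<and>
     ((\<forall>T1 T2. dim (killing (N6_3 T1 T2)) > 2 \<longrightarrow> T1 = 0)
      \<and> killing (N6_3 0 0) =
          span {XX, D2, vf (\<lambda>x y. (0, x)), vf (\<lambda>x y. (0, y + x * ln x)),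
                vf (\<lambda>x y. (- (x^2), x * (x - y))),
                vf (\<lambda>x y. ((y + x * ln x) * (- x), (y + x * ln x) * (x - y)))}
      \<and> (\<forall>T2. T2 \<noteq> 0 \<longrightarrow>
           killing (N6_3 0 T2) =
             span {XX, D2, vf (\<lambda>x y. (0, x)), vf (\<lambda>x y. (0, y + x * ln x))})
      \<and> (\<forall>T1 T2. T1 \<noteq> 0 \<longrightarrow> killing (N6_3 T1 T2) = span {XX, D2}))

   \<and>
     ((\<forall>T1 T2. dim (killing (N6_4 T1 T2)) > 2 \<longrightarrow> T1 = 0)
      \<and> killing (N6_4 0 0) =
          span {XX, D2, vf (\<lambda>x y. (0, x)), vf (\<lambda>x y. (0, y + x * ln x)),
                vf (\<lambda>x y. (1, - (1 + ln x))),
                vf (\<lambda>x y. (y + x * ln x, (y + x * ln x) * (- (1 + ln x))))}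
      \<and> (\<forall>T2. T2 \<noteq> 0 \<longrightarrow>
           killing (N6_4 0 T2) =
             span {XX, D2, vf (\<lambda>x y. (0, x)), vf (\<lambda>x y. (0, y + x * ln x))})
      \<and> (\<forall>T1 T2. T1 \<noteq> 0 \<longrightarrow> killing (N6_4 T1 T2) = span {XX, D2}))

   \<and>
     ((\<forall>T1 T2. dim (killing (N6_5 T1 T2)) > 2 \<longrightarrow> T1 = 0)
      \<and> killing (N6_5 0 0) =
          span {XX, D2, vf (\<lambda>x y. (0, y)), vf (\<lambda>x y. (x * y, 0)),
                vf (\<lambda>x y. (0, ln x)), vf (\<lambda>x y. (x * ln x, 0))}
      \<and> (\<forall>T2. T2 \<noteq> 0 \<longrightarrow>
           killing (N6_5 0 T2) =
             span {XX, D2, vf (\<lambda>x y. (0, y)), vf (\<lambda>x y. (0, ln x))})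
      \<and> (\<forall>T1 T2. T1 \<noteq> 0 \<longrightarrow> killing (N6_5 T1 T2) = span {XX, D2}))

   \<and>
     (\<forall>c. c \<noteq> 0 \<and> c \<noteq> - 1 \<longrightarrow>
        (\<forall>T1 T2. dim (killing (N6_6 c T1 T2)) > 2 \<longrightarrow> T1 = 0)
      \<and> killing (N6_6 c 0 0) =
          span {XX, D2, vf (\<lambda>x y. (0, y)), vf (\<lambda>x y. (x powr (- c), 0)),
                vf (\<lambda>x y. (x powr (- c) * y, 0)), vf (\<lambda>x y. (0, x powr (c + 1)))}
      \<and> (\<forall>T2. T2 \<noteq> 0 \<longrightarrow>
           killing (N6_6 c 0 T2) =
             span {XX, D2, vf (\<lambda>x y. (0, y)), vf (\<lambda>x y. (0, x powr (c + 1)))})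
      \<and> (\<forall>T1 T2. T1 \<noteq> 0 \<longrightarrow> killing (N6_6 c T1 T2) = span {XX, D2}))

   \<and>
     (\<forall>\<kappa>. \<kappa> \<noteq> 0 \<and> \<kappa> \<noteq> - 1 \<longrightarrow>
        (\<forall>T1 T2. dim (killing (N4_1 \<kappa> T1 T2)) > 2 \<longrightarrow> T1 = 0)
      \<and> (\<forall>T2. killing (N4_1 \<kappa> 0 T2) =
           span {XX, D2, vf (\<lambda>x y. (0, x)), vf (\<lambda>x y. (x, x * (- ln x)))})
      \<and> (\<forall>T1 T2. T1 \<noteq> 0 \<longrightarrow> killing (N4_1 \<kappa> T1 T2) = span {XX, D2}))

   \<and>
     (\<forall>\<kappa> \<theta>. \<theta> \<noteq> 0 \<and> \<kappa> * (\<kappa> + \<theta>) \<noteq> 0 \<longrightarrow>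
        (\<forall>T1 T2. dim (killing (N4_2 \<kappa> \<theta> T1 T2)) > 2 \<longrightarrow> T1 = 0)
      \<and> (\<forall>T2. killing (N4_2 \<kappa> \<theta> 0 T2) =
           span {XX, D2, vf (\<lambda>x y. (0, y)), vf (\<lambda>x y. (0, x powr \<theta>))})
      \<and> (\<forall>T1 T2. T1 \<noteq> 0 \<longrightarrow> killing (N4_2 \<kappa> \<theta> T1 T2) = span {XX, D2}))

   \<and>
     (\<forall>c. c \<noteq> 0 \<longrightarrow>
        (\<forall>T1 T2. dim (killing (N4_3 c T1 T2)) > 2 \<longrightarrow> T1 = 0)
      \<and> (\<forall>T2. killing (N4_3 c 0 T2) =
           span {XX, D2, vf (\<lambda>x y. (0, y)), vf (\<lambda>x y. (0, ln x))})
      \<and> (\<forall>T1 T2. T1 \<noteq> 0 \<longrightarrow> killing (N4_3 c T1 T2) = span {XX, D2}))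

   \<and>
     (\<forall>s\<in>{1, - 1}.
        (\<forall>T1 T2. dim (killing (N3_1 s T1 T2)) > 2 \<longrightarrow> T2 = 0)
      \<and> (\<forall>T1. killing (N3_1 s T1 0) = span {XX, D2, vf (\<lambda>x y. (y * (2 * x), y * y))})
      \<and> (\<forall>T1 T2. T2 \<noteq> 0 \<longrightarrow> killing (N3_1 s T1 T2) = span {XX, D2}))

   \<and>
     (\<forall>c.
        (\<forall>T1 T2. dim (killing (N3_2 c T1 T2)) > 2 \<longrightarrow> T2 = 0)
      \<and> (\<forall>T1. killing (N3_2 c T1 0) = span {XX, D2, vf (\<lambda>x y. (y * (2 * x), y * y))})
      \<and> (\<forall>T1 T2. T2 \<noteq> 0 \<longrightarrow> killing (N3_2 c T1 T2) = span {XX, D2}))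

   \<and>
     ((\<forall>T1 T2. dim (killing (N3_3 T1 T2)) > 2 \<longrightarrow> T1 = 0 \<and> T2 = 0)
      \<and> killing (N3_3 0 0) = span {XX, D2, vf (\<lambda>x y. (2 * x * y, y^2 + x^2))}
      \<and> (\<forall>T1 T2. \<not> (T1 = 0 \<and> T2 = 0) \<longrightarrow> killing (N3_3 T1 T2) = span {XX, D2}))

   \<and>
     ((\<forall>T1 T2. dim (killing (N3_4 T1 T2)) > 2 \<longrightarrow> T1 = 0 \<and> T2 = 0)
      \<and> killing (N3_4 0 0) = span {XX, D2, vf (\<lambda>x y. (2 * x * y, y^2 - x^2))}
      \<and> (\<forall>T1 T2. \<not> (T1 = 0 \<and> T2 = 0) \<longrightarrow> killing (N3_4 T1 T2) = span {XX, D2}))"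
proof (rule conjI, goal_cases)
  case 1
  \<comment> \<open>\<open>listed\<close> repeats this conclusion literally, so that it can be
    folded.\<close>
  show ?case unfolding listed_def[symmetric] using listed_if_dim_gt_2 by blast
qed (rule conjI, rule killing_N6_0_models, rule conjI, rule ballI, erule killing_N6_1_models, rule conjI,
    rule allI, rule impI, erule killing_N6_2_models, rule conjI, rule killing_N6_3_models, rule conjI,
    rule killing_N6_4_models, rule conjI, rule killing_N6_5_models, rule conjI,
    rule allI, rule impI, erule killing_N6_6_models, rule conjI,
    rule allI, rule impI, erule killing_N4_1_models, rule conjI,
    rule allI, rule allI, rule impI, erule killing_N4_2_models, rule conjI,
    rule allI, rule impI, erule killing_N4_3_models, rule conjI, rule ballI, erule killing_N3_1_models,
    rule conjI, rule allI, rule killing_N3_2_models, rule conjI, rule killing_N3_3_models,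
    rule killing_N3_4_models)

end
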